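(* Let $D$ be a Dedekind domain with countably many maximal ideals and let $\alpha$ be a nonzero countable ordinal. Then there is an almost Dedekind domain $A$ such that $D\subseteq A$ is an integral extension and the SP-rank of $A$ is $\alpha$.
   Context: An integral domain $A$ with quotient field $F$ is almost Dedekind if $A_M$ is a discrete valuation ring for every $M\in\mathrm{Max}(A)$. A maximal ideal $M$ of $A$ is critical if it contains no nonzero finitely generated radical ideal; $\mathrm{Crit}(A)$ is the set of critical maximal ideals of $A$. Define recursively, for ordinals $\alpha$: $T_0=A$ and $\mathrm{Crit}^0(A)=\mathrm{Max}(A)$; if $\alpha=\beta+1$, $\mathrm{Crit}^\alpha(A)=\{P\in\mathrm{Max}(A): PT_\beta\in\mathrm{Crit}(T_\beta)\}$; if $\alpha$ is a limit ordinal, $\mathrm{Crit}^\alpha(A)=\bigcap_{\beta<\alpha}\mathrm{Crit}^\beta(A)$; and $T_\alpha=\bigcap\{A_M: M\in\mathrm{Crit}^\alpha(A)\}$ (with $T_\alpha=F$ if $\mathrm{Crit}^\alpha(A)=\emptyset$). The maximal ideals of $T_\alpha$ are exactly the extensions of the elements of $\mathrm{Crit}^\alpha(A)$. The SP-rank of $A$ is the smallest ordinal $\alpha$ such that $\mathrm{Crit}^\alpha(A)=\emptyset$; it always exists.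
   Formalization: "Countably many maximal ideals" is taken to mean countably infinitely many; with finitely many the claim fails: for D the p-adic integers no such A has SP-rank 2, and for any such D no limit ordinal is an SP-rank. *)

theory Defs
  imports "HOL-Algebra.Algebraic_Closure_Type" "HOL-Library.Countable_Set"
begin

text \<open>
  Integral domains are represented as subrings of an ambient field type. The ring-theoretic notions
  (ideals, maximal ideals, PIDs, Noetherian rings) are those of HOL-Algebra, applied to the ring
  structure that a subset inherits from the ambient field. Quotient fields, localizations and
  overrings of a domain are computed inside the ambient field, which may be larger than the
  quotient field.
\<close>

definition subring_of :: "'k::field set \<Rightarrow> 'k ring" where
  "subring_of A = ring_of_type_algebra\<lparr>carrier := A\<rparr>"

definition integral_domain :: "'k::field set \<Rightarrow> bool" where
  "integral_domain A \<longleftrightarrow> subring A ring_of_type_algebra"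

definition quotient_field :: "'k::field set \<Rightarrow> 'k set" where
  "quotient_field A = {a / b | a b. a \<in> A \<and> b \<in> A \<and> b \<noteq> 0}"

definition max_spec :: "'k::field set \<Rightarrow> 'k set set" where
  "max_spec A = {M. maximalideal M (subring_of A)}"

definition localization :: "'k::field set \<Rightarrow> 'k set \<Rightarrow> 'k set" where
  "localization A P = {a / s | a s. a \<in> A \<and> s \<in> A - P}"

definition generated_ideal :: "'k::field set \<Rightarrow> 'k set \<Rightarrow> 'k set" where
  "generated_ideal A S = genideal (subring_of A) S"

definition integral_over :: "'k::field set \<Rightarrow> 'k \<Rightarrow> bool" where
  "integral_over D x \<longleftrightarrow>
     (\<exists>p :: 'k poly. Polynomial.lead_coeff p = 1 \<and> (\<forall>i. Polynomial.coeff p i \<in> D) \<and> poly p x = 0)"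

definition integral_extension :: "'k::field set \<Rightarrow> 'k set \<Rightarrow> bool" where
  "integral_extension D A \<longleftrightarrow> D \<subseteq> A \<and> (\<forall>x\<in>A. integral_over D x)"

text \<open>
  Fields are neither discrete valuation rings, nor (almost) Dedekind domains. For almost Dedekind
  domains this is a consequence: the localization of a field at its zero ideal is a field.
\<close>

definition discrete_valuation_ring :: "'k::field set \<Rightarrow> bool" where
  "discrete_valuation_ring V \<longleftrightarrow>
     principal_domain (subring_of V) \<and> \<not> Ring.field (subring_of V) \<and> (\<exists>!M. M \<in> max_spec V)"

definition dedekind_domain :: "'k::field set \<Rightarrow> bool" where
  "dedekind_domain D \<longleftrightarrow>
     integral_domain D \<and> \<not> Ring.field (subring_of D) \<and>
     noetherian_ring (subring_of D) \<and>
     (\<forall>x\<in>quotient_field D. integral_over D x \<longrightarrow> x \<in> D) \<and>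
     (\<forall>P. primeideal P (subring_of D) \<and> P \<noteq> {0} \<longrightarrow> maximalideal P (subring_of D))"

definition almost_dedekind_domain :: "'k::field set \<Rightarrow> bool" where
  "almost_dedekind_domain A \<longleftrightarrow>
     integral_domain A \<and> (\<forall>M\<in>max_spec A. discrete_valuation_ring (localization A M))"

definition finitely_generated_ideal :: "'k::field set \<Rightarrow> 'k set \<Rightarrow> bool" where
  "finitely_generated_ideal A I \<longleftrightarrow> (\<exists>S. finite S \<and> S \<subseteq> A \<and> I = generated_ideal A S)"

definition radical_ideal :: "'k::field set \<Rightarrow> 'k set \<Rightarrow> bool" where
  "radical_ideal A I \<longleftrightarrow> ideal I (subring_of A) \<and> (\<forall>x\<in>A. \<forall>n::nat. x ^ n \<in> I \<longrightarrow> x \<in> I)"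

definition crit :: "'k::field set \<Rightarrow> 'k set set" where
  "crit A = {M \<in> max_spec A.
     \<not> (\<exists>I. finitely_generated_ideal A I \<and> radical_ideal A I \<and> I \<noteq> {0} \<and> I \<subseteq> M)}"

text \<open>
  An element \<open>\<alpha>\<close> of a well-ordered type stands for the ordinal that is the order type of
  \<open>{..<\<alpha>}\<close>. Every ordinal arises in this way, and all notions below depend only on this order
  type, since they only refer to elements up to \<open>\<alpha>\<close>.
\<close>

definition zero_ordinal :: "'o::wellorder \<Rightarrow> bool" where
  "zero_ordinal \<alpha> \<longleftrightarrow> {..<\<alpha>} = {}"

definition successor_of :: "'o::wellorder \<Rightarrow> 'o \<Rightarrow> bool" where
  "successor_of \<beta> \<alpha> \<longleftrightarrow> \<beta> < \<alpha> \<and> {\<beta><..<\<alpha>} = {}"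

text \<open>
  \<open>crit_iter A \<alpha>\<close> is $\mathrm{Crit}^\alpha(A)$ and \<open>overring_iter A \<alpha>\<close> is $T_\alpha$.
  The ideal of $T_\beta$ generated by \<open>P\<close> is the extension $P T_\beta$.
\<close>

function crit_iter :: "'k::field set \<Rightarrow> 'o::wellorder \<Rightarrow> 'k set set"
  and overring_iter :: "'k::field set \<Rightarrow> 'o::wellorder \<Rightarrow> 'k set" where
  "crit_iter A \<alpha> =
     (if zero_ordinal \<alpha> then max_spec A
      else if \<exists>\<beta>. successor_of \<beta> \<alpha> then
        {P \<in> max_spec A. \<exists>\<beta>\<in>{\<beta>. successor_of \<beta> \<alpha>}.
           generated_ideal (overring_iter A \<beta>) P \<in> crit (overring_iter A \<beta>)}
      else (\<Inter>\<beta>\<in>{..<\<alpha>}. crit_iter A \<beta>))"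
| "overring_iter A \<alpha> =
     (if zero_ordinal \<alpha> then A
      else if crit_iter A \<alpha> = {} then quotient_field A
      else (\<Inter>M\<in>crit_iter A \<alpha>. localization A M))"
  by pat_completeness auto
termination
proof (relation "inv_image ({(x, y). x < y} <*lex*> less_than)
    (\<lambda>s. case s of Inl (_, \<alpha>) \<Rightarrow> (\<alpha>, 0) | Inr (_, \<alpha>) \<Rightarrow> (\<alpha>, 1::nat))")
qed (auto simp: wf successor_of_def)

declare crit_iter.simps [simp del] overring_iter.simps [simp del]

lemma crit_iter_zero: "zero_ordinal \<alpha> \<Longrightarrow> crit_iter A \<alpha> = max_spec A"
  by (simp add: crit_iter.simps)

lemma crit_iter_successor:
  assumes "successor_of \<beta> \<alpha>"
  shows "crit_iter A \<alpha> =
    {P \<in> max_spec A. generated_ideal (overring_iter A \<beta>) P \<in> crit (overring_iter A \<beta>)}"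
proof -
  have "\<gamma> = \<beta>" if "successor_of \<gamma> \<alpha>" for \<gamma>
    using that assms
    by (cases \<gamma> \<beta> rule: linorder_cases) (auto simp: successor_of_def set_eq_iff)
  hence "{\<gamma>. successor_of \<gamma> \<alpha>} = {\<beta>}"
    using assms by blast
  moreover have "\<not> zero_ordinal \<alpha>" "\<exists>\<beta>. successor_of \<beta> \<alpha>"
    using assms by (auto simp: successor_of_def zero_ordinal_def)
  ultimately show ?thesis
    by (subst crit_iter.simps) simp
qed

lemma crit_iter_limit:
  assumes "\<not> zero_ordinal \<alpha>" and "\<nexists>\<beta>. successor_of \<beta> \<alpha>"
  shows "crit_iter A \<alpha> = (\<Inter>\<beta>\<in>{..<\<alpha>}. crit_iter A \<beta>)"
  using assms by (subst crit_iter.simps) simp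

text \<open>
  The SP-rank is expressed as a relation because the type \<open>'o\<close> need not contain the SP-rank of
  every domain.
\<close>

definition has_SP_rank :: "'k::field set \<Rightarrow> 'o::wellorder \<Rightarrow> bool" where
  "has_SP_rank A \<alpha> \<longleftrightarrow> crit_iter A \<alpha> = {} \<and> (\<forall>\<beta>. crit_iter A \<beta> = {} \<longrightarrow> \<alpha> \<le> \<beta>)"

end

theory Submission
  imports Defs
begin

text \<open>
  The domain \<open>A\<close> is the union of a tower \<open>D 0 \<subseteq> D 1 \<subseteq> \<dots>\<close> of Dedekind domains over \<open>D\<close>, each obtained from
  the previous one by quadratic extensions. A maximal ideal of \<open>A\<close> is a branch of the tree of maximal
  ideals of the \<open>D n\<close>, and it is critical if and only if the total ramification index fails to be locally
  constant at it. At every stage the ramification over finitely many ideals can be prescribed, using a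
  polynomial that is \<open>X (X - 1)\<close> modulo the ideals to be split and Eisenstein at the ideals to be ramified.
  Every ideal carries an ordinal below \<open>\<alpha>\<close>. Over an ideal with label \<open>\<gamma> > 0\<close> there is an unramified
  ideal with the same label and a ramified one with a smaller label, chosen such that along an
  unramified branch every \<open>\<delta> < \<gamma>\<close> is used infinitely often; over ideals with label 0 nothing ramifies.
  The label along a branch stabilizes at an ordinal, the rank of the branch, and the branches of rank
  at least \<open>\<delta>\<close> form the \<open>\<delta>\<close>-th set of critical ideals. Since \<open>D\<close> has infinitely many maximal ideals, the
  initial labels can be chosen to exhaust all ordinals below \<open>\<alpha>\<close>.
\<close>

section \<open>Subrings of a field\<close>

text \<open>Why local ramification decides criticality: the generators of a finitely generated ideal
  lie in the quotient field of one \<open>D n\<close>. If no branch near \<open>M\<close> ramifies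
  after stage \<open>n\<close>, elements of \<open>D n\<close> generate the ideal of everything with
  positive value near \<open>M\<close>, which is radical. If branches arbitrarily close to
  \<open>M\<close> ramify after every stage, an ideal generated at stage \<open>n\<close> and
  contained in \<open>M\<close> takes only values at least 2 at one of them, which a nonzero radical
  ideal cannot do. "Near" refers to the critical set reached so far. Labels drop strictly at each
  ramification, so by well-foundedness every branch ramifies only finitely often under control;
  hence the localizations of \<open>A\<close> stay discrete although ramification recurs around
  critical ideals. A quadratic step treats conjugate ideals alike, so ramifying only one of the
  ideals over a given one takes two steps. For the rings \<open>D n\<close>, Dedekind is replaced by
  discrete valuations plus finite character, which norms carry to quadratic extensions. All rings
  lie in an algebraic closure, so roots exist and the limit is a plain union.\<close>

definition is_ideal :: "'k::field set \<Rightarrow> 'k set \<Rightarrow> bool" where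
  "is_ideal A I \<longleftrightarrow> I \<subseteq> A \<and> 0 \<in> I \<and> (\<forall>x\<in>I. \<forall>y\<in>I. x + y \<in> I) \<and> (\<forall>a\<in>A. \<forall>x\<in>I. a * x \<in> I)"

definition is_prime :: "'k::field set \<Rightarrow> 'k set \<Rightarrow> bool" where
  "is_prime A P \<longleftrightarrow> is_ideal A P \<and> 1 \<notin> P \<and> (\<forall>x\<in>A. \<forall>y\<in>A. x * y \<in> P \<longrightarrow> x \<in> P \<or> y \<in> P)"

lemma subring_of_simps [simp]:
  "carrier (subring_of A) = A" "\<zero>\<^bsub>subring_of A\<^esub> = 0" "\<one>\<^bsub>subring_of A\<^esub> = 1"
  "x \<oplus>\<^bsub>subring_of A\<^esub> y = x + y" "x \<otimes>\<^bsub>subring_of A\<^esub> y = x * y"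
  by (simp_all add: subring_of_def ring_of_type_algebra_def)

lemma cring_subring_of:
  assumes "1 \<in> A" "\<And>x y. x \<in> A \<Longrightarrow> y \<in> A \<Longrightarrow> x - y \<in> A" "\<And>x y. x \<in> A \<Longrightarrow> y \<in> A \<Longrightarrow> x * y \<in> (A :: 'k::field set)"
  shows "cring (subring_of A)"
proof -
  have z: "0 \<in> A" using assms(1) assms(2)[of 1 1] by simp
  have neg: "- x \<in> A" if "x \<in> A" for x using assms(2)[OF z that] by simp
  have add: "x + y \<in> A" if "x \<in> A" "y \<in> A" for x y using assms(2)[OF that(1) neg[OF that(2)]] by simp
  show ?thesis
  proof (rule cringI)
    show "abelian_group (subring_of A)"
    proof (rule abelian_groupI)
      fix x assume "x \<in> carrier (subring_of A)"
      thus "\<exists>y\<in>carrier (subring_of A). y \<oplus>\<^bsub>subring_of A\<^esub> x = \<zero>\<^bsub>subring_of A\<^esub>"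
        using neg by (intro bexI[of _ "- x"]) auto
    qed (auto simp: z add add.assoc add.commute)
    show "comm_monoid (subring_of A)"
      by (rule comm_monoidI) (auto simp: assms mult.assoc mult.commute)
  qed (auto simp: algebra_simps)
qed

lemma integral_domain_iff:
  "integral_domain A \<longleftrightarrow> 1 \<in> A \<and> (\<forall>x\<in>A. \<forall>y\<in>A. x - y \<in> A \<and> x * y \<in> A)" (is "_ = ?R")
proof
  interpret R: ring "ring_of_type_algebra :: 'a ring" by (rule ring_from_type_algebra)
  have carr: "carrier (ring_of_type_algebra :: 'a ring) = UNIV" by (simp add: ring_of_type_algebra_def)
  have op: "\<one>\<^bsub>ring_of_type_algebra\<^esub> = (1::'a)" "\<zero>\<^bsub>ring_of_type_algebra\<^esub> = (0::'a)"
    "x \<oplus>\<^bsub>ring_of_type_algebra\<^esub> y = x + y"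
    "x \<otimes>\<^bsub>ring_of_type_algebra\<^esub> y = x * y" for x y :: 'a by (simp_all add: ring_of_type_algebra_def)
  have ainv: "\<ominus>\<^bsub>ring_of_type_algebra\<^esub> x = - x" for x :: 'a
    using R.minus_equality[of "-x" x] by (simp add: op carr)
  {
    assume "integral_domain A"
    hence s: "subring A ring_of_type_algebra" by (simp add: integral_domain_def)
    note E = subringE[OF s, unfolded op ainv]
    show ?R
    proof (intro conjI ballI)
      fix x y assume xy: "x \<in> A" "y \<in> A"
      show "x - y \<in> A" using E(7)[OF xy(1) E(5)[OF xy(2)]] by simp
      show "x * y \<in> A" using E(6)[OF xy] .
    qed (use E(3) in simp)
  next
    assume r: ?R
    have z: "0 \<in> A" using r by (metis diff_self)
    have neg: "- x \<in> A" if "x \<in> A" for x using r z that by (metis diff_0)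
    have add: "x + y \<in> A" if "x \<in> A" "y \<in> A" for x y using r neg that by (metis diff_minus_eq_add)
    show "integral_domain A" unfolding integral_domain_def
      by (rule R.subringI) (use r z neg add in \<open>auto simp: carr op ainv\<close>)
  }
qed

locale field_subring = fixes A :: "'k::field set" assumes integral_domain: "integral_domain A"
begin

lemma one_mem [simp]: "1 \<in> A"
  and diff_mem [simp]: "x \<in> A \<Longrightarrow> y \<in> A \<Longrightarrow> x - y \<in> A"
  and mult_mem [simp]: "x \<in> A \<Longrightarrow> y \<in> A \<Longrightarrow> x * y \<in> A"
  using integral_domain by (auto simp: integral_domain_iff)

lemma zero_mem [simp]: "0 \<in> A"
  using diff_mem[OF one_mem one_mem] by simp

lemma uminus_mem [simp]: "x \<in> A \<Longrightarrow> - x \<in> A"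
  using diff_mem[OF zero_mem] by fastforce

lemma add_mem [simp]: "x \<in> A \<Longrightarrow> y \<in> A \<Longrightarrow> x + y \<in> A"
  using diff_mem[of x "- y"] by simp

lemma numeral_mem [simp]: "numeral n \<in> A"
proof -
  have "of_nat k \<in> A" for k by (induction k) auto
  from this[of "numeral n"] show ?thesis by simp
qed

lemma power_mem [simp]: "x \<in> A \<Longrightarrow> x ^ n \<in> A"
  by (induction n) auto

lemma sum_mem: "(\<And>i. i \<in> S \<Longrightarrow> f i \<in> A) \<Longrightarrow> (\<Sum>i\<in>S. f i) \<in> A"
  by (induction S rule: infinite_finite_induct) auto

lemma is_cring: "cring (subring_of A)"
  by (rule cring_subring_of) auto

lemma is_domain: "domain (subring_of A)"
proof -
  interpret cring "subring_of A" by (rule is_cring)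
  show ?thesis by unfold_locales auto
qed

lemma ideal_iff: "ideal I (subring_of A) \<longleftrightarrow> is_ideal A I"
proof
  interpret cring "subring_of A" by (rule is_cring)
  {
    assume "ideal I (subring_of A)"
    then interpret I: ideal I "subring_of A" .
    show "is_ideal A I" unfolding is_ideal_def
      using I.a_subset I.zero_closed I.a_closed I.I_l_closed by simp
  next
    assume i: "is_ideal A I"
    have sub: "x \<in> A" if "x \<in> I" for x using i that by (auto simp: is_ideal_def)
    have neg: "- x \<in> I" if "x \<in> I" for x
    proof -
      have "(-1) * x \<in> I" using i that uminus_mem[OF one_mem] unfolding is_ideal_def by blast
      thus ?thesis by simp
    qed
    have minv: "\<ominus>\<^bsub>subring_of A\<^esub> x = - x" if "x \<in> A" for x
      using minus_equality[of "-x" x] that by simp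
    show "ideal I (subring_of A)"
    proof (rule idealI)
      show "subgroup I (add_monoid (subring_of A))"
      proof (rule add.subgroupI)
        fix a assume "a \<in> I" thus "\<ominus>\<^bsub>subring_of A\<^esub> a \<in> I" using minv neg sub by simp
      qed (use i in \<open>auto simp: is_ideal_def\<close>)
    next
      fix a x assume "a \<in> I" "x \<in> carrier (subring_of A)"
      hence "x * a \<in> I" using i by (auto simp: is_ideal_def)
      thus "x \<otimes>\<^bsub>subring_of A\<^esub> a \<in> I" "a \<otimes>\<^bsub>subring_of A\<^esub> x \<in> I" by (simp_all add: mult.commute)
    qed (rule ring_axioms)
  }
qed

lemma idealD:
  assumes "is_ideal A I"
  shows "x \<in> I \<Longrightarrow> x \<in> A" "0 \<in> I" "x \<in> I \<Longrightarrow> y \<in> I \<Longrightarrow> x + y \<in> I"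
    "a \<in> A \<Longrightarrow> x \<in> I \<Longrightarrow> a * x \<in> I" "a \<in> A \<Longrightarrow> x \<in> I \<Longrightarrow> x * a \<in> I" 
    "x \<in> I \<Longrightarrow> - x \<in> I" "x \<in> I \<Longrightarrow> y \<in> I \<Longrightarrow> x - y \<in> I"
proof -
  have b: "x \<in> I \<Longrightarrow> x \<in> A" "x \<in> I \<Longrightarrow> y \<in> I \<Longrightarrow> x + y \<in> I" "a \<in> A \<Longrightarrow> x \<in> I \<Longrightarrow> a * x \<in> I" for a x y
    using assms by (auto simp: is_ideal_def)
  show "x \<in> I \<Longrightarrow> x \<in> A" "0 \<in> I" "x \<in> I \<Longrightarrow> y \<in> I \<Longrightarrow> x + y \<in> I"
    "a \<in> A \<Longrightarrow> x \<in> I \<Longrightarrow> a * x \<in> I" using assms by (auto simp: is_ideal_def)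
  show "a \<in> A \<Longrightarrow> x \<in> I \<Longrightarrow> x * a \<in> I" using b(3)[of a x] by (simp add: mult.commute)
  have n: "- x \<in> I" if "x \<in> I" for x using b(3)[of "-1" x] that by simp
  thus "x \<in> I \<Longrightarrow> - x \<in> I" .
  show "x \<in> I \<Longrightarrow> y \<in> I \<Longrightarrow> x - y \<in> I" using b(2)[of x "-y"] n[of y] by simp
qed

text \<open>For \<open>x\<close> outside \<open>M\<close> the ideal \<open>M + x A\<close> is
  everything, so \<open>A / M\<close> is a field. This elementwise form makes traces, conjugates and
  directed unions of maximal ideals easy to check.\<close>

lemma max_spec_iff:
  "M \<in> max_spec A \<longleftrightarrow> is_ideal A M \<and> 1 \<notin> M \<and> (\<forall>x\<in>A. x \<notin> M \<longrightarrow> (\<exists>y\<in>A. 1 - x * y \<in> M))" (is "_ = ?R")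
proof
  assume "M \<in> max_spec A"
  then interpret M: maximalideal M "subring_of A" by (simp add: max_spec_def)
  have i: "is_ideal A M" using M.ideal_axioms ideal_iff by blast
  note D = idealD[OF i]
  have one: "1 \<notin> M"
  proof
    assume "1 \<in> M"
    hence "A \<subseteq> M" using D(4)[of _ 1] by auto
    thus False using M.I_notcarr D(1) by auto
  qed
  have "\<exists>y\<in>A. 1 - x * y \<in> M" if x: "x \<in> A" "x \<notin> M" for x
  proof -
    define J where "J = {m + x * y | m y. m \<in> M \<and> y \<in> A}"
    have "is_ideal A J" unfolding is_ideal_def
    proof (intro conjI ballI)
      show "J \<subseteq> A" unfolding J_def using D(1) x by auto
      show "0 \<in> J" unfolding J_def using D(2) by force
      fix u v assume "u \<in> J" "v \<in> J"
      then obtain m y m' y' where "u = m + x * y" "v = m' + x * y'" "m \<in> M" "m' \<in> M" "y \<in> A" "y' \<in> A"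
        unfolding J_def by blast
      thus "u + v \<in> J" unfolding J_def using D(3)
        by (intro CollectI exI[of _ "m + m'"] exI[of _ "y + y'"]) (auto simp: algebra_simps)
    next
      fix a v assume "a \<in> A" "v \<in> J"
      then obtain m' y' where "v = m' + x * y'" "m' \<in> M" "y' \<in> A"
        unfolding J_def by blast
      thus "a * v \<in> J" unfolding J_def using D(4) \<open>a \<in> A\<close>
        by (intro CollectI exI[of _ "a * m'"] exI[of _ "a * y'"]) (auto simp: algebra_simps)
    qed
    moreover have "M \<subseteq> J" unfolding J_def by force
    moreover have "x \<in> J" unfolding J_def using D(2) by force
    ultimately have "J = A" using M.I_maximal[of J] x ideal_iff by (auto simp: is_ideal_def)
    hence "1 \<in> J" by simp
    then obtain m y where "1 = m + x * y" "m \<in> M" "y \<in> A" unfolding J_def by blast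
    hence "1 - x * y = m" by (metis add_diff_cancel_right')
    thus ?thesis using \<open>m \<in> M\<close> \<open>y \<in> A\<close> by auto
  qed
  thus ?R using i one by blast
next
  assume r: ?R
  note D = idealD[OF conjunct1[OF r]]
  show "M \<in> max_spec A" unfolding max_spec_def mem_Collect_eq
  proof (rule maximalidealI)
    show "ideal M (subring_of A)" using r ideal_iff by blast
    show "carrier (subring_of A) \<noteq> M" using r by auto
    fix J assume J: "ideal J (subring_of A)" "M \<subseteq> J" "J \<subseteq> carrier (subring_of A)"
    hence "is_ideal A J" using ideal_iff by blast
    note DJ = idealD[OF this]
    show "J = M \<or> J = carrier (subring_of A)"
    proof (rule disjCI)
      assume "J \<noteq> carrier (subring_of A)"
      hence "1 \<notin> J" using DJ(4)[of _ 1] J(3) by auto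
      have "x \<in> M" if xJ: "x \<in> J" for x
      proof (rule ccontr)
        assume "x \<notin> M"
        then obtain y where y: "y \<in> A" "1 - x * y \<in> M" using r DJ(1)[OF xJ] by blast
        have "(1 - x * y) + x * y \<in> J" using y xJ J(2) DJ(3,5) by blast
        thus False using \<open>1 \<notin> J\<close> by simp
      qed
      thus "J = M" using J(2) by auto
    qed
  qed
qed

lemma max_spec_ideal: "M \<in> max_spec A \<Longrightarrow> is_ideal A M" by (simp add: max_spec_iff)

lemma max_spec_prime:
  assumes "M \<in> max_spec A"
  shows "is_prime A M"
proof -
  note M = assms[unfolded max_spec_iff]
  note D = idealD[OF conjunct1[OF M]]
  have "y \<in> M" if xy: "x \<in> A" "y \<in> A" "x * y \<in> M" "x \<notin> M" for x y
  proof -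
    obtain z where z: "z \<in> A" "1 - x * z \<in> M"
      using bspec[OF conjunct2[OF conjunct2[OF M]] xy(1)] xy(4) by auto
    have "y * (1 - x * z) + z * (x * y) \<in> M"
      by (rule D(3)[OF D(4)[OF xy(2) z(2)] D(4)[OF z(1) xy(3)]])
    thus ?thesis by (simp add: algebra_simps)
  qed
  thus ?thesis using M unfolding is_prime_def by blast
qed

lemma max_spec_primeD: "M \<in> max_spec A \<Longrightarrow> x \<in> A \<Longrightarrow> y \<in> A \<Longrightarrow> x * y \<in> M \<Longrightarrow> x \<in> M \<or> y \<in> M"
  using max_spec_prime unfolding is_prime_def by auto

lemma max_spec_eqI:
  assumes "M \<in> max_spec A" "N \<in> max_spec A" "M \<subseteq> N"
  shows "M = N"
proof -
  have "x \<in> M" if xN: "x \<in> N" for x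
  proof (rule ccontr)
    assume "x \<notin> M"
    then obtain y where y: "y \<in> A" "1 - x * y \<in> M"
      using assms(1) idealD(1)[OF max_spec_ideal[OF assms(2)] xN] unfolding max_spec_iff[of M] by auto
    have "(1 - x * y) + x * y \<in> N"
      using idealD(3,5)[OF max_spec_ideal[OF assms(2)]] y xN assms(3) by blast
    thus False using assms(2) by (simp add: max_spec_iff)
  qed
  thus ?thesis using assms(3) by auto
qed

lemma ex_max_spec:
  assumes "is_ideal A I" "1 \<notin> I"
  shows "\<exists>M\<in>max_spec A. I \<subseteq> M"
proof -
  define S where "S = {J. is_ideal A J \<and> 1 \<notin> J \<and> I \<subseteq> J}"
  have "\<exists>M\<in>S. \<forall>Z\<in>S. M \<subseteq> Z \<longrightarrow> Z = M"
  proof (rule subset_Zorn_nonempty)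
    show "S \<noteq> {}" using assms unfolding S_def by auto
    fix C assume C: "C \<noteq> {}" "subset.chain S C"
    hence CS: "\<And>J. J \<in> C \<Longrightarrow> J \<in> S" and ch: "\<And>J J'. J \<in> C \<Longrightarrow> J' \<in> C \<Longrightarrow> J \<subseteq> J' \<or> J' \<subseteq> J"
      by (auto simp: subset_chain_def)
    have "is_ideal A (\<Union>C)" unfolding is_ideal_def
    proof (intro conjI ballI)
      show "\<Union>C \<subseteq> A" "0 \<in> \<Union>C" using CS C(1) unfolding S_def is_ideal_def by blast+
    next
      fix x y assume "x \<in> \<Union>C" "y \<in> \<Union>C"
      then obtain J J' where "x \<in> J" "y \<in> J'" "J \<in> C" "J' \<in> C" by blast
      then obtain J'' where "x \<in> J''" "y \<in> J''" "J'' \<in> C" using ch by blast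
      moreover from this have "x + y \<in> J''" using CS[of J''] by (auto simp: S_def is_ideal_def)
      ultimately show "x + y \<in> \<Union>C" by blast
    next
      fix a x assume "a \<in> A" "x \<in> \<Union>C"
      thus "a * x \<in> \<Union>C" using CS unfolding S_def is_ideal_def by blast
    qed
    thus "\<Union>C \<in> S" using C(1) CS unfolding S_def by blast
  qed
  then obtain M where M: "M \<in> S" "\<And>Z. Z \<in> S \<Longrightarrow> M \<subseteq> Z \<Longrightarrow> Z = M" by blast
  have iM: "ideal M (subring_of A)" and one: "1 \<notin> M" using M(1) ideal_iff by (auto simp: S_def)
  have "maximalideal M (subring_of A)"
  proof (rule maximalidealI[OF iM])
    show "carrier (subring_of A) \<noteq> M" using one by auto
    fix J assume J: "ideal J (subring_of A)" "M \<subseteq> J" "J \<subseteq> carrier (subring_of A)"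
    note iJ = J(1)[unfolded ideal_iff]
    show "J = M \<or> J = carrier (subring_of A)"
    proof (cases "1 \<in> J")
      case True
      hence "A \<subseteq> J" using idealD(4)[OF iJ, of _ 1] by auto
      thus ?thesis using J(3) by auto
    next
      case False
      hence "J \<in> S" using M(1) iJ J(2) by (auto simp: S_def)
      thus ?thesis using M(2) J(2) by blast
    qed
  qed
  thus ?thesis using M(1) unfolding max_spec_def S_def by blast
qed

lemma generated_ideal:
  assumes "S \<subseteq> A"
  shows "is_ideal A (generated_ideal A S)" "S \<subseteq> generated_ideal A S"
    "is_ideal A I \<Longrightarrow> S \<subseteq> I \<Longrightarrow> generated_ideal A S \<subseteq> I"
proof -
  interpret cring "subring_of A" by (rule is_cring)
  show "is_ideal A (generated_ideal A S)" "S \<subseteq> generated_ideal A S"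
    unfolding generated_ideal_def ideal_iff[symmetric]
    using assms by (simp_all add: genideal_ideal genideal_self)
  show "is_ideal A I \<Longrightarrow> S \<subseteq> I \<Longrightarrow> generated_ideal A S \<subseteq> I"
    unfolding generated_ideal_def ideal_iff[symmetric] by (rule genideal_minimal)
qed

text \<open>Choose an element outside \<open>P\<close> in each \<open>Q\<close>; by primality their
  product stays outside \<open>P\<close>.\<close>

lemma finite_Inter_not_in_prime:
  assumes "is_prime A P" "finite Z" "\<And>Q. Q \<in> Z \<Longrightarrow> Q \<in> max_spec A" "\<And>Q. Q \<in> Z \<Longrightarrow> \<not> Q \<subseteq> P"
  shows "\<exists>u\<in>A - P. \<forall>Q\<in>Z. u \<in> Q"
  using assms(2-4)
proof (induction Z rule: finite_induct)
  case empty
  thus ?case using assms(1) by (intro bexI[of _ 1]) (auto simp: is_prime_def)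
next
  case (insert Q Z)
  then obtain u where u: "u \<in> A" "u \<notin> P" "\<forall>Q\<in>Z. u \<in> Q" by auto
  obtain q where q: "q \<in> Q" "q \<notin> P" using insert.prems by auto
  have qA: "q \<in> A" using q insert.prems(1)[of Q] idealD(1) max_spec_ideal by blast
  have "u * q \<notin> P" using assms(1) u q qA unfolding is_prime_def by blast
  moreover have "u * q \<in> Q'" if "Q' \<in> insert Q Z" for Q'
    using that u q qA idealD(4,5)[OF max_spec_ideal[OF insert.prems(1)[OF that]]] by blast
  ultimately show ?case using u(1) qA by (intro bexI[of _ "u * q"]) auto
qed

lemma max_spec_separate:
  assumes "M \<in> max_spec A" "finite Z" "Z \<subseteq> max_spec A" "M \<notin> Z"
  shows "\<exists>u\<in>A - M. \<forall>Q\<in>Z. u \<in> Q"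
proof (rule finite_Inter_not_in_prime[OF max_spec_prime[OF assms(1)] assms(2)])
  show "\<And>Q. Q \<in> Z \<Longrightarrow> Q \<in> max_spec A" "\<And>Q. Q \<in> Z \<Longrightarrow> \<not> Q \<subseteq> M"
    using assms max_spec_eqI by blast+
qed

text \<open>The Chinese remainder theorem for the residues 0 and 1, which are the only ones that the
  coefficient \<open>a\<close> of a quadratic polynomial has to take.\<close>

lemma max_spec_approx:
  assumes "finite Z" "finite Y" "Z \<subseteq> max_spec A" "Y \<subseteq> max_spec A" "Z \<inter> Y = {}"
  shows "\<exists>u\<in>A. (\<forall>Q\<in>Z. u \<in> Q) \<and> (\<forall>Q\<in>Y. 1 - u \<in> Q)"
  using assms(2,4,5)
proof (induction Y rule: finite_induct)
  case empty thus ?case using max_spec_ideal assms(3) idealD(2) by (intro bexI[of _ 0]) auto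
next
  case (insert M Y)
  then obtain u where u: "u \<in> A" "\<forall>Q\<in>Z. u \<in> Q" "\<forall>Q\<in>Y. 1 - u \<in> Q" by auto
  have M: "M \<in> max_spec A" using insert by auto
  obtain w where w: "w \<in> A" "w \<notin> M" "\<forall>Q\<in>Z \<union> Y. w \<in> Q"
    using max_spec_separate[OF M, of "Z \<union> Y"] insert assms by auto
  obtain y where y: "y \<in> A" "1 - w * y \<in> M" using w(1,2) M by (auto simp: max_spec_iff)
  \<comment> \<open>Makes \<open>1 - u'\<close> the product of \<open>1 - u\<close> and
    \<open>1 - w * y\<close>, so the old congruences survive and the one at \<open>M\<close> is
    added.\<close>
  define u' where "u' = u + (1 - u) * (w * y)"
  have "u' \<in> Q" if "Q \<in> Z" for Q
  proof -
    have "Q \<in> max_spec A" using that assms by auto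
    note D = idealD[OF max_spec_ideal[OF this]]
    show ?thesis unfolding u'_def using that u w y by (intro D(3)[OF _ D(4)[OF _ D(5)]]) auto
  qed
  moreover have "1 - u' \<in> Q" if "Q \<in> insert M Y" for Q
  proof -
    have e: "1 - u' = (1 - u) * (1 - w * y)" by (simp add: u'_def algebra_simps)
    have "Q \<in> max_spec A" using that insert by auto
    note D = idealD[OF max_spec_ideal[OF this]]
    have "Q = M \<Longrightarrow> 1 - w * y \<in> Q" "Q \<in> Y \<Longrightarrow> 1 - u \<in> Q" "1 - u \<in> A" "1 - w * y \<in> A" using u w y by auto
    thus ?thesis unfolding e using that D(4)[of "1-u" "1-w*y"] D(5)[of "1-w*y" "1-u"] by blast
  qed
  moreover have "u' \<in> A" unfolding u'_def using u w y by auto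
  ultimately show ?case by blast
qed

lemma quotient_fieldI: "a \<in> A \<Longrightarrow> b \<in> A \<Longrightarrow> b \<noteq> 0 \<Longrightarrow> a / b \<in> quotient_field A"
  by (auto simp: quotient_field_def)

lemma quotient_fieldE:
  assumes "x \<in> quotient_field A"
  obtains a b where "x = a / b" "a \<in> A" "b \<in> A" "b \<noteq> 0"
  using assms by (auto simp: quotient_field_def)

lemma subset_quotient_field: "x \<in> A \<Longrightarrow> x \<in> quotient_field A"
  using quotient_fieldI[of x 1] by simp

lemma quotient_field_diff: 
  assumes "x \<in> quotient_field A" "y \<in> quotient_field A"
  shows "x - y \<in> quotient_field A" "x + y \<in> quotient_field A" "x * y \<in> quotient_field A" "x / y \<in> quotient_field A"
proof -
  obtain a b c d where e: "x = a / b" "y = c / d" "a \<in> A" "b \<in> A" "c \<in> A" "d \<in> A" "b \<noteq> 0" "d \<noteq> 0"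
    using assms quotient_fieldE by metis
  have "x - y = (a * d - c * b) / (b * d)" "x + y = (a * d + c * b) / (b * d)"
    "x * y = (a * c) / (b * d)" using e by (simp_all add: field_simps)
  thus "x - y \<in> quotient_field A" "x + y \<in> quotient_field A" "x * y \<in> quotient_field A"
    using e by (metis quotient_fieldI no_zero_divisors mult_mem add_mem diff_mem)+
  show "x / y \<in> quotient_field A"
  proof (cases "c = 0")
    case True thus ?thesis using e subset_quotient_field by simp
  next
    case False
    have "x / y = (a * d) / (b * c)" unfolding e(1,2) using e(7,8) False by (simp add: field_simps)
    thus ?thesis using e False by (auto intro!: quotient_fieldI)
  qed
qed

lemma quotient_field_uminus: "x \<in> quotient_field A \<Longrightarrow> - x \<in> quotient_field A"
  using quotient_field_diff(1)[of 0 x] subset_quotient_field[of 0] by simp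

lemma quotient_field_power: "x \<in> quotient_field A \<Longrightarrow> x ^ n \<in> quotient_field A"
  using subset_quotient_field[of 1] by (induction n) (auto intro: quotient_field_diff(3))

lemmas quotient_field_closed = quotient_field_diff quotient_field_uminus quotient_field_power

end

section \<open>Discrete valuations and localizations\<close>

text \<open>The ultrametric inequality is not demanded: it follows from the last clause, because the
  localization is closed under addition. The element of value 1 normalizes the valuation and
  excludes fields.\<close>

definition discrete_val :: "'k::field set \<Rightarrow> 'k set \<Rightarrow> ('k \<Rightarrow> int) \<Rightarrow> bool" where
  "discrete_val A M v \<longleftrightarrow>
     (\<forall>x\<in>quotient_field A. \<forall>y\<in>quotient_field A. x \<noteq> 0 \<longrightarrow> y \<noteq> 0 \<longrightarrow> v (x * y) = v x + v y) \<and>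
     (\<exists>t\<in>quotient_field A. t \<noteq> 0 \<and> v t = 1) \<and>
     (\<forall>x\<in>quotient_field A. x \<noteq> 0 \<longrightarrow> (0 \<le> v x \<longleftrightarrow> x \<in> localization A M))"

definition locally_discrete :: "'k::field set \<Rightarrow> bool" where
  "locally_discrete A \<longleftrightarrow> integral_domain A \<and> (\<forall>M\<in>max_spec A. \<exists>v. discrete_val A M v)"

definition finite_character :: "'k::field set \<Rightarrow> bool" where
  "finite_character A \<longleftrightarrow> (\<forall>x\<in>A. x \<noteq> 0 \<longrightarrow> finite {M \<in> max_spec A. x \<in> M})"

text \<open>
  All valuations are functions on the ambient field, whose values at 0 and outside the quotient field
  are meaningless.
\<close>

definition val :: "'k::field set \<Rightarrow> 'k set \<Rightarrow> 'k \<Rightarrow> int" where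
  "val A M = (SOME v. discrete_val A M v)"

context field_subring begin

lemma localizationI: "a \<in> A \<Longrightarrow> s \<in> A \<Longrightarrow> s \<notin> P \<Longrightarrow> x = a / s \<Longrightarrow> x \<in> localization A P"
  by (auto simp: localization_def)

lemma localizationE:
  assumes "x \<in> localization A P" "0 \<in> P"
  obtains a s where "x = a / s" "a \<in> A" "s \<in> A" "s \<notin> P" "s \<noteq> 0"
  using assms by (auto simp: localization_def)

lemma subset_localization: "1 \<notin> P \<Longrightarrow> x \<in> A \<Longrightarrow> x \<in> localization A P"
  by (rule localizationI[of x 1]) auto

lemma localization_subset: "0 \<in> P \<Longrightarrow> x \<in> localization A P \<Longrightarrow> x \<in> quotient_field A"
  by (auto elim!: localizationE intro!: quotient_fieldI)

lemma integral_domain_localization: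
  assumes "is_prime A P"
  shows "integral_domain (localization A P)"
proof -
  have P: "0 \<in> P" "1 \<notin> P" and pr: "\<And>x y. x \<in> A \<Longrightarrow> y \<in> A \<Longrightarrow> x * y \<in> P \<Longrightarrow> x \<in> P \<or> y \<in> P"
    using assms by (auto simp: is_prime_def is_ideal_def)
  show ?thesis unfolding integral_domain_iff
  proof (intro conjI ballI)
    show "1 \<in> localization A P" using P by (simp add: subset_localization)
    fix x y assume "x \<in> localization A P" "y \<in> localization A P"
    then obtain a s b r where xy: "x = a / s" "y = b / r" and m: "a \<in> A" "s \<in> A" "b \<in> A" "r \<in> A" "s \<notin> P" "r \<notin> P" "s \<noteq> 0" "r \<noteq> 0"
      using P by (elim localizationE) auto
    have sr: "s * r \<notin> P" using pr m by blast
    show "x - y \<in> localization A P" unfolding xy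
      by (rule localizationI[of "a * r - b * s" "s * r"]) (use m sr in \<open>auto simp: field_simps\<close>)
    show "x * y \<in> localization A P" unfolding xy
      by (rule localizationI[of "a * b" "s * r"]) (use m sr in \<open>auto simp: field_simps\<close>)
  qed
qed

text \<open>The ideal of denominators of \<open>x\<close> is contained in no maximal ideal, hence
  contains 1.\<close>

lemma in_all_localizations:
  assumes "x \<in> quotient_field A" "\<And>M. M \<in> max_spec A \<Longrightarrow> x \<in> localization A M"
  shows "x \<in> A"
proof -
  define I where "I = {d \<in> A. d * x \<in> A}"
  have I: "is_ideal A I" unfolding is_ideal_def I_def by (auto simp: distrib_right mult.assoc)
  have "1 \<in> I"
  proof (rule ccontr)
    assume "1 \<notin> I"
    then obtain M where M: "M \<in> max_spec A" "I \<subseteq> M" using ex_max_spec I by blast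
    obtain a s where s: "x = a / s" "a \<in> A" "s \<in> A" "s \<notin> M" "s \<noteq> 0"
      using assms(2)[OF M(1)] idealD(2)[OF max_spec_ideal[OF M(1)]] by (rule localizationE)
    have "s \<in> I" unfolding I_def using s by simp
    thus False using M s by blast
  qed
  thus ?thesis by (simp add: I_def)
qed

end

locale valued_ring = field_subring A for A :: "'k::field set" +
  fixes M v
  assumes M: "M \<in> max_spec A" and dv: "discrete_val A M v"
begin

abbreviation "F \<equiv> quotient_field A"

lemma M_ideal: "is_ideal A M" and M_prime: "is_prime A M"
  using max_spec_ideal[OF M] max_spec_prime[OF M] .

lemma M_0: "0 \<in> M" and M_1: "1 \<notin> M" using M by (auto simp: max_spec_iff is_ideal_def)

lemmas F_closed [simp] = quotient_field_closed subset_quotient_field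

lemma v_mult [simp]: "x \<in> F \<Longrightarrow> y \<in> F \<Longrightarrow> x \<noteq> 0 \<Longrightarrow> y \<noteq> 0 \<Longrightarrow> v (x * y) = v x + v y"
  and v_ge_0: "x \<in> F \<Longrightarrow> x \<noteq> 0 \<Longrightarrow> 0 \<le> v x \<longleftrightarrow> x \<in> localization A M"
  using dv by (auto simp: discrete_val_def)

lemma v_1 [simp]: "v 1 = 0" using v_mult[of 1 1] by simp

lemma v_uminus [simp]: assumes "x \<in> F" "x \<noteq> 0" shows "v (- x) = v x"
proof -
  have "v ((-1) * (-1)) = v (-1) + v (-1)" by (rule v_mult) auto
  hence "v (-1) = 0" by simp
  thus ?thesis using v_mult[of "-1" x] assms by simp
qed

lemma v_power [simp]: assumes "x \<in> F" "x \<noteq> 0" shows "v (x ^ n) = int n * v x"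
  using assms by (induction n) (auto simp: algebra_simps)

lemma v_divide [simp]: assumes "x \<in> F" "y \<in> F" "x \<noteq> 0" "y \<noteq> 0" shows "v (x / y) = v x - v y"
  using v_mult[of "x / y" y] assms by simp

lemma v_powi:
  assumes "x \<in> quotient_field A" "x \<noteq> 0"
  shows "x powi k \<in> quotient_field A" "v (x powi k) = k * v x"
proof -
  have i: "inverse x = 1 / x" by (simp add: inverse_eq_divide)
  show "x powi k \<in> quotient_field A" using assms by (simp add: power_int_def i)
  show "v (x powi k) = k * v x"
    using assms by (auto simp: power_int_def i power_one_over)
qed

text \<open>If \<open>x\<close> has the smaller value, then \<open>y / x\<close> lies in the
  localization, and so does \<open>1 + y / x\<close>. A lower bound \<open>k\<close> replaces the
  minimum because values at 0 are meaningless.\<close>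

lemma v_min:
  assumes "x \<in> F" "y \<in> F" "x = 0 \<or> k \<le> v x" "y = 0 \<or> k \<le> v y" "x + y \<noteq> 0"
  shows "k \<le> v (x + y)"
proof -
  have *: "k \<le> v (x + y)" if "x \<in> F" "y \<in> F" "k \<le> v x" "x \<noteq> 0" "y = 0 \<or> v x \<le> v y" "x + y \<noteq> 0" for x y
  proof (cases "y = 0")
    case False
    have "0 \<le> v (y / x)" using that False by simp
    hence "y / x \<in> localization A M" using v_ge_0[of "y / x"] that False by simp
    interpret L: field_subring "localization A M"
      by unfold_locales (rule integral_domain_localization[OF M_prime])
    from \<open>y / x \<in> _\<close> have l: "1 + y / x \<in> localization A M" by simp
    have e: "x + y = x * (1 + y / x)" using that by (simp add: field_simps)
    hence nz: "1 + y / x \<noteq> 0" using that by auto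
    have "0 \<le> v (1 + y / x)" using v_ge_0[of "1 + y / x"] l nz that by simp
    moreover have "v (x + y) = v x + v (1 + y / x)" unfolding e by (rule v_mult) (use that nz in auto)
    ultimately show ?thesis using that by simp
  qed (use that in auto)
  consider "x = 0" | "x \<noteq> 0" "y = 0 \<or> v x \<le> v y" | "y \<noteq> 0" "x \<noteq> 0" "v y \<le> v x" by linarith
  thus ?thesis
  proof cases
    case 1 thus ?thesis using assms by auto
  next
    case 2 thus ?thesis using *[of x y] assms by auto
  next
    case 3 thus ?thesis using *[of y x] assms by (auto simp: add.commute)
  qed
qed

lemma v_dominant:
  assumes "x \<in> F" "y \<in> F" "x \<noteq> 0" "y = 0 \<or> v x < v y"
  shows "x + y \<noteq> 0" "v (x + y) = v x"
proof -
  show nz: "x + y \<noteq> 0"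
  proof
    assume "x + y = 0"
    hence "y = - x" by (simp add: add_eq_0_iff)
    thus False using assms v_uminus by auto
  qed
  have "v x \<le> v (x + y)" by (rule v_min) (use assms nz in auto)
  moreover have "v (x + y) \<le> v x"
  proof (rule ccontr)
    assume c: "\<not> ?thesis"
    have "- y = 0 \<or> v x + 1 \<le> v (- y)" using assms(2,4) by (cases "y = 0") auto
    hence "v x + 1 \<le> v ((x + y) + (- y))"
      by (intro v_min) (use assms(1,2,3) nz c in auto)
    thus False by simp
  qed
  ultimately show "v (x + y) = v x" by simp
qed

lemma v_nonneg: "x \<in> A \<Longrightarrow> x \<noteq> 0 \<Longrightarrow> 0 \<le> v x"
  using v_ge_0[of x] subset_localization M_1 by simp

lemma v_eq_0: assumes "x \<in> A" "x \<notin> M" shows "v x = 0"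
proof -
  have nz: "x \<noteq> 0" using assms M_0 by auto
  have "1 / x \<in> localization A M" by (rule localizationI[of 1 x]) (use assms in auto)
  hence "0 \<le> v (1 / x)" using v_ge_0[of "1 / x"] nz assms by simp
  thus ?thesis using v_nonneg[of x] nz assms by simp
qed

lemma v_pos: assumes "x \<in> M" "x \<noteq> 0" shows "0 < v x"
proof (rule ccontr)
  assume "\<not> 0 < v x"
  have xA: "x \<in> A" using assms idealD(1)[OF M_ideal] by simp
  have "0 \<le> v (1 / x)" using \<open>\<not> 0 < v x\<close> assms xA by simp
  hence "1 / x \<in> localization A M" using v_ge_0[of "1 / x"] xA assms by simp
  then obtain a s where "1 / x = a / s" "a \<in> A" "s \<in> A" "s \<notin> M" "s \<noteq> 0"
    using M_0 by (rule localizationE)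
  hence "s = a * x" using assms by (simp add: field_simps)
  thus False using \<open>s \<notin> M\<close> idealD(4)[OF M_ideal] assms \<open>a \<in> A\<close> by blast
qed

lemma mem_M_iff: "x \<in> A \<Longrightarrow> x \<noteq> 0 \<Longrightarrow> x \<in> M \<longleftrightarrow> 0 < v x"
  using v_eq_0 v_pos by fastforce

lemma mem_M_iff': "x \<in> F \<Longrightarrow> x \<noteq> 0 \<Longrightarrow> x \<in> localization A M \<Longrightarrow> v x = 0 \<longleftrightarrow> 1 / x \<in> localization A M"
  using v_ge_0[of x] v_ge_0[of "1/x"] by auto

lemma uniformizer: obtains t where "t \<in> M" "t \<in> A" "t \<noteq> 0" "v t = 1"
proof -
  obtain t where t: "t \<in> F" "t \<noteq> 0" "v t = 1" using dv by (auto simp: discrete_val_def)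
  hence "t \<in> localization A M" using v_ge_0[of t] by simp
  then obtain a s where a: "t = a / s" "a \<in> A" "s \<in> A" "s \<notin> M" "s \<noteq> 0"
    using M_0 by (rule localizationE)
  hence "a \<noteq> 0" using t by auto
  have "v t = v a - v s" unfolding a(1) using a \<open>a \<noteq> 0\<close> by simp
  hence "v a = 1" using v_eq_0[of s] a t by simp
  thus ?thesis using that[of a] a \<open>a \<noteq> 0\<close> mem_M_iff[of a] by simp
qed

text \<open>Units of the smaller localization are units of the larger one, so \<open>w\<close> is
  determined on \<open>F\<close> by its value at a uniformizer. That value, \<open>e\<close>, is the
  ramification index.\<close>

lemma val_restrict:
  assumes B: "valued_ring B N w" and AB: "A \<subseteq> B" and NM: "N \<inter> A = M"
  shows "\<exists>e\<ge>1. \<forall>x\<in>F. x \<noteq> 0 \<longrightarrow> w x = e * v x"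
proof -
  interpret B: valued_ring B N w by (rule B)
  have FB: "x \<in> quotient_field B" if "x \<in> F" for x
    using that AB by (auto elim!: quotient_fieldE intro!: B.quotient_fieldI)
  have loc: "x \<in> localization B N" if "x \<in> localization A M" for x
    using that AB NM by (auto simp: localization_def)
  obtain t where t: "t \<in> M" "t \<in> A" "t \<noteq> 0" "v t = 1" by (rule uniformizer)
  have pos: "0 < w t" using B.v_pos[of t] t NM by auto
  have unit: "w x = 0" if "x \<in> F" "x \<noteq> 0" "v x = 0" for x
  proof -
    have "x \<in> localization A M" using v_ge_0[OF that(1,2)] that(3) by simp
    moreover from this have "1 / x \<in> localization A M" using mem_M_iff'[OF that(1,2)] that(3) by simp
    ultimately show ?thesis using B.mem_M_iff'[of x] loc FB that by blast
  qed
  have "w x = w t * v x" if x: "x \<in> F" "x \<noteq> 0" for x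
  proof (cases "0 \<le> v x")
    case True
    define n where "n = nat (v x)"
    have "v (x / t ^ n) = 0" using x t True by (simp add: n_def)
    hence "w (x / t ^ n) = 0" using unit[of "x / t ^ n"] x t by simp
    moreover have "w (x / t ^ n) = w x - int n * w t" using x t AB FB by (subst B.v_divide) auto
    ultimately show ?thesis using True by (simp add: n_def)
  next
    case False
    define n where "n = nat (- v x)"
    have "v (x * t ^ n) = 0" using x t False by (simp add: n_def)
    hence "w (x * t ^ n) = 0" using unit[of "x * t ^ n"] x t by simp
    moreover have "w (x * t ^ n) = w x + int n * w t" using x t AB FB by (subst B.v_mult) auto
    ultimately show ?thesis using False by (simp add: n_def)
  qed
  thus ?thesis using pos by (intro exI[of _ "w t"]) auto
qed

text \<open>A nonzero ideal is generated by any element of least value; the elements of positive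
  value form the only maximal ideal.\<close>

lemma discrete_valuation_ring_localization: "discrete_valuation_ring (localization A M)"
proof -
  let ?L = "localization A M"
  interpret L: field_subring ?L by unfold_locales (rule integral_domain_localization[OF M_prime])
  interpret LD: domain "subring_of ?L" by (rule L.is_domain)
  have LF: "x \<in> F" if "x \<in> ?L" for x using localization_subset[OF M_0 that] .
  obtain t where t: "t \<in> M" "t \<in> A" "t \<noteq> 0" "v t = 1" by (rule uniformizer)
  have tL: "t \<in> ?L" using t M_1 subset_localization by blast
  have div: "y / x \<in> ?L" if "x \<in> ?L" "y \<in> ?L" "x \<noteq> 0" "y = 0 \<or> v x \<le> v y" for x y
    using that v_ge_0[of "y / x"] LF by (cases "y = 0") auto
  have pid: "\<exists>i\<in>carrier (subring_of ?L). I = PIdl\<^bsub>subring_of ?L\<^esub> i" if I: "ideal I (subring_of ?L)" for I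
  proof -
    note iI = I[unfolded L.ideal_iff]
    have "\<exists>i\<in>carrier (subring_of ?L). I = Idl\<^bsub>subring_of ?L\<^esub> {i}"
    proof (cases "I = {0}")
      case True
      have "Idl\<^bsub>subring_of ?L\<^esub> {\<zero>\<^bsub>subring_of ?L\<^esub>} = {0}"
        using LD.genideal_zero by simp
      thus ?thesis using True by (intro bexI[of _ 0]) auto
    next
      case False
      then obtain x0 where x0: "x0 \<in> I" "x0 \<noteq> 0" using L.idealD(2)[OF iI] by blast
      define n where "n = (LEAST n. \<exists>x\<in>I. x \<noteq> 0 \<and> nat (v x) = n)"
      have "\<exists>x\<in>I. x \<noteq> 0 \<and> nat (v x) = n" unfolding n_def by (rule LeastI_ex) (use x0 in blast)
      then obtain x where x: "x \<in> I" "x \<noteq> 0" "nat (v x) = n" by blast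
      have xL: "x \<in> ?L" using x L.idealD(1)[OF iI] by blast
      have min: "v x \<le> v y" if "y \<in> I" "y \<noteq> 0" for y
      proof -
        have "n \<le> nat (v y)" unfolding n_def by (rule Least_le) (use that in blast)
        moreover have "0 \<le> v y" using v_ge_0[of y] LF that L.idealD(1)[OF iI] by auto
        ultimately show ?thesis using x by linarith
      qed
      have "I = generated_ideal ?L {x}"
      proof
        show "generated_ideal ?L {x} \<subseteq> I" using L.generated_ideal(3)[of "{x}"] iI x xL by auto
        show "I \<subseteq> generated_ideal ?L {x}"
        proof
          fix y assume y: "y \<in> I"
          hence "y / x \<in> ?L" using div[of x y] xL x min L.idealD(1)[OF iI] by blast
          moreover have "x \<in> generated_ideal ?L {x}" using L.generated_ideal(2)[of "{x}"] xL by auto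
          ultimately have "(y / x) * x \<in> generated_ideal ?L {x}"
            using L.idealD(4)[OF L.generated_ideal(1)[of "{x}"]] xL by blast
          thus "y \<in> generated_ideal ?L {x}" using x by simp
        qed
      qed
      thus ?thesis using xL unfolding generated_ideal_def by auto
    qed
    thus ?thesis using LD.cgenideal_eq_genideal by blast
  qed
  have "principal_domain (subring_of ?L)"
    by (intro principal_domain.intro principal_domain_axioms.intro L.is_domain pid)
  moreover have nt: "1 / t \<notin> ?L"
    using v_ge_0[of "1 / t"] t by simp
  have "\<not> field (subring_of ?L)"
  proof
    assume "field (subring_of ?L)"
    then interpret f: field "subring_of ?L" .
    have "t \<in> Units (subring_of ?L)" using f.field_Units tL t by simp
    then obtain y where "y \<in> ?L" "t * y = 1" by (auto simp: Units_def)
    thus False using nt t by (metis nonzero_mult_div_cancel_left)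
  qed
  moreover have "\<exists>!M. M \<in> max_spec ?L"
  proof -
    define m where "m = {x \<in> ?L. x = 0 \<or> 0 < v x}"
    have mi: "is_ideal ?L m" unfolding is_ideal_def
    proof (intro conjI ballI)
      show "m \<subseteq> ?L" "0 \<in> m" unfolding m_def by auto
      fix x y assume xy: "x \<in> m" "y \<in> m"
      hence "x + y \<noteq> 0 \<Longrightarrow> 1 \<le> v (x + y)" by (intro v_min) (auto simp: m_def LF)
      moreover have "x + y \<in> ?L" using xy by (auto simp: m_def)
      ultimately show "x + y \<in> m" unfolding m_def by fastforce
    next
      fix a x assume ax: "a \<in> ?L" "x \<in> m"
      thus "a * x \<in> m" using v_ge_0[of a] LF by (cases "a = 0 \<or> x = 0") (auto simp: m_def)
    qed
    have m1: "1 \<notin> m" by (simp add: m_def)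
    have unit: "1 / x \<in> ?L" if "x \<in> ?L" "x \<notin> m" for x
    proof -
      have "x \<noteq> 0" "v x = 0" using that v_ge_0[of x] LF unfolding m_def by auto
      thus ?thesis using mem_M_iff'[of x] that LF by blast
    qed
    have "m \<in> max_spec ?L" unfolding L.max_spec_iff
    proof (intro conjI ballI impI mi m1)
      fix x assume "x \<in> ?L" "x \<notin> m"
      thus "\<exists>y\<in>?L. 1 - x * y \<in> m" using unit[of x] by (intro bexI[of _ "1 / x"]) (auto simp: m_def)
    qed
    moreover have "N = m" if N: "N \<in> max_spec ?L" for N
    proof (rule L.max_spec_eqI[OF N \<open>m \<in> max_spec ?L\<close>], rule subsetI, rule ccontr)
      fix x assume x: "x \<in> N" "x \<notin> m"
      have xL: "x \<in> ?L" using L.idealD(1)[OF L.max_spec_ideal[OF N] x(1)] .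
      have "(1 / x) * x \<in> N" using L.idealD(4)[OF L.max_spec_ideal[OF N] unit[OF xL x(2)] x(1)] .
      moreover have "x \<noteq> 0" using x(2) by (auto simp: m_def)
      ultimately show False using N by (simp add: L.max_spec_iff)
    qed
    ultimately show ?thesis by blast
  qed
  ultimately show ?thesis unfolding discrete_valuation_ring_def by blast
qed

end

lemma discrete_val_unique:
  assumes "valued_ring A M v" "valued_ring A M w" "x \<in> quotient_field A" "x \<noteq> 0"
  shows "v x = w x"
proof -
  interpret v: valued_ring A M v by fact
  interpret w: valued_ring A M w by fact
  obtain e where e: "\<And>x. x \<in> quotient_field A \<Longrightarrow> x \<noteq> 0 \<Longrightarrow> w x = e * v x" 
    using v.val_restrict[OF assms(2)] v.idealD(1)[OF v.M_ideal] by blast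
  obtain t where t: "t \<in> A" "t \<noteq> 0" "v t = 1" by (rule v.uniformizer)
  obtain s where s: "s \<in> A" "s \<noteq> 0" "w s = 1" by (rule w.uniformizer)
  have "e * v s = 1" using e[of s] s by simp
  moreover have "0 \<le> v s" using v.v_nonneg s by simp
  ultimately have "e = 1" unfolding zmult_eq_1_iff by auto
  thus ?thesis using e assms by simp
qed

locale locally_discrete_ring = fixes A :: "'k::field set" assumes locally_discrete_ring: "locally_discrete A"
begin

sublocale field_subring A by unfold_locales (use locally_discrete_ring in \<open>simp add: locally_discrete_def\<close>)

lemma dval_val: "M \<in> max_spec A \<Longrightarrow> valued_ring A M (val A M)"
  using locally_discrete_ring someI_ex[of "discrete_val A M"] unfolding val_def locally_discrete_def
  by unfold_locales auto

text \<open>Let \<open>M\<close> be maximal above \<open>P\<close>. For \<open>m\<close> in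
  \<open>M\<close>, a power of \<open>m\<close> with exponent the value of \<open>p\<close> is
  divisible by \<open>p\<close> up to a denominator outside \<open>M\<close>, hence outside
  \<open>P\<close>; so the power, and then \<open>m\<close>, lies in \<open>P\<close>.\<close>

lemma prime_is_max:
  assumes P: "is_prime A P" and p: "p \<in> P" "p \<noteq> 0"
  shows "P \<in> max_spec A"
proof -
  have Pi: "is_ideal A P" "1 \<notin> P" using P by (auto simp: is_prime_def)
  then obtain M where M: "M \<in> max_spec A" "P \<subseteq> M" using ex_max_spec by blast
  interpret v: valued_ring A M "val A M" by (rule dval_val[OF M(1)])
  have pA: "p \<in> A" using idealD(1)[OF Pi(1) p(1)] .
  have "M \<subseteq> P"
  proof
    fix m assume m: "m \<in> M"
    have mA: "m \<in> A" using idealD(1)[OF v.M_ideal m] .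
    show "m \<in> P"
    proof (cases "m = 0")
      case True thus ?thesis using idealD(2)[OF Pi(1)] by simp
    next
      case False
      define n where "n = nat (val A M p)"
      have "int n * 1 \<le> int n * val A M m" using v.v_pos[OF m False] by (intro mult_left_mono) auto
      hence "0 \<le> val A M (m ^ n / p)"
        using v.v_nonneg[OF pA p(2)] False p pA mA by (simp add: n_def)
      hence "m ^ n / p \<in> localization A M" using v.v_ge_0[of "m ^ n / p"] pA mA p False by simp
      then obtain a s where a: "m ^ n / p = a / s" "a \<in> A" "s \<in> A" "s \<notin> M" "s \<noteq> 0"
        using v.M_0 by (rule localizationE)
      hence "s * m ^ n = a * p" using p by (simp add: field_simps)
      hence "s * m ^ n \<in> P" using idealD(4)[OF Pi(1)] p a by simp
      hence mn: "m ^ n \<in> P" using P a mA M(2) power_mem[of m n] unfolding is_prime_def by blast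
      have "m ^ k \<in> P \<Longrightarrow> m \<in> P" for k
      proof (induction k)
        case 0 thus ?case using Pi by simp
      next
        case (Suc k)
        have "m \<in> P \<or> m ^ k \<in> P" using Suc.prems P mA power_mem[of m k] unfolding is_prime_def by auto
        thus ?case using Suc.IH by blast
      qed
      thus ?thesis using mn .
    qed
  qed
  hence "P = M" using M by auto
  thus ?thesis using M by simp
qed

lemma mem_iff_val: 
  assumes "x \<in> quotient_field A" "x \<noteq> 0" "\<And>M. M \<in> max_spec A \<Longrightarrow> 0 \<le> val A M x"
  shows "x \<in> A"
proof (rule in_all_localizations[OF assms(1)])
  fix M assume M: "M \<in> max_spec A"
  interpret v: valued_ring A M "val A M" by (rule dval_val[OF M])
  show "x \<in> localization A M" using v.v_ge_0[OF assms(1,2)] assms(3)[OF M] by simp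
qed

text \<open>At a pole of \<open>x\<close>, the value of \<open>x ^ 2\<close> would be smaller than
  that of \<open>p * x + q\<close>. Monic quadratics are the only equations for which integral
  closedness is used in the tower.\<close>

lemma integrally_closed_2:
  assumes x: "x \<in> quotient_field A" and pq: "p \<in> A" "q \<in> A" and e: "x ^ 2 = p * x + q"
  shows "x \<in> A"
proof (cases "x = 0")
  case False
  show ?thesis
  proof (rule mem_iff_val[OF x False], rule ccontr)
    fix M assume M: "M \<in> max_spec A" and neg: "\<not> 0 \<le> val A M x"
    interpret v: valued_ring A M "val A M" by (rule dval_val[OF M])
    have "val A M x + 1 \<le> 0" using neg by simp
    have "p * x + q \<noteq> 0" using e False by (metis power_not_zero)
    have "p * x = 0 \<or> val A M x \<le> val A M (p * x)" using v.v_nonneg[OF pq(1)] x pq False by (cases "p = 0") auto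
    moreover have "q = 0 \<or> val A M x \<le> val A M q" using v.v_nonneg[OF pq(2)] neg by linarith
    ultimately have "val A M x \<le> val A M (p * x + q)"
      by (intro v.v_min) (use x pq \<open>p * x + q \<noteq> 0\<close> in auto)
    hence "val A M x \<le> 2 * val A M x" using v.v_power[of x 2] x False e by simp
    thus False using neg by simp
  qed
qed auto

lemma uniformizer_in:
  assumes M: "M \<in> max_spec A" and Z: "finite Z" "Z \<subseteq> max_spec A" "M \<notin> Z"
  shows "\<exists>y\<in>M. y \<noteq> 0 \<and> val A M y = 1 \<and> (\<forall>Q\<in>Z. y \<in> Q)"
proof -
  interpret v: valued_ring A M "val A M" by (rule dval_val[OF M])
  obtain t where t: "t \<in> M" "t \<in> A" "t \<noteq> 0" "val A M t = 1" by (rule v.uniformizer)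
  obtain u where u: "u \<in> A" "u \<notin> M" "\<forall>Q\<in>Z. u \<in> Q" using max_spec_separate[OF M Z] by blast
  have nz: "u \<noteq> 0" using u v.M_0 by auto
  have "t * u \<in> M" using idealD(5)[OF v.M_ideal] t u by blast
  moreover have "val A M (t * u) = 1" using t u nz v.v_eq_0[of u] by simp
  moreover have "\<forall>Q\<in>Z. t * u \<in> Q" using idealD(4)[OF max_spec_ideal] t u Z by blast
  ultimately show ?thesis using t nz by (intro bexI[of _ "t * u"]) auto
qed

end

text \<open>Dedekind domains in valuation-theoretic form. Both properties pass to quadratic
  extensions, so no Noetherian argument is needed beyond the bottom ring.\<close>

locale dedekind_like = locally_discrete_ring + assumes fin_char: "finite_character A"
begin

lemma finite_containing: "x \<in> A \<Longrightarrow> x \<noteq> 0 \<Longrightarrow> finite {M \<in> max_spec A. x \<in> M}"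
  using fin_char by (auto simp: finite_character_def)

text \<open>
  This replaces the inverse of the fractional ideal \<open>Q\<close>: the element \<open>z\<close> has its only pole at \<open>Q\<close>, and
  \<open>1 = q + z * q'\<close> says that \<open>Q\<close> times its inverse contains 1.
\<close>

lemma inverse_uniformizer:
  assumes Q: "Q \<in> max_spec A"
  obtains z q q' where "z \<in> quotient_field A" "z \<noteq> 0" "val A Q z = -1"
    "\<And>M. M \<in> max_spec A \<Longrightarrow> M \<noteq> Q \<Longrightarrow> 0 \<le> val A M z"
    "q \<in> Q" "q' \<in> Q" "1 = q + z * q'"
proof -
  interpret v: valued_ring A Q "val A Q" by (rule dval_val[OF Q])
  obtain t where t: "t \<in> Q" "t \<in> A" "t \<noteq> 0" "val A Q t = 1" by (rule v.uniformizer)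
  define Z where "Z = {M \<in> max_spec A. t \<in> M} - {Q}"
  have Z: "finite Z" "Z \<subseteq> max_spec A" "Q \<notin> Z" using finite_containing[OF t(2,3)] by (auto simp: Z_def)
  obtain u where u: "u \<in> A" "u \<notin> Q" "\<forall>M\<in>Z. u \<in> M" using max_spec_separate[OF Q Z] by blast
  have unz: "u \<noteq> 0" using u v.M_0 by auto
  \<comment> \<open>An exponent that is at least the value of \<open>t\<close> at every other zero
    of \<open>t\<close>, so that \<open>u ^ k\<close> cancels all poles of \<open>1 / t\<close>
    except the one at \<open>Q\<close>.\<close>
  define k where "k = Suc (nat (\<Sum>M\<in>Z. \<bar>val A M t\<bar>))"
  have kz: "val A M t \<le> int k" if "M \<in> Z" for M
  proof -
    have "\<bar>val A M t\<bar> \<le> (\<Sum>M\<in>Z. \<bar>val A M t\<bar>)" using Z(1) that by (intro member_le_sum) auto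
    thus ?thesis by (simp add: k_def)
  qed
  define z where "z = u ^ k / t"
  have uk: "u ^ k \<notin> Q"
  proof -
    have "val A Q u = 0" by (rule v.v_eq_0[OF u(1,2)])
    hence "val A Q (u ^ k) = 0" using u unz by simp
    moreover have "u ^ k \<in> A" "u ^ k \<noteq> 0" using u unz by auto
    ultimately show ?thesis using v.mem_M_iff[of "u ^ k"] by (metis less_irrefl)
  qed
  obtain y where y: "y \<in> A" "1 - u ^ k * y \<in> Q" using uk Q u(1) by (auto simp: max_spec_iff)
  show ?thesis
  proof (rule that[of z "1 - u ^ k * y" "t * y"])
    show "z \<in> quotient_field A" "z \<noteq> 0" using t u unz by (simp_all add: z_def)
    show "val A Q z = -1" using t u unz v.v_eq_0[OF u(1,2)] by (simp add: z_def)
    show "1 - u ^ k * y \<in> Q" by (rule y)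
    show "t * y \<in> Q" using idealD(5)[OF v.M_ideal] t y by blast
    show "1 = 1 - u ^ k * y + z * (t * y)" using t by (simp add: z_def)
    fix M assume M: "M \<in> max_spec A" "M \<noteq> Q"
    interpret w: valued_ring A M "val A M" by (rule dval_val[OF M(1)])
    have e: "val A M z = int k * val A M u - val A M t" using t u unz by (simp add: z_def)
    show "0 \<le> val A M z"
    proof (cases "t \<in> M")
      case True
      hence MZ: "M \<in> Z" using M by (simp add: Z_def)
      have "0 < val A M u" using w.v_pos[of u] u MZ unz by blast
      hence "int k * 1 \<le> int k * val A M u" by (intro mult_left_mono) auto
      thus ?thesis using kz[OF MZ] e by simp
    next
      case False
      thus ?thesis using e w.v_eq_0[OF t(2)] w.v_nonneg[OF u(1) unz] by simp
    qed
  qed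
qed

end

section \<open>Dedekind domains\<close>

text \<open>Every nonzero element is assumed to be a unit times a power of \<open>t\<close>, and the
  valuation is the exponent. It is unique because no negative power of \<open>t\<close> is in the
  localization: multiplied by a power of \<open>t\<close> it would give
  \<open>1 / t\<close>.\<close>

lemma (in field_subring) discrete_valI:
  assumes M: "M \<in> max_spec A" and t: "t \<in> localization A M" "t \<noteq> 0" "1 / t \<notin> localization A M"
    and ex: "\<And>x. x \<in> quotient_field A \<Longrightarrow> x \<noteq> 0 \<Longrightarrow>
      \<exists>k::int. x * t powi k \<in> localization A M \<and> 1 / (x * t powi k) \<in> localization A M"
  shows "\<exists>v. discrete_val A M v \<and> v t = 1"
proof -
  let ?L = "localization A M"
  interpret L: field_subring ?L by unfold_locales (rule integral_domain_localization[OF max_spec_prime[OF M]])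
  have M0: "0 \<in> M" using M by (auto simp: max_spec_iff is_ideal_def)
  have tF: "t \<in> quotient_field A" by (rule localization_subset[OF M0 t(1)])
  define U where "U x \<longleftrightarrow> x \<noteq> 0 \<and> x \<in> ?L \<and> 1 / x \<in> ?L" for x
  have Um: "U (x * y)" if "U x" "U y" for x y
    using that L.mult_mem[of x y] L.mult_mem[of "1/x" "1/y"] by (auto simp: U_def)
  have Ui: "U (1 / x)" if "U x" for x using that by (auto simp: U_def)
  have pw: "t powi k \<in> ?L" if "k \<ge> 0" for k
    using that t L.power_mem[of t "nat k"] by (simp add: power_int_def)
  have notL: "t powi k \<notin> ?L" if "k < 0" for k
  proof
    assume "t powi k \<in> ?L"
    moreover have "t powi (- 1 - k) \<in> ?L" by (rule pw) (use that in simp)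
    ultimately have "t powi k * t powi (- 1 - k) \<in> ?L" by simp
    also have "t powi k * t powi (- 1 - k) = t powi (-1)"
      using t(2) by (subst power_int_add[symmetric]) auto
    finally show False using t(3) by (simp add: power_int_minus inverse_eq_divide)
  qed
  have Uk: "k = 0" if "U (t powi k)" for k
  proof -
    have "1 / t powi k = t powi (-k)" by (simp add: power_int_minus inverse_eq_divide)
    hence "t powi k \<in> ?L" "t powi (-k) \<in> ?L" using that by (auto simp: U_def)
    hence "\<not> k < 0" "\<not> -k < 0" using notL by blast+
    thus ?thesis by simp
  qed
  define v where "v x = (THE k. U (x * t powi (-k)))" for x
  have vI: "v x = k" if "U (x * t powi (-k))" for x k
    unfolding v_def
  proof (rule the_equality[where a = k])
    show "U (x * t powi (-k))" by fact
    fix j assume "U (x * t powi (-j))"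
    from Um[OF this Ui[OF that]] have "U (t powi (-j) * (1 / t powi (-k)))"
      using that by (auto simp: U_def)
    also have "t powi (-j) * (1 / t powi (-k)) = t powi (k - j)"
      using t(2) by (simp add: power_int_minus power_int_diff field_simps)
    finally show "j = k" using Uk by fastforce
  qed
  have v: "U (x * t powi (- v x))" if xq: "x \<in> quotient_field A" "x \<noteq> 0" for x
  proof -
    obtain k where "x * t powi k \<in> ?L \<and> 1 / (x * t powi k) \<in> ?L" using ex[OF xq] by (elim exE)
    hence "U (x * t powi (-(-k)))" using t(2) xq by (simp add: U_def)
    thus ?thesis using vI by metis
  qed
  have "discrete_val A M v" unfolding discrete_val_def
  proof (intro conjI ballI impI)
    fix x y assume xy: "x \<in> quotient_field A" "y \<in> quotient_field A" "x \<noteq> 0" "y \<noteq> 0"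
    have e: "x * t powi (- v x) * (y * t powi (- v y)) = x * y * t powi (- (v x + v y))"
      using t(2) by (simp add: power_int_diff power_int_minus field_simps)
    show "v (x * y) = v x + v y"
      by (rule vI) (use Um[OF v[OF xy(1,3)] v[OF xy(2,4)]] in \<open>simp only: e\<close>)
  next
    show "\<exists>t\<in>quotient_field A. t \<noteq> 0 \<and> v t = 1"
      by (rule bexI[OF _ tF], rule conjI[OF t(2)], rule vI) (use t in \<open>simp add: U_def power_int_minus\<close>)
  next
    fix x assume x: "x \<in> quotient_field A" "x \<noteq> 0"
    note u = v[OF x]
    have e: "x * t powi (- v x) * t powi v x = x" "1 / (x * t powi (- v x)) * x = t powi v x"
      using t(2) x(2) by (simp_all add: power_int_minus field_simps)
    show "0 \<le> v x \<longleftrightarrow> x \<in> ?L"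
    proof
      assume "0 \<le> v x"
      hence "x * t powi (- v x) * t powi v x \<in> ?L" using pw u by (auto simp: U_def)
      thus "x \<in> ?L" by (simp only: e)
    next
      assume "x \<in> ?L"
      hence "1 / (x * t powi (- v x)) * x \<in> ?L" using L.mult_mem u unfolding U_def by blast
      hence "t powi v x \<in> ?L" by (simp only: e)
      thus "0 \<le> v x" using notL[of "v x"] by linarith
    qed
  qed
  moreover have "v t = 1" by (rule vI) (use t in \<open>simp add: U_def power_int_minus\<close>)
  ultimately show ?thesis by blast
qed

section \<open>From the classical definition of a Dedekind domain to discrete valuations and finite
  character\<close>

locale dedekind = fixes D :: "'k::field set" assumes ded: "dedekind_domain D"
begin

sublocale field_subring D by unfold_locales (use ded in \<open>simp add: dedekind_domain_def\<close>)

text \<open>Zorn's lemma asks that unions of chains in \<open>S\<close> belong to \<open>S\<close>;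
  in a Noetherian ring such a union is a member of the chain.\<close>

lemma ex_maximal_ideal_in:
  assumes "S \<noteq> {}" "\<And>I. I \<in> S \<Longrightarrow> is_ideal D I"
  shows "\<exists>M\<in>S. \<forall>I\<in>S. M \<subseteq> I \<longrightarrow> I = M"
proof (rule subset_Zorn_nonempty[OF assms(1)])
  interpret n: noetherian_ring "subring_of D" using ded by (simp add: dedekind_domain_def)
  fix C assume C: "C \<noteq> {}" "subset.chain S C"
  hence "subset.chain {I. ideal I (subring_of D)} C"
    using assms(2) unfolding ideal_iff subset_chain_def by blast
  thus "\<Union>C \<in> S" using n.ideal_chain_is_trivial[OF C(1)] C(2) by (auto simp: subset_chain_def)
qed

lemma ascending_ideals:
  assumes "\<And>n. is_ideal D (I n)" "\<And>n. I n \<subseteq> I (Suc n)"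
  shows "\<exists>n. I (Suc n) = I n"
proof -
  have "\<exists>M\<in>range I. \<forall>J\<in>range I. M \<subseteq> J \<longrightarrow> J = M"
    by (rule ex_maximal_ideal_in) (use assms in auto)
  then obtain n where "\<forall>J\<in>range I. I n \<subseteq> J \<longrightarrow> J = I n" by blast
  thus ?thesis using assms(2)[of n] by blast
qed

lemma prime_max: "is_prime D P \<Longrightarrow> P \<noteq> {0} \<Longrightarrow> P \<in> max_spec D"
proof -
  assume P: "is_prime D P" "P \<noteq> {0}"
  have "primeideal P (subring_of D)"
  proof (rule primeidealI)
    show "ideal P (subring_of D)" using P by (simp add: is_prime_def ideal_iff)
    show "cring (subring_of D)" by (rule is_cring)
    have "1 \<in> D" "1 \<notin> P" using P by (auto simp: is_prime_def)
    thus "carrier (subring_of D) \<noteq> P" by auto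
  qed (use P in \<open>auto simp: is_prime_def\<close>)
  thus ?thesis using ded P unfolding dedekind_domain_def max_spec_def by blast
qed

lemma max_nonzero: "M \<in> max_spec D \<Longrightarrow> M \<noteq> {0}"
  using cring.zeromaximalideal_eq_field[OF is_cring] ded
  by (auto simp: max_spec_def dedekind_domain_def)

text \<open>Stands for the inclusion of the ideal product of \<open>Ps\<close> in \<open>I\<close>,
  tested on the elements that generate that product. The empty list stands for the unit ideal, and
  repetitions count.\<close>

definition prods_in :: "'k set list \<Rightarrow> 'k set \<Rightarrow> bool" where
  "prods_in Ps I \<longleftrightarrow> set Ps \<subseteq> max_spec D \<and> (\<forall>ps. list_all2 (\<in>) ps Ps \<longrightarrow> prod_list ps \<in> I)"

lemma ideal_adjoin:
  assumes I: "is_ideal D I" and x: "x \<in> D"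
  shows "is_ideal D {i + d * x | i d. i \<in> I \<and> d \<in> D}" (is "is_ideal D ?J")
  unfolding is_ideal_def
proof (intro conjI ballI)
  note D = idealD[OF I]
  show "?J \<subseteq> D" using D(1) x by auto
  show "0 \<in> ?J" using D(2) by force
  fix u v assume "u \<in> ?J" "v \<in> ?J"
  then obtain i d j e where "u = i + d * x" "v = j + e * x" "i \<in> I" "j \<in> I" "d \<in> D" "e \<in> D" by blast
  thus "u + v \<in> ?J" using D(3) by (intro CollectI exI[of _ "i + j"] exI[of _ "d + e"]) (auto simp: algebra_simps)
next
  note D = idealD[OF I]
  fix a v assume "a \<in> D" "v \<in> ?J"
  then obtain j e where "v = j + e * x" "j \<in> I" "e \<in> D" by blast
  thus "a * v \<in> ?J" using D(4) \<open>a \<in> D\<close>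
    by (intro CollectI exI[of _ "a * j"] exI[of _ "a * e"]) (auto simp: algebra_simps)
qed

text \<open>Noetherian induction: a maximal counterexample \<open>J\<close> is not prime, so it
  contains some \<open>x * y\<close> with \<open>x\<close> and \<open>y\<close> outside. The larger
  ideals \<open>J + D x\<close> and \<open>J + D y\<close> contain products of maximal ideals, and
  multiplying these gives a product inside \<open>J\<close>.\<close>

lemma ex_prods_in:
  assumes "is_ideal D I" "I \<noteq> {0}"
  shows "\<exists>Ps. prods_in Ps I"
proof (rule ccontr)
  assume no: "\<not> ?thesis"
  define S where "S = {I. is_ideal D I \<and> I \<noteq> {0} \<and> (\<nexists>Ps. prods_in Ps I)}"
  have "S \<noteq> {}" using assms no by (auto simp: S_def)
  hence "\<exists>M\<in>S. \<forall>I\<in>S. M \<subseteq> I \<longrightarrow> I = M"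
    by (rule ex_maximal_ideal_in) (auto simp: S_def)
  then obtain J where J: "J \<in> S" "\<And>I. I \<in> S \<Longrightarrow> J \<subseteq> I \<Longrightarrow> I = J" by blast
  have iJ: "is_ideal D J" "J \<noteq> {0}" "\<And>Ps. \<not> prods_in Ps J" using J by (auto simp: S_def)
  note D = idealD[OF iJ(1)]
  have "1 \<notin> J" using iJ(3)[of "[]"] by (auto simp: prods_in_def)
  moreover have "\<not> is_prime D J"
  proof
    assume "is_prime D J"
    hence "prods_in [J] J" using prime_max iJ by (auto simp: prods_in_def list_all2_Cons2)
    thus False using iJ by blast
  qed
  ultimately obtain x y where xy: "x \<in> D" "y \<in> D" "x * y \<in> J" "x \<notin> J" "y \<notin> J"
    using iJ(1) by (auto simp: is_prime_def)
  have *: "\<exists>Ps. prods_in Ps {i + d * x | i d. i \<in> J \<and> d \<in> D}" if "x \<in> D" "x \<notin> J" for x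
  proof (rule ccontr)
    let ?K = "{i + d * x | i d. i \<in> J \<and> d \<in> D}"
    assume n: "\<not> ?thesis"
    have xK: "x \<in> ?K" using D(2) by (intro CollectI exI[of _ 0] exI[of _ 1]) auto
    have JK: "J \<subseteq> ?K"
    proof
      fix j assume "j \<in> J" thus "j \<in> ?K" by (intro CollectI exI[of _ j] exI[of _ 0]) auto
    qed
    have "?K \<noteq> {0}" using xK that D(2) by (metis singletonD)
    hence "?K \<in> S" using ideal_adjoin[OF iJ(1) that(1)] n by (simp add: S_def)
    hence "?K = J" using J(2) JK by blast
    thus False using xK that by simp
  qed
  obtain Ps Qs where Ps: "prods_in Ps {i + d * x | i d. i \<in> J \<and> d \<in> D}"
    and Qs: "prods_in Qs {i + d * y | i d. i \<in> J \<and> d \<in> D}" using *[of x] *[of y] xy by blast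
  have "prods_in (Ps @ Qs) J" unfolding prods_in_def
  proof (intro conjI allI impI)
    show "set (Ps @ Qs) \<subseteq> max_spec D" using Ps Qs by (auto simp: prods_in_def)
    fix ps assume "list_all2 (\<in>) ps (Ps @ Qs)"
    then obtain as bs where ab: "ps = as @ bs" "list_all2 (\<in>) as Ps" "list_all2 (\<in>) bs Qs"
      by (auto simp: list_all2_append2)
    obtain i d where a: "prod_list as = i + d * x" "i \<in> J" "d \<in> D" using ab Ps unfolding prods_in_def by blast
    obtain j e where b: "prod_list bs = j + e * y" "j \<in> J" "e \<in> D" using ab Qs unfolding prods_in_def by blast
    have eq: "prod_list ps = i * (j + e * y) + ((d * x) * j + (d * e) * (x * y))"
      unfolding ab(1) prod_list.append a(1) b(1) by (simp add: algebra_simps)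
    show "prod_list ps \<in> J" unfolding eq
      using a b xy D(1) by (intro D(3) D(5)[of "j + e * y" i] D(4)[of "d * x" j] D(4)[of "d * e"]) auto
  qed
  thus False using iJ by blast
qed

lemma prods_not_in_prime:
  assumes "is_prime D Q" "\<forall>P\<in>set Ps. P \<subseteq> D \<and> \<not> P \<subseteq> Q"
  shows "\<exists>ps. list_all2 (\<in>) ps Ps \<and> prod_list ps \<in> D \<and> prod_list ps \<notin> Q"
  using assms(2)
proof (induction Ps)
  case Nil thus ?case using assms(1) by (auto simp: is_prime_def)
next
  case (Cons P Ps)
  then obtain ps where ps: "list_all2 (\<in>) ps Ps" "prod_list ps \<in> D" "prod_list ps \<notin> Q" by auto
  obtain p where p: "p \<in> P" "p \<in> D" "p \<notin> Q" using Cons.prems by auto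
  have "p * prod_list ps \<notin> Q" using assms(1) p ps unfolding is_prime_def by blast
  thus ?case using p ps by (intro exI[of _ "p # ps"]) auto
qed

lemma max_in_prods:
  assumes "prods_in Ps I" "I \<subseteq> Q" "Q \<in> max_spec D"
  shows "Q \<in> set Ps"
proof (rule ccontr)
  assume n: "Q \<notin> set Ps"
  have "\<forall>P\<in>set Ps. P \<subseteq> D \<and> \<not> P \<subseteq> Q"
    using n assms(1,3) max_spec_eqI max_spec_ideal unfolding prods_in_def is_ideal_def by blast
  then obtain ps where "list_all2 (\<in>) ps Ps" "prod_list ps \<notin> Q"
    using prods_not_in_prime[OF max_spec_prime[OF assms(3)]] by blast
  thus False using assms(1,2) by (auto simp: prods_in_def)
qed

lemma ideal_principal: "a \<in> D \<Longrightarrow> is_ideal D {d * a | d. d \<in> D}"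
proof -
  assume a: "a \<in> D"
  have "is_ideal D {0}" by (auto simp: is_ideal_def)
  from ideal_adjoin[OF this a] show ?thesis by simp
qed

text \<open>Every maximal ideal containing \<open>a\<close> occurs in a fixed list whose product
  lies in the ideal generated by \<open>a\<close>.\<close>

lemma finite_character: "finite_character D"
  unfolding finite_character_def
proof (intro ballI impI)
  fix a assume a: "a \<in> D" "a \<noteq> 0"
  have "a \<in> {d * a | d. d \<in> D}" by (intro CollectI exI[of _ 1]) auto
  hence "{d * a | d. d \<in> D} \<noteq> {0}" using a by blast
  then obtain Ps where Ps: "prods_in Ps {d * a | d. d \<in> D}" using ex_prods_in[OF ideal_principal[OF a(1)]] by blast
  have "{M \<in> max_spec D. a \<in> M} \<subseteq> set Ps"
    using max_in_prods[OF Ps] idealD(4)[OF max_spec_ideal] by blast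
  thus "finite {M \<in> max_spec D. a \<in> M}" using finite_subset by blast
qed

text \<open>
  The ideals \<open>a * (D + D x + \<dots> + D x ^ n)\<close> form an ascending chain; where it stops, \<open>x\<close> satisfies a
  monic equation.
\<close>

lemma stable_imp_mem:
  assumes x: "x \<in> quotient_field D" and Q: "Q \<subseteq> D" "a \<in> Q" "a \<noteq> 0" and st: "\<And>q. q \<in> Q \<Longrightarrow> x * q \<in> Q"
  shows "x \<in> D"
proof -
  have xn: "a * x ^ n \<in> Q" for n
  proof (induction n)
    case (Suc n) thus ?case using st[OF Suc] by (simp add: algebra_simps)
  qed (use Q in simp)
  define I where "I n = {\<Sum>i\<le>n. c i * (a * x ^ i) | c. \<forall>i. c i \<in> D}" for n
  have id: "is_ideal D (I n)" for n unfolding is_ideal_def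
  proof (intro conjI ballI)
    show "I n \<subseteq> D" 
    proof
      fix u assume "u \<in> I n"
      then obtain c where "u = (\<Sum>i\<le>n. c i * (a * x ^ i))" "\<forall>i. c i \<in> D" unfolding I_def by blast
      moreover have "c i * (a * x ^ i) \<in> D" if "c i \<in> D" for c :: "nat \<Rightarrow> 'k" and i
        using mult_mem[OF that, of "a * x ^ i"] xn[of i] Q(1) by blast
      ultimately show "u \<in> D" by (simp add: sum_mem)
    qed
    show "0 \<in> I n" unfolding I_def by (intro CollectI exI[of _ "\<lambda>_. 0"]) auto
    fix u w assume "u \<in> I n" "w \<in> I n"
    then obtain c d where "u = (\<Sum>i\<le>n. c i * (a * x ^ i))" "w = (\<Sum>i\<le>n. d i * (a * x ^ i))" "\<forall>i. c i \<in> D" "\<forall>i. d i \<in> D"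
      unfolding I_def by blast
    thus "u + w \<in> I n" unfolding I_def
      by (intro CollectI exI[of _ "\<lambda>i. c i + d i"]) (auto simp: sum.distrib distrib_right)
  next
    fix u w assume "u \<in> D" "w \<in> I n"
    then obtain d where "w = (\<Sum>i\<le>n. d i * (a * x ^ i))" "\<forall>i. d i \<in> D"
      unfolding I_def by blast
    thus "u * w \<in> I n" unfolding I_def using \<open>u \<in> D\<close>
      by (intro CollectI exI[of _ "\<lambda>i. u * d i"]) (auto simp: sum_distrib_left mult.assoc)
  qed
  have "I n \<subseteq> I (Suc n)" for n
  proof
    fix u assume "u \<in> I n"
    then obtain c where c: "u = (\<Sum>i\<le>n. c i * (a * x ^ i))" "\<forall>i. c i \<in> D" unfolding I_def by blast
    have "(\<Sum>i\<le>n. (if i \<le> n then c i else 0) * (a * x ^ i)) = (\<Sum>i\<le>n. c i * (a * x ^ i))"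
      by (rule sum.cong) auto
    thus "u \<in> I (Suc n)" unfolding I_def using c
      by (intro CollectI exI[of _ "\<lambda>i. if i \<le> n then c i else 0"]) auto
  qed
  then obtain n where n: "I (Suc n) = I n" using ascending_ideals[of I] id by blast
  have "a * x ^ Suc n \<in> I (Suc n)" unfolding I_def
    by (intro CollectI exI[of _ "\<lambda>i. if i = Suc n then 1 else 0"]) (auto simp: if_distrib[of "\<lambda>c. c * _"] cong: if_cong)
  then obtain c where c: "a * x ^ Suc n = (\<Sum>i\<le>n. c i * (a * x ^ i))" "\<forall>i. c i \<in> D"
    unfolding n unfolding I_def by blast
  have "a * x ^ Suc n = a * (\<Sum>i\<le>n. c i * x ^ i)" unfolding c(1) sum_distrib_left by (rule sum.cong) auto
  hence e: "x ^ Suc n = (\<Sum>i\<le>n. c i * x ^ i)" using Q(3) by simp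
  define p where "p = Polynomial.monom 1 (Suc n) - (\<Sum>i\<le>n. Polynomial.monom (c i) i)"
  have cf: "Polynomial.coeff p j = (if j = Suc n then 1 else if j \<le> n then - c j else 0)" for j
    unfolding p_def by (simp add: Polynomial.coeff_sum)
  have "Polynomial.degree p = Suc n"
    by (rule antisym[OF Polynomial.degree_le Polynomial.le_degree]) (auto simp: cf)
  hence "Polynomial.lead_coeff p = 1" by (simp add: cf)
  moreover have "\<forall>i. Polynomial.coeff p i \<in> D" using c(2) by (simp add: cf)
  moreover have "poly p x = 0" using e by (simp add: p_def poly_sum poly_monom)
  ultimately have "integral_over D x" unfolding integral_over_def by blast
  thus ?thesis using ded x by (auto simp: dedekind_domain_def)
qed

text \<open>The classical proof that \<open>Q\<close> is invertible. Removing \<open>Q\<close> from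
  a shortest product of maximal ideals inside \<open>a D\<close> yields some \<open>b\<close>
  outside \<open>a D\<close> with \<open>b Q\<close> inside \<open>a D\<close>. Then
  \<open>x = b / a\<close> is not in \<open>D\<close> but multiplies \<open>Q\<close> into
  \<open>D\<close>.\<close>

lemma local_generator:
  assumes Q: "Q \<in> max_spec D"
  shows "\<exists>t\<in>Q. \<exists>s\<in>D. t \<noteq> 0 \<and> s \<notin> Q \<and> (\<forall>p\<in>Q. \<exists>d\<in>D. s * p = d * t)"
proof -
  note DQ = idealD[OF max_spec_ideal[OF Q]]
  obtain a where a: "a \<in> Q" "a \<noteq> 0" "a \<in> D" using max_nonzero[OF Q] DQ(1,2) by blast
  let ?I = "{d * a | d. d \<in> D}"
  have IQ: "?I \<subseteq> Q" using DQ(4) a by blast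
  have "a \<in> {d * a | d. d \<in> D}" by (intro CollectI exI[of _ 1]) auto
  hence "{d * a | d. d \<in> D} \<noteq> {0}" using a by blast
  then obtain Ps0 where "prods_in Ps0 ?I" using ex_prods_in[OF ideal_principal[OF a(3)]] by blast
  then obtain Ps where Ps: "prods_in Ps ?I" "\<And>Rs. prods_in Rs ?I \<Longrightarrow> length Ps \<le> length Rs"
    using ex_has_least_nat[of "\<lambda>Ps. prods_in Ps ?I" Ps0 length] by blast
  have "Q \<in> set Ps" by (rule max_in_prods[OF Ps(1) IQ Q])
  then obtain As Bs where AB: "Ps = As @ Q # Bs" by (meson split_list)
  have "\<not> prods_in (As @ Bs) ?I" using Ps(2)[of "As @ Bs"] AB by auto
  moreover have "set (As @ Bs) \<subseteq> max_spec D" using Ps(1) AB by (auto simp: prods_in_def)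
  ultimately obtain rs where rs: "list_all2 (\<in>) rs (As @ Bs)" "prod_list rs \<notin> ?I"
    by (auto simp: prods_in_def)
  have sub: "P \<subseteq> D" if "P \<in> set (As @ Bs)" for P
  proof -
    have "P \<in> max_spec D" using that Ps(1) AB by (auto simp: prods_in_def)
    thus ?thesis using max_spec_ideal idealD(1) by blast
  qed
  define b where "b = prod_list rs"
  have bD: "b \<in> D"
  proof -
    have "list_all2 (\<in>) rs Rs \<Longrightarrow> (\<And>P. P \<in> set Rs \<Longrightarrow> P \<subseteq> D) \<Longrightarrow> prod_list rs \<in> D" for rs Rs
      by (induction rs Rs rule: list_all2_induct) (auto intro!: mult_mem)
    thus ?thesis using rs(1) sub b_def by blast
  qed
  have bq: "b * q \<in> ?I" if "q \<in> Q" for q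
  proof -
    obtain as bs where ab: "rs = as @ bs" "list_all2 (\<in>) as As" "list_all2 (\<in>) bs Bs"
      using rs(1) by (auto simp: list_all2_append2)
    hence "list_all2 (\<in>) (as @ q # bs) Ps" unfolding AB using that by (intro list_all2_appendI) auto
    hence "prod_list (as @ q # bs) \<in> ?I" using Ps(1) unfolding prods_in_def by blast
    thus ?thesis by (simp add: b_def ab(1) mult_ac)
  qed
  define x where "x = b / a"
  have xF: "x \<in> quotient_field D" unfolding x_def using bD a by (intro quotient_fieldI)
  have xD: "x * q \<in> D" if q: "q \<in> Q" for q
  proof -
    obtain d where "b * q = d * a" "d \<in> D" using bq[OF q] by blast
    thus ?thesis using a by (simp add: x_def)
  qed
  have "x \<notin> D"
  proof
    assume "x \<in> D"
    moreover have "b = x * a" using a by (simp add: x_def)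
    ultimately have "prod_list rs = x * a \<and> x \<in> D" using b_def by simp
    thus False using rs(2) by blast
  qed
  \<comment> \<open>Multiplication by \<open>x\<close> cannot map \<open>Q\<close> into itself,
    since \<open>x\<close> is not in \<open>D\<close>. Now \<open>q\<close> serves as
    \<open>t\<close> and \<open>x * q\<close> as \<open>s\<close>, because
    \<open>(x * q) * p = (x * p) * q\<close>.\<close>
  then obtain q where q: "q \<in> Q" "x * q \<notin> Q"
    using stable_imp_mem[OF xF _ a(1,2)] DQ(1) by blast
  have "x * q \<noteq> 0" using q DQ(2) by metis
  moreover have "x * q * p = (x * p) * q" for p by simp
  ultimately show ?thesis
    using q xD by (intro bexI[OF _ q(1)] bexI[OF _ xD[OF q(1)]]) (metis mult_zero_right)
qed

text \<open>Locally at \<open>Q\<close> every nonunit is divisible by \<open>t\<close>, and by the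
  ascending chain condition only finitely often; hence every element is a unit times a power of
  \<open>t\<close>.\<close>

lemma ex_discrete_val:
  assumes Q: "Q \<in> max_spec D"
  shows "\<exists>v. discrete_val D Q v"
proof -
  let ?L = "localization D Q"
  interpret L: field_subring ?L by unfold_locales (rule integral_domain_localization[OF max_spec_prime[OF Q]])
  note DQ = idealD[OF max_spec_ideal[OF Q]]
  have Q1: "1 \<notin> Q" using Q by (simp add: max_spec_iff)
  obtain t s where t: "t \<in> Q" "t \<noteq> 0" "s \<in> D" "s \<notin> Q" and ts: "\<And>p. p \<in> Q \<Longrightarrow> \<exists>d\<in>D. s * p = d * t"
    using local_generator[OF Q] by blast
  have tD: "t \<in> D" using DQ(1) t by blast
  have tL: "t \<in> ?L" using subset_localization[OF Q1 tD] .
  have tn: "1 / t \<notin> ?L"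
  proof
    assume "1 / t \<in> ?L"
    then obtain a r where r: "1 / t = a / r" "a \<in> D" "r \<in> D" "r \<notin> Q" "r \<noteq> 0" using DQ(2) by (rule localizationE)
    hence "r = a * t" using t by (simp add: field_simps)
    thus False using r DQ(4) t by blast
  qed
  have bounded: "\<exists>n. x / t ^ n \<notin> ?L" if x: "x \<in> quotient_field D" "x \<noteq> 0" for x
  proof (rule ccontr)
    assume "\<not> ?thesis"
    hence xL: "x / t ^ n \<in> ?L" for n by blast
    \<comment> \<open>The contractions to \<open>D\<close> of the principal ideals of the
      localization generated by \<open>x / t ^ n\<close>. They increase with \<open>n\<close>, and
      where they become stationary \<open>1 / t\<close> would have to lie in the
      localization.\<close>
    define I where "I n = {d \<in> D. \<exists>l\<in>?L. d = l * (x / t ^ n)}" for n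
    have "is_ideal D (I n)" for n unfolding is_ideal_def
    proof (intro conjI ballI)
      show "I n \<subseteq> D" "0 \<in> I n" unfolding I_def by (auto intro!: bexI[of _ 0])
      fix u w assume "u \<in> I n" "w \<in> I n"
      then obtain l m where "u = l * (x / t ^ n)" "w = m * (x / t ^ n)" "l \<in> ?L" "m \<in> ?L" "u \<in> D" "w \<in> D"
        unfolding I_def by blast
      thus "u + w \<in> I n" unfolding I_def by (auto intro!: bexI[of _ "l + m"] simp: add_divide_distrib distrib_right)
    next
      fix u w assume "u \<in> D" "w \<in> I n"
      then obtain m where m: "w = m * (x / t ^ n)" "m \<in> ?L" "w \<in> D"
        unfolding I_def by blast
      have "u * w = u * m * (x / t ^ n)" "u * m \<in> ?L" "u * w \<in> D"
        using m mult_mem[OF \<open>u \<in> D\<close> m(3)] subset_localization[OF Q1 \<open>u \<in> D\<close>] by simp_all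
      thus "u * w \<in> I n" unfolding I_def by blast
    qed
    moreover have "I n \<subseteq> I (Suc n)" for n
    proof
      fix d assume "d \<in> I n"
      then obtain l where l: "d = l * (x / t ^ n)" "l \<in> ?L" "d \<in> D" unfolding I_def by blast
      thus "d \<in> I (Suc n)" unfolding I_def using tL t(2) by (intro CollectI conjI bexI[of _ "l * t"]) auto
    qed
    ultimately obtain n where n: "I (Suc n) = I n" using ascending_ideals[of I] by blast
    obtain a r where r: "x / t ^ Suc n = a / r" "a \<in> D" "r \<in> D" "r \<notin> Q" "r \<noteq> 0"
      using xL[of "Suc n"] DQ(2) by (rule localizationE)
    have "a \<in> I (Suc n)" unfolding I_def using r subset_localization[OF Q1 r(3)]
      by (auto intro!: bexI[of _ r])
    then obtain l where l: "l \<in> ?L" "a = l * (x / t ^ n)" unfolding n by (auto simp: I_def)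
    have "x / t ^ n / t = l / r * (x / t ^ n)"
      using r(1) l(2) by (simp add: field_simps)
    hence "x / t ^ n * (1 / t) = x / t ^ n * (l / r)" by (simp add: mult.commute)
    hence "1 / t = l / r" using x t by (subst (asm) mult_cancel_left) simp
    moreover have "1 / r \<in> ?L" by (rule localizationI[of 1 r]) (use r in auto)
    ultimately show False using tn l(1) L.mult_mem[of l "1 / r"] by simp
  qed
  have red: "u / t \<in> ?L \<or> 1 / u \<in> ?L" if u: "u \<in> ?L" "u \<noteq> 0" for u
  proof -
    obtain a r where r: "u = a / r" "a \<in> D" "r \<in> D" "r \<notin> Q" "r \<noteq> 0"
      using u(1) DQ(2) by (rule localizationE)
    show ?thesis
    proof (cases "a \<in> Q")
      case True
      then obtain d where d: "d \<in> D" "s * a = d * t" using ts by blast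
      have snz: "s \<noteq> 0" using t DQ(2) by auto
      have "u / t = (s * a) / (s * r * t)" using r(1,5) snz by simp
      also have "\<dots> = d / (s * r)" unfolding d(2) using t(2) by simp
      finally have "u / t = d / (s * r)" .
      moreover have "s * r \<notin> Q" using max_spec_prime[OF Q] t r unfolding is_prime_def by blast
      ultimately have "u / t \<in> ?L" using localizationI[OF d(1) mult_mem[OF t(3) r(3)]] by blast
      thus ?thesis ..
    next
      case False
      have "1 / u = r / a" using r by simp
      thus ?thesis using r False by (auto intro: localizationI)
    qed
  qed
  have loc: "\<exists>n. 1 / (x / t ^ n) \<in> ?L \<and> x / t ^ n \<in> ?L" if x: "x \<in> ?L" "x \<noteq> 0" for x
  proof -
    have xF: "x \<in> quotient_field D" by (rule localization_subset[OF DQ(2) x(1)])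
    define n where "n = (LEAST n. x / t ^ n \<notin> ?L)"
    have n: "x / t ^ n \<notin> ?L" unfolding n_def by (rule LeastI_ex) (rule bounded[OF xF x(2)])
    then obtain m where m: "n = Suc m" using x(1) by (cases n) auto
    have mL: "x / t ^ m \<in> ?L" using not_less_Least[of m "\<lambda>n. x / t ^ n \<notin> ?L"] m n_def by auto
    have "x / t ^ m / t \<notin> ?L" using n m by (simp add: mult.commute)
    thus ?thesis using red[OF mL] mL x t by auto
  qed
  have "\<exists>k::int. x * t powi k \<in> ?L \<and> 1 / (x * t powi k) \<in> ?L" if x: "x \<in> quotient_field D" "x \<noteq> 0" for x
  proof -
    obtain a b where ab: "x = a / b" "a \<in> D" "b \<in> D" "b \<noteq> 0" using x(1) by (rule quotient_fieldE)
    have "a \<noteq> 0" using ab x by auto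
    obtain m where m: "1 / (a / t ^ m) \<in> ?L" "a / t ^ m \<in> ?L" using loc[of a] subset_localization[OF Q1] ab \<open>a \<noteq> 0\<close> by blast
    obtain n where n: "1 / (b / t ^ n) \<in> ?L" "b / t ^ n \<in> ?L" using loc[of b] subset_localization[OF Q1] ab by blast
    have "x * t powi (int n - int m) = (a / t ^ m) * (1 / (b / t ^ n))" "1 / (x * t powi (int n - int m)) = (b / t ^ n) * (1 / (a / t ^ m))"
      using t(2) ab \<open>a \<noteq> 0\<close> by (simp_all add: power_int_diff)
    thus ?thesis using m n L.mult_mem by metis
  qed
  thus ?thesis using discrete_valI[OF Q tL t(2) tn] by blast
qed

sublocale dedekind_like D
  by unfold_locales (use integral_domain ex_discrete_val finite_character in \<open>auto simp: locally_discrete_def\<close>)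

end

section \<open>Transport along an embedding of fields\<close>

locale field_embedding =
  fixes h :: "'a::field \<Rightarrow> 'b::field"
  assumes h_1: "h 1 = 1" and h_diff: "\<And>x y. h (x - y) = h x - h y"
    and h_mult: "\<And>x y. h (x * y) = h x * h y" and h_divide: "\<And>x y. h (x / y) = h x / h y"
begin

lemma h_0: "h 0 = 0" using h_diff[of 0 0] by simp
lemma h_add: "h (x + y) = h x + h y" using h_diff[of x "0 - y"] h_diff[of 0 y] h_0 by simp

lemma h_eq_0_iff: "h x = 0 \<longleftrightarrow> x = 0"
  using h_mult[of x "1 / x"] h_1 h_0 by (cases "x = 0") auto

lemma h_eq_iff: "h x = h y \<longleftrightarrow> x = y"
  using h_eq_0_iff[of "x - y"] by (simp add: h_diff)

lemma inj_h: "inj h" by (auto intro: injI simp: h_eq_iff)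

lemma mem_image_iff: "h x \<in> h ` S \<longleftrightarrow> x \<in> S" by (auto simp: h_eq_iff)

lemma field_subring_image: assumes "field_subring D" shows "field_subring (h ` D)"
proof -
  interpret field_subring D by fact
  show ?thesis
    by unfold_locales (auto simp: integral_domain_iff h_diff[symmetric] h_mult[symmetric] mem_image_iff h_1[symmetric])
qed

lemma max_spec_image:
  assumes "field_subring D" shows "max_spec (h ` D) = (`) h ` max_spec D"
proof -
  interpret field_subring D by fact
  interpret h: field_subring "h ` D" by (rule field_subring_image) fact
  have id: "is_ideal (h ` D) (h ` M) \<longleftrightarrow> is_ideal D M" for M
    unfolding is_ideal_def by (simp add: mem_image_iff h_add[symmetric] h_mult[symmetric] inj_image_subset_iff[OF inj_h] flip: h_0)
  have mx: "h ` M \<in> max_spec (h ` D) \<longleftrightarrow> M \<in> max_spec D" for M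
    unfolding max_spec_iff h.max_spec_iff id
    by (simp add: mem_image_iff h_diff[symmetric] h_mult[symmetric] flip: h_1)
  have "\<exists>N. M = h ` N" if "M \<in> max_spec (h ` D)" for M
  proof -
    have "M \<subseteq> h ` D" using that by (auto simp: h.max_spec_iff is_ideal_def)
    thus ?thesis by (meson subset_imageE)
  qed
  thus ?thesis using mx by blast
qed

lemma quotient_field_image: "quotient_field (h ` D) = h ` quotient_field D"
  unfolding quotient_field_def
  by (auto simp: h_divide h_eq_0_iff image_iff Bex_def) (metis h_divide h_eq_0_iff)+

lemma localization_image: "localization (h ` D) (h ` M) = h ` localization D M"
  unfolding localization_def
  by (auto simp: h_divide h_eq_0_iff image_iff Bex_def) (metis h_divide h_eq_iff)+

lemma dedekind_like_image: assumes "dedekind_like D" shows "dedekind_like (h ` D)"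
proof -
  interpret dedekind_like D by fact
  interpret h: field_subring "h ` D" by (rule field_subring_image) unfold_locales
  note ms = max_spec_image[OF field_subring_axioms]
  have "\<exists>w. discrete_val (h ` D) M w" if M: "M \<in> max_spec (h ` D)" for M
  proof -
    obtain N where N: "M = h ` N" "N \<in> max_spec D" using M ms by blast
    interpret v: valued_ring D N "val D N" by (rule dval_val[OF N(2)])
    have "discrete_val (h ` D) M (\<lambda>y. val D N (the_inv h y))"
      unfolding discrete_val_def N(1) quotient_field_image localization_image
      using v.dv unfolding discrete_val_def
      by (simp add: h_mult[symmetric] the_inv_f_f[OF inj_h] mem_image_iff h_eq_0_iff del: v.v_mult)
    thus ?thesis by blast
  qed
  moreover have "finite {M \<in> max_spec (h ` D). h x \<in> M}" if "x \<in> D" "x \<noteq> 0" for x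
  proof -
    have "{M \<in> max_spec (h ` D). h x \<in> M} \<subseteq> (`) h ` {M \<in> max_spec D. x \<in> M}"
      unfolding ms by (auto simp: h_eq_iff)
    thus ?thesis using finite_containing[OF that] finite_subset by blast
  qed
  ultimately show ?thesis
    by unfold_locales (auto simp: locally_discrete_def finite_character_def h.integral_domain h_eq_0_iff)
qed

end

interpretation to_ac: field_embedding "to_ac :: 'a::field \<Rightarrow> 'a alg_closure"
  by unfold_locales simp_all

section \<open>Quadratic extensions\<close>

text \<open>Integrality is stated as descent of integral dependence for arbitrary \<open>x\<close>,
  not as integrality of \<open>E\<close> over \<open>D\<close>; in this form it composes along a
  tower immediately.\<close>

definition extends_domain :: "'k::field set \<Rightarrow> 'k set \<Rightarrow> bool" where
  "extends_domain D E \<longleftrightarrow> dedekind_like D \<and> dedekind_like E \<and> D \<subseteq> E \<and> E \<inter> quotient_field D \<subseteq> D \<and>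
     (\<forall>M\<in>max_spec E. M \<inter> D \<in> max_spec D) \<and> (\<forall>Q\<in>max_spec D. \<exists>M\<in>max_spec E. M \<inter> D = Q) \<and>
     (\<forall>x. integral_over E x \<longrightarrow> integral_over D x)"

text \<open>The ramification index is 1; the residue fields are not restricted.\<close>

definition unramified :: "'k::field set \<Rightarrow> 'k set \<Rightarrow> 'k set \<Rightarrow> bool" where
  "unramified D E M \<longleftrightarrow> (\<forall>x\<in>quotient_field D. x \<noteq> 0 \<longrightarrow> val E M x = val D (M \<inter> D) x)"

text \<open>The roots of the polynomial \<open>X ^ 2 - a X + b\<close> are \<open>\<theta>\<close>
  and \<open>a - \<theta>\<close>; the last two assumptions say that it is irreducible over the
  quotient field and separable. No restriction on the characteristic is made.\<close>

locale quadratic = dedekind_like D for D :: "'k::field set" +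
  fixes a b \<theta> :: 'k
  assumes aD: "a \<in> D" and bD: "b \<in> D" and theta: "\<theta> * \<theta> = a * \<theta> - b"
    and theta_notin: "\<theta> \<notin> quotient_field D" and separable: "a - \<theta> \<noteq> \<theta>"
begin

abbreviation "K \<equiv> quotient_field D"

lemmas K_closed [simp] = quotient_field_closed subset_quotient_field

definition "L = {x + y * \<theta> | x y. x \<in> K \<and> y \<in> K}"

lemma LI: "x \<in> K \<Longrightarrow> y \<in> K \<Longrightarrow> x + y * \<theta> \<in> L" by (auto simp: L_def)

lemma LE: assumes "z \<in> L" obtains x y where "z = x + y * \<theta>" "x \<in> K" "y \<in> K"
  using assms by (auto simp: L_def)

lemma coords_unique:
  assumes "x + y * \<theta> = x' + y' * \<theta>" "x \<in> K" "y \<in> K" "x' \<in> K" "y' \<in> K"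
  shows "x = x'" "y = y'"
proof -
  show "y = y'"
  proof (rule ccontr)
    assume "y \<noteq> y'"
    moreover have "(y - y') * \<theta> = x' - x" using assms(1) by (simp add: algebra_simps)
    ultimately have "\<theta> = (x' - x) / (y - y')" by (simp add: field_simps)
    thus False using theta_notin assms by simp
  qed
  thus "x = x'" using assms(1) by simp
qed

text \<open>The nontrivial automorphism of \<open>L\<close> over \<open>K\<close>.\<close>

definition "cj z = (THE w. \<exists>x\<in>K. \<exists>y\<in>K. z = x + y * \<theta> \<and> w = x + y * (a - \<theta>))"

lemma cj_eq: "x \<in> K \<Longrightarrow> y \<in> K \<Longrightarrow> cj (x + y * \<theta>) = x + y * (a - \<theta>)"
  unfolding cj_def by (rule the_equality) (auto dest: coords_unique)

lemma K_L: "x \<in> K \<Longrightarrow> x \<in> L" using LI[of x 0] subset_quotient_field[OF zero_mem] by simp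
lemma cj_K: "x \<in> K \<Longrightarrow> cj x = x" using cj_eq[of x 0] subset_quotient_field[OF zero_mem] by simp
lemma theta_L: "\<theta> \<in> L" using LI[of 0 1] by simp
lemma cj_theta: "cj \<theta> = a - \<theta>" using cj_eq[of 0 1] by simp

lemma cj_L: assumes "z \<in> L" shows "cj z \<in> L"
proof -
  obtain x y where z: "z = x + y * \<theta>" "x \<in> K" "y \<in> K" using assms by (rule LE)
  have "cj z = (x + y * a) + (- y) * \<theta>" unfolding z(1) cj_eq[OF z(2,3)] by (simp add: algebra_simps)
  also have "\<dots> \<in> L" by (rule LI) (use z aD in auto)
  finally show ?thesis .
qed

lemma L_add: assumes "z \<in> L" "w \<in> L" shows "z + w \<in> L" "cj (z + w) = cj z + cj w"
proof -
  obtain x y where z: "z = x + y * \<theta>" "x \<in> K" "y \<in> K" using assms(1) by (rule LE)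
  obtain x' y' where w: "w = x' + y' * \<theta>" "x' \<in> K" "y' \<in> K" using assms(2) by (rule LE)
  have e: "z + w = (x + x') + (y + y') * \<theta>" using z w by (simp add: algebra_simps)
  have k: "x + x' \<in> K" "y + y' \<in> K" using z w by auto
  show "z + w \<in> L" unfolding e by (rule LI[OF k])
  show "cj (z + w) = cj z + cj w" unfolding e cj_eq[OF k] unfolding z(1) w(1) cj_eq[OF z(2,3)] cj_eq[OF w(2,3)]
    by (simp add: algebra_simps)
qed

lemma L_mult: assumes "z \<in> L" "w \<in> L" shows "z * w \<in> L" "cj (z * w) = cj z * cj w"
proof -
  obtain x y where z: "z = x + y * \<theta>" "x \<in> K" "y \<in> K" using assms(1) by (rule LE)
  obtain x' y' where w: "w = x' + y' * \<theta>" "x' \<in> K" "y' \<in> K" using assms(2) by (rule LE)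
  have "z * w = x * x' + (x * y' + y * x') * \<theta> + y * y' * (\<theta> * \<theta>)" using z w by (simp add: algebra_simps)
  also have "\<dots> = (x * x' - y * y' * b) + (x * y' + y * x' + y * y' * a) * \<theta>"
    unfolding theta by (simp add: algebra_simps)
  finally have e: "z * w = (x * x' - y * y' * b) + (x * y' + y * x' + y * y' * a) * \<theta>" .
  have k: "x * x' - y * y' * b \<in> K" "x * y' + y * x' + y * y' * a \<in> K" using z w aD bD by auto
  show "z * w \<in> L" unfolding e by (rule LI[OF k])
  have "(a - \<theta>) * (a - \<theta>) = a * (a - \<theta>) - b" using theta by (simp add: algebra_simps)
  hence t: "y * y' * ((a - \<theta>) * (a - \<theta>)) = y * y' * (a * (a - \<theta>) - b)" by simp
  have "cj z * cj w = x * x' + (x * y' + y * x') * (a - \<theta>) + y * y' * ((a - \<theta>) * (a - \<theta>))"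
    unfolding z(1) w(1) cj_eq[OF z(2,3)] cj_eq[OF w(2,3)] by (simp add: algebra_simps)
  also have "\<dots> = cj (z * w)" unfolding t e cj_eq[OF k] by (simp add: algebra_simps)
  finally show "cj (z * w) = cj z * cj w" by simp
qed

lemma cj_0: "cj 0 = 0" and cj_1: "cj 1 = 1" by (auto intro: cj_K)

lemma L_uminus: assumes "z \<in> L" shows "- z \<in> L" "cj (- z) = - cj z"
proof -
  have k: "-1 \<in> K" by simp
  show "- z \<in> L" "cj (- z) = - cj z" using L_mult[OF K_L[OF k] assms] cj_K[OF k] by auto
qed

lemma L_diff: assumes "z \<in> L" "w \<in> L" shows "z - w \<in> L" "cj (z - w) = cj z - cj w"
  using L_add[OF assms(1) L_uminus(1)[OF assms(2)]] L_uminus(2)[OF assms(2)] by auto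

lemma cj_cj: assumes "z \<in> L" shows "cj (cj z) = z"
proof -
  obtain x y where z: "z = x + y * \<theta>" "x \<in> K" "y \<in> K" using assms by (rule LE)
  have "cj z = (x + y * a) + (- y) * \<theta>" unfolding z(1) cj_eq[OF z(2,3)] by (simp add: algebra_simps)
  also have "cj \<dots> = (x + y * a) + (- y) * (a - \<theta>)" by (rule cj_eq) (use z aD in auto)
  finally show ?thesis using z by (simp add: algebra_simps)
qed

lemma norm_K: assumes "z \<in> L" shows "z * cj z \<in> K"
proof -
  obtain x y where z: "z = x + y * \<theta>" "x \<in> K" "y \<in> K" using assms by (rule LE)
  have "z * cj z = x * x + x * y * a + y * y * (a * \<theta> - \<theta> * \<theta>)"
    unfolding z(1) cj_eq[OF z(2,3)] by (simp add: algebra_simps)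
  also have "\<dots> = x * x + x * y * a + y * y * b" unfolding theta by simp
  finally show ?thesis using z aD bD by simp
qed

lemma trace_K: assumes "z \<in> L" shows "z + cj z \<in> K"
proof -
  obtain x y where z: "z = x + y * \<theta>" "x \<in> K" "y \<in> K" using assms by (rule LE)
  have "z + cj z = x + x + y * a" unfolding z(1) cj_eq[OF z(2,3)] by (simp add: algebra_simps)
  moreover have "x + x + y * a \<in> K"
    by (rule K_closed(2)[OF K_closed(2)[OF z(2,2)] K_closed(3)[OF z(3) K_closed(7)[OF aD]]])
  ultimately show ?thesis by simp
qed

lemma cj_fixed: assumes "z \<in> L" "cj z = z" shows "z \<in> K"
proof -
  obtain x y where z: "z = x + y * \<theta>" "x \<in> K" "y \<in> K" using assms(1) by (rule LE)
  have "y * ((a - \<theta>) - \<theta>) = 0" using assms(2) unfolding z(1) cj_eq[OF z(2,3)] by (simp add: algebra_simps)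
  hence "y = 0" using separable by simp
  thus ?thesis using z by simp
qed

lemma cj_nz: "z \<in> L \<Longrightarrow> z \<noteq> 0 \<Longrightarrow> cj z \<noteq> 0" using cj_cj cj_0 by metis

lemma L_inverse: assumes "z \<in> L" "w \<in> L" shows "z / w \<in> L" 
proof (cases "w = 0")
  case True thus ?thesis using K_L by simp
next
  case False
  have "z / w = z * cj w * (1 / (w * cj w))" using False cj_nz[OF assms(2)] by simp
  moreover have "1 / (w * cj w) \<in> K" by (rule K_closed(4)[OF _ norm_K[OF assms(2)]]) simp
  ultimately show ?thesis using assms L_mult(1) cj_L K_L by metis
qed

lemma cj_sum: "(\<And>i. i \<in> S \<Longrightarrow> f i \<in> L) \<Longrightarrow> cj (\<Sum>i\<in>S. f i) = (\<Sum>i\<in>S. cj (f i)) \<and> (\<Sum>i\<in>S. f i) \<in> L"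
  by (induction S rule: infinite_finite_induct) (auto simp: cj_0 K_L L_add)

text \<open>The integral closure of \<open>D\<close> in \<open>L\<close>: as \<open>D\<close> is
  integrally closed, integrality in a quadratic extension can be read off from trace and
  norm.\<close>

definition "E = {x \<in> L. x + cj x \<in> D \<and> x * cj x \<in> D}"

lemma E_L: "x \<in> E \<Longrightarrow> x \<in> L" by (simp add: E_def)

lemma cj_E: "x \<in> E \<Longrightarrow> cj x \<in> E" by (auto simp: E_def cj_L cj_cj add.commute mult.commute)

lemma D_E: "x \<in> D \<Longrightarrow> x \<in> E" by (auto simp: E_def cj_K K_L)

lemma E_K: assumes "x \<in> E" "x \<in> K" shows "x \<in> D"
proof (rule integrally_closed_2[OF assms(2) zero_mem])
  show "x * x \<in> D" using assms by (simp add: E_def cj_K)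
qed (simp add: power2_eq_square)

lemma theta_E: "\<theta> \<in> E"
proof -
  have "\<theta> * (a - \<theta>) = b" "\<theta> + (a - \<theta>) = a" using theta by (simp_all add: right_diff_distrib mult.commute)
  thus ?thesis by (simp add: E_def theta_L cj_theta aD bD)
qed

text \<open>
  The two elements are the roots of a monic quadratic polynomial over \<open>D\<close>, so that closure of \<open>D\<close>
  under roots of quadratics suffices to show that \<open>E\<close> is a ring.
\<close>

lemma mixed_traces:
  assumes "x \<in> E" "y \<in> E"
  shows "x * cj y + cj x * y \<in> D" "x * y + cj x * cj y \<in> D"
proof -
  define p where "p = (x + cj x) * (y + cj y)"
  \<comment> \<open>The product of the two elements, as \<open>p\<close> is their sum. The inner
    differences are sums of squares, such as \<open>x ^ 2 + (cj x) ^ 2\<close>, written through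
    trace and norm.\<close>
  define q where "q = (y * cj y) * ((x + cj x) * (x + cj x) - x * cj x - x * cj x) +
     (x * cj x) * ((y + cj y) * (y + cj y) - y * cj y - y * cj y)"
  have L: "x \<in> L" "y \<in> L" using assms E_L by auto
  have "x + cj x \<in> D" "x * cj x \<in> D" "y + cj y \<in> D" "y * cj y \<in> D" using assms by (auto simp: E_def)
  hence "p \<in> D" "q \<in> D" unfolding p_def q_def by simp_all
  hence pq: "p \<in> D" "- q \<in> D" by auto
  have k1: "x * cj y + cj x * y \<in> K" using trace_K[OF L_mult(1)[OF L(1) cj_L[OF L(2)]]] L_mult(2)[OF L(1) cj_L[OF L(2)]] cj_cj[OF L(2)] by simp
  have k2: "x * y + cj x * cj y \<in> K" using trace_K[OF L_mult(1)[OF L]] L_mult(2)[OF L] by simp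
  show "x * cj y + cj x * y \<in> D"
    by (rule integrally_closed_2[OF k1 pq]) (simp add: p_def q_def power2_eq_square algebra_simps)
  show "x * y + cj x * cj y \<in> D"
    by (rule integrally_closed_2[OF k2 pq]) (simp add: p_def q_def power2_eq_square algebra_simps)
qed

sublocale E: field_subring E
proof (unfold_locales, unfold integral_domain_iff, intro conjI ballI)
  show "1 \<in> E" by (simp add: D_E)
  fix x y assume xy: "x \<in> E" "y \<in> E"
  hence L: "x \<in> L" "y \<in> L" using E_L by auto
  note T = mixed_traces[OF xy]
  have "x - y + (cj x - cj y) = (x + cj x) - (y + cj y)"
    "(x - y) * (cj x - cj y) = x * cj x + y * cj y - (x * cj y + cj x * y)" by (simp_all add: algebra_simps)
  moreover have "(x + cj x) - (y + cj y) \<in> D" "x * cj x + y * cj y - (x * cj y + cj x * y) \<in> D"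
    using xy T(1) unfolding E_def by simp_all
  ultimately have "x - y + (cj x - cj y) \<in> D" "(x - y) * (cj x - cj y) \<in> D" by (simp_all only:)
  thus "x - y \<in> E" using L_diff[OF L] unfolding E_def by simp
  have "x * y * (cj x * cj y) = (x * cj x) * (y * cj y)" by (simp add: algebra_simps)
  moreover have "(x * cj x) * (y * cj y) \<in> D" using xy by (intro mult_mem[of "x * cj x"]) (simp_all add: E_def)
  ultimately have "x * y * (cj x * cj y) \<in> D" by (simp only:)
  thus "x * y \<in> E" using T L_mult[OF L] unfolding E_def by simp
qed

lemma quotient_field_E: "quotient_field E = L"
proof
  show "quotient_field E \<subseteq> L" using L_inverse E_L by (auto simp: quotient_field_def)
  show "L \<subseteq> quotient_field E"
  proof
    fix z assume "z \<in> L"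
    then obtain x y where z: "z = x + y * \<theta>" "x \<in> K" "y \<in> K" by (rule LE)
    obtain c d where x: "x = c / d" "c \<in> D" "d \<in> D" "d \<noteq> 0" using z(2) by (rule quotient_fieldE)
    obtain e f where y: "y = e / f" "e \<in> D" "f \<in> D" "f \<noteq> 0" using z(3) by (rule quotient_fieldE)
    have "z = (c * f + e * d * \<theta>) / (d * f)" using z x y by (simp add: field_simps)
    thus "z \<in> quotient_field E" using x y by (auto intro!: E.quotient_fieldI simp: D_E theta_E)
  qed
qed

lemma norm_in_ideal: "is_ideal E I \<Longrightarrow> m \<in> I \<Longrightarrow> m * cj m \<in> I \<inter> D"
  using E.idealD(1)[of I m] E.idealD(5)[of I "cj m" m] cj_E by (auto simp: E_def)

text \<open>The norm of \<open>1 - x * y\<close> lies in \<open>M\<close> and has the form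
  \<open>1 - x * y'\<close> with \<open>y'\<close> in \<open>D\<close>, so an inverse of
  \<open>x\<close> modulo \<open>M\<close> can be moved down to \<open>D\<close>.\<close>

lemma max_restrict: assumes M: "M \<in> max_spec E" shows "M \<inter> D \<in> max_spec D"
  unfolding max_spec_iff
proof (intro conjI ballI impI)
  note DM = E.idealD[OF E.max_spec_ideal[OF M]]
  show "is_ideal D (M \<inter> D)" unfolding is_ideal_def using DM(2-4) D_E by auto
  show "1 \<notin> M \<inter> D" using M by (simp add: E.max_spec_iff)
  fix x assume x: "x \<in> D" "x \<notin> M \<inter> D"
  then obtain y where y: "y \<in> E" "1 - x * y \<in> M" using M D_E[OF x(1)] unfolding E.max_spec_iff by blast
  have L: "x \<in> L" "y \<in> L" "x * y \<in> L" "1 \<in> L" using x y K_L E_L L_mult by auto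
  have "(1 - x * y) * cj (1 - x * y) \<in> M \<inter> D" by (rule norm_in_ideal[OF E.max_spec_ideal[OF M] y(2)])
  also have "cj (1 - x * y) = 1 - x * cj y"
    unfolding L_diff(2)[OF L(4,3)] L_mult(2)[OF L(1,2)] cj_1 using cj_K[of x] x by simp
  also have "(1 - x * y) * (1 - x * cj y) = 1 - x * ((y + cj y) - x * (y * cj y))"
    by (simp add: algebra_simps)
  finally show "\<exists>y\<in>D. 1 - x * y \<in> M \<inter> D"
  proof (rule bexI[of _ "(y + cj y) - x * (y * cj y)"])
    show "(y + cj y) - x * (y * cj y) \<in> D" using y(1) x(1) by (intro diff_mem mult_mem[OF x(1)]) (simp_all add: E_def)
  qed
qed

lemma cj_max: assumes M: "M \<in> max_spec E" shows "cj ` M \<in> max_spec E" "cj ` M \<inter> D = M \<inter> D"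
proof -
  note DM = E.idealD[OF E.max_spec_ideal[OF M]]
  have mem: "x \<in> cj ` M \<longleftrightarrow> cj x \<in> M" if "x \<in> E" for x
  proof
    assume "x \<in> cj ` M"
    then obtain m where "x = cj m" "m \<in> M" by blast
    thus "cj x \<in> M" using cj_cj[OF E_L[OF DM(1)]] by simp
  next
    assume "cj x \<in> M"
    thus "x \<in> cj ` M" using cj_cj[OF E_L[OF that]] by (metis imageI)
  qed
  have sub: "cj ` M \<subseteq> E" using DM(1) cj_E by auto
  show "cj ` M \<in> max_spec E" unfolding E.max_spec_iff
  proof (intro conjI ballI impI)
    show "is_ideal E (cj ` M)" unfolding is_ideal_def
    proof (intro conjI ballI sub)
      show "0 \<in> cj ` M" using mem[of 0] DM(2) cj_0 by simp
      fix x y assume "x \<in> cj ` M" "y \<in> cj ` M"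
      moreover from this have "x \<in> E" "y \<in> E" using sub by auto
      ultimately show "x + y \<in> cj ` M" using mem DM(3) L_add(2) E_L by simp
    next
      fix x y assume "x \<in> E" "y \<in> cj ` M"
      moreover from this have "y \<in> E" using sub by auto
      ultimately show "x * y \<in> cj ` M" using mem DM(4) L_mult(2) E_L cj_E by simp
    qed
    show "1 \<notin> cj ` M" using mem[of 1] M cj_1 by (simp add: E.max_spec_iff)
    fix x assume x: "x \<in> E" "x \<notin> cj ` M"
    hence "cj x \<notin> M" using mem by simp
    then obtain y where y: "y \<in> E" "1 - cj x * y \<in> M" using M cj_E[OF x(1)] unfolding E.max_spec_iff by blast
    have L: "x \<in> L" "cj y \<in> L" "x * cj y \<in> L" "1 \<in> L" using x y E_L K_L cj_L L_mult(1) by auto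
    have "cj (1 - x * cj y) = 1 - cj x * y"
      using L_diff(2)[OF L(4,3)] L_mult(2)[OF L(1,2)] cj_1 cj_cj[OF E_L[OF y(1)]] by simp
    hence "1 - x * cj y \<in> cj ` M" using mem[of "1 - x * cj y"] x y cj_E by simp
    thus "\<exists>y\<in>E. 1 - x * y \<in> cj ` M" using cj_E[OF y(1)] by blast
  qed
  have "x \<in> cj ` M \<longleftrightarrow> x \<in> M" if "x \<in> D" for x
    using mem[OF D_E[OF that]] cj_K[of x] that by simp
  thus "cj ` M \<inter> D = M \<inter> D" by blast
qed

text \<open>\<open>J\<close> is the contraction of the ideal that \<open>t\<close> generates in the
  localization of \<open>E\<close> at the complement of \<open>Q\<close>. It is proper: otherwise
  some \<open>s\<close> outside \<open>Q\<close> equals \<open>t * d\<close> with \<open>d\<close>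
  in \<open>E\<close> and in \<open>K\<close>, hence in \<open>D\<close>.\<close>

lemma ex_max_over:
  assumes Q: "Q \<in> max_spec D" shows "\<exists>M\<in>max_spec E. M \<inter> D = Q"
proof -
  interpret v: valued_ring D Q "val D Q" by (rule dval_val[OF Q])
  obtain t where t: "t \<in> Q" "t \<in> D" "t \<noteq> 0" "val D Q t = 1" by (rule v.uniformizer)
  define J where "J = {x \<in> E. \<exists>s\<in>D. \<exists>d\<in>E. s \<notin> Q \<and> s * x = t * d}"
  have J: "is_ideal E J" unfolding is_ideal_def
  proof (intro conjI ballI)
    show "J \<subseteq> E" unfolding J_def by auto
    have "1 * 0 = t * 0" by simp
    thus "0 \<in> J" unfolding J_def using v.M_1 one_mem E.zero_mem by blast
    fix x y assume "x \<in> J" "y \<in> J"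
    then obtain s d s' d' where h: "x \<in> E" "y \<in> E" "s \<in> D" "s' \<in> D" "d \<in> E" "d' \<in> E" "s \<notin> Q" "s' \<notin> Q" "s * x = t * d" "s' * y = t * d'"
      unfolding J_def by blast
    have "s * s' * (x + y) = s' * (s * x) + s * (s' * y)" by (simp add: algebra_simps)
    also have "\<dots> = t * (s' * d + s * d')" unfolding h by (simp add: algebra_simps)
    finally have "s * s' * (x + y) = t * (s' * d + s * d')" .
    moreover have "s * s' \<notin> Q" using v.M_prime h unfolding is_prime_def by blast
    moreover have "s * s' \<in> D" "s' * d + s * d' \<in> E" "x + y \<in> E" using h D_E by auto
    ultimately show "x + y \<in> J" unfolding J_def by blast
  next
    fix x y assume x: "x \<in> E" and "y \<in> J"
    then obtain s d where h: "y \<in> E" "s \<in> D" "d \<in> E" "s \<notin> Q" "s * y = t * d"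
      unfolding J_def by blast
    have "s * (x * y) = t * (x * d)" using h(5) by (simp add: algebra_simps)
    moreover have "x * d \<in> E" "x * y \<in> E" using x h by auto
    ultimately show "x * y \<in> J" using h unfolding J_def by blast
  qed
  have "1 \<notin> J"
  proof
    assume "1 \<in> J"
    then obtain s d where h: "s \<in> D" "d \<in> E" "s \<notin> Q" "s = t * d" unfolding J_def by auto
    hence "d = s / t" using t by simp
    hence "d \<in> K" using h(1) t quotient_fieldI[of s t] by simp
    hence "d \<in> D" using E_K h by blast
    thus False using h idealD(5)[OF v.M_ideal] t by blast
  qed
  then obtain M where M: "M \<in> max_spec E" "J \<subseteq> M" using E.ex_max_spec[OF J] by blast
  have "Q \<subseteq> J"
  proof
    fix q assume q: "q \<in> Q"
    have qD: "q \<in> D" using idealD(1)[OF v.M_ideal q] .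
    have "q / t \<in> localization D Q"
    proof (cases "q = 0")
      case True thus ?thesis using subset_localization[OF v.M_1] by simp
    next
      case False
      thus ?thesis using v.v_ge_0[of "q / t"] v.v_pos[OF q False] qD t by simp
    qed
    then obtain c s where s: "q / t = c / s" "c \<in> D" "s \<in> D" "s \<notin> Q" "s \<noteq> 0" using v.M_0 by (rule localizationE)
    have "s * q = t * c" using s(1,5) t(3) by (simp add: field_simps)
    thus "q \<in> J" unfolding J_def using s D_E qD by auto
  qed
  hence "Q \<subseteq> M \<inter> D" using M(2) idealD(1)[OF v.M_ideal] by auto
  hence "Q = M \<inter> D" by (rule max_spec_eqI[OF Q max_restrict[OF M(1)]])
  thus ?thesis using M by blast
qed

text \<open>
  Scaling by \<open>\<alpha>\<close> makes \<open>X ^ 2 - T X + N\<close> primitive at \<open>Q\<close>. Applied to trace and norm of \<open>z\<close>, this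
  shows that \<open>z\<close> or its inverse lies in any given localization of \<open>E\<close>.
\<close>

lemma primitive_quadratic:
  assumes Q: "Q \<in> max_spec D" and T: "T \<in> K" and N: "N \<in> K"
  shows "\<exists>\<alpha>\<in>D. \<alpha> \<noteq> 0 \<and> \<alpha> * T \<in> D \<and> \<alpha> * N \<in> D \<and> \<not> (\<alpha> \<in> Q \<and> \<alpha> * T \<in> Q \<and> \<alpha> * N \<in> Q)"
proof -
  interpret v: valued_ring D Q "val D Q" by (rule dval_val[OF Q])
  obtain t where t: "t \<in> Q" "t \<in> D" "t \<noteq> 0" "val D Q t = 1" by (rule v.uniformizer)
  define W where "W = (val D Q) ` ({1, T, N} - {0})"
  \<comment> \<open>The set \<open>W\<close> contains the value 0 of 1, so \<open>Min W\<close> is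
    at most 0 and no information is lost by \<open>nat\<close>.\<close>
  define k where "k = nat (- Min W)"
  have W: "finite W" "0 \<in> W" by (auto simp: W_def image_iff intro!: bexI[of _ 1])
  have kM: "int k = - Min W" using Min_le[OF W] by (simp add: k_def)
  have "Min W \<in> W" using W by (intro Min_in) auto
  hence "\<exists>x\<in>{1, T, N} - {0}. Min W = val D Q x" using W_def by blast
  then obtain x where x: "x \<in> {1, T, N}" "x \<noteq> 0" "val D Q x = Min W" by (metis DiffE insertI1)
  have xk: "y / t ^ 0 * t ^ k \<in> localization D Q" if "y \<in> {1, T, N}" for y
  proof (cases "y = 0")
    case True thus ?thesis using subset_localization[OF v.M_1] by simp
  next
    case False
    have "Min W \<le> val D Q y" using W False that by (intro Min_le) (auto simp: W_def)
    moreover have yK: "y \<in> K" using that T N by auto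
    ultimately show ?thesis using v.v_ge_0[of "y * t ^ k"] False t kM by simp
  qed
  obtain c s where cs: "1 * t ^ k = c / s" "s \<in> D" "s \<notin> Q" "s \<noteq> 0" "c \<in> D" using xk[of 1] v.M_0 by (auto elim: localizationE)
  obtain c' s' where cs': "T * t ^ k = c' / s'" "s' \<in> D" "s' \<notin> Q" "s' \<noteq> 0" "c' \<in> D" using xk[of T] v.M_0 by (auto elim: localizationE)
  obtain c'' s'' where cs'': "N * t ^ k = c'' / s''" "s'' \<in> D" "s'' \<notin> Q" "s'' \<noteq> 0" "c'' \<in> D" using xk[of N] v.M_0 by (auto elim: localizationE)
  \<comment> \<open>The power of \<open>t\<close> raises the least of the three values to exactly 0,
    and the factors outside \<open>Q\<close> clear the remaining denominators without changing
    values at \<open>Q\<close>.\<close>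
  define \<alpha> where "\<alpha> = s * s' * s'' * t ^ k"
  have sQ: "s * s' * s'' \<notin> Q" using v.M_prime cs cs' cs'' unfolding is_prime_def by (metis mult_mem)
  have "\<alpha> \<in> D" "\<alpha> \<noteq> 0" using cs cs' cs'' t by (auto simp: \<alpha>_def)
  moreover have "\<alpha> * T = s * s'' * c'" using cs'(1,4) unfolding \<alpha>_def by (simp add: field_simps)
  moreover have "\<alpha> * N = s * s' * c''" using cs''(1,4) unfolding \<alpha>_def by (simp add: field_simps)
  moreover have "\<alpha> * x \<notin> Q"
  proof
    assume q: "\<alpha> * x \<in> Q"
    have xK: "x \<in> K" using x T N by auto
    define \<sigma> where "\<sigma> = s * s' * s''"
    have sg: "\<sigma> \<in> D" "\<sigma> \<notin> Q" "\<sigma> \<noteq> 0" using cs cs' cs'' sQ by (auto simp: \<sigma>_def)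
    have "\<alpha> * x = \<sigma> * t ^ k * x" by (simp add: \<alpha>_def \<sigma>_def)
    hence "val D Q (\<alpha> * x) = int k + val D Q x" using sg t x(2) xK v.v_eq_0[OF sg(1,2)] by simp
    hence "val D Q (\<alpha> * x) = 0" using x kM by simp
    moreover have "\<alpha> * x \<noteq> 0" using x \<open>\<alpha> \<noteq> 0\<close> by simp
    ultimately show False using v.v_pos[OF q] by simp
  qed
  ultimately show ?thesis using x cs cs' cs'' by (intro bexI[of _ \<alpha>]) auto
qed

lemma primitive_relation:
  assumes M: "M \<in> max_spec E" and z: "z \<in> L" "z \<noteq> 0"
  obtains \<alpha> where "\<alpha> \<in> D" "\<alpha> \<noteq> 0" "\<alpha> * (z + cj z) \<in> D" "\<alpha> * (z * cj z) \<in> D"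
    "\<not> (\<alpha> \<in> M \<and> \<alpha> * (z + cj z) \<in> M \<and> \<alpha> * (z * cj z) \<in> M)"
  using primitive_quadratic[OF max_restrict[OF M] trace_K[OF z(1)] norm_K[OF z(1)]] by blast

lemma valuation_ring:
  assumes M: "M \<in> max_spec E" and z: "z \<in> L" "z \<noteq> 0"
  shows "z \<in> localization E M \<or> 1 / z \<in> localization E M"
proof -
  note DM = E.idealD[OF E.max_spec_ideal[OF M]]
  obtain \<alpha> where al: "\<alpha> \<in> D" "\<alpha> \<noteq> 0" "\<alpha> * (z + cj z) \<in> D" "\<alpha> * (z * cj z) \<in> D"
    "\<not> (\<alpha> \<in> M \<and> \<alpha> * (z + cj z) \<in> M \<and> \<alpha> * (z * cj z) \<in> M)" using M z by (rule primitive_relation)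
  define y where "y = \<alpha> * z"
  have aL: "\<alpha> \<in> L" "cj \<alpha> = \<alpha>" using al K_L cj_K by auto
  have cy: "cj y = \<alpha> * cj z" using L_mult(2)[OF aL(1) z(1)] aL by (simp add: y_def)
  note cy' = cy[unfolded y_def]
  have yE: "y \<in> E"
  proof -
    have "y + cj y = \<alpha> * (z + cj z)" "y * cj y = \<alpha> * (\<alpha> * (z * cj z))" by (simp_all add: cy' y_def algebra_simps)
    hence "y + cj y \<in> D" "y * cj y \<in> D" using al by auto
    thus ?thesis using L_mult(1)[OF aL(1) z(1)] by (simp add: E_def y_def)
  qed
  have cz: "cj z \<noteq> 0" using cj_nz z by simp
  \<comment> \<open>Each case gives a fraction with denominator outside \<open>M\<close>:
    \<open>z\<close> is \<open>y / \<alpha>\<close> or, with \<open>\<alpha>\<close> times the norm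
    of \<open>z\<close> as numerator, has denominator \<open>cj y\<close>; the inverse of
    \<open>z\<close> is obtained by exchanging numerator and denominator.\<close>
  consider "\<alpha> \<notin> M" | "\<alpha> * (z * cj z) \<notin> M" | "\<alpha> * (z + cj z) \<notin> M" using al by blast
  thus ?thesis
  proof cases
    case 1
    have "z \<in> localization E M" by (rule E.localizationI[OF yE D_E[OF al(1)] 1]) (use al in \<open>simp add: y_def\<close>)
    thus ?thesis ..
  next
    case 2
    have "1 / z \<in> localization E M"
      by (rule E.localizationI[OF cj_E[OF yE] D_E[OF al(4)] 2]) (use al cz in \<open>simp add: cy\<close>)
    thus ?thesis ..
  next
    case 3
    have "\<alpha> * (z + cj z) = y + cj y" by (simp add: cy' y_def algebra_simps)
    hence "y \<notin> M \<or> cj y \<notin> M" using 3 DM(3) by auto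
    thus ?thesis
    proof
      assume "y \<notin> M"
      have "1 / z \<in> localization E M" by (rule E.localizationI[OF D_E[OF al(1)] yE \<open>y \<notin> M\<close>]) (use al in \<open>simp add: y_def\<close>)
      thus ?thesis ..
    next
      assume "cj y \<notin> M"
      have "z \<in> localization E M"
        by (rule E.localizationI[OF D_E[OF al(4)] cj_E[OF yE] \<open>cj y \<notin> M\<close>]) (use al cz in \<open>simp add: cy\<close>)
      thus ?thesis ..
    qed
  qed
qed

end

section \<open>Valuations and maximal ideals of the quadratic extension\<close>

context quadratic begin

text \<open>
  By the ultrametric inequality, two of the three terms in \<open>\<alpha> z ^ 2 + \<gamma> = \<beta> z\<close> have the same value.
  Hence the square of every \<open>z\<close> is a power of \<open>t\<close> up to a unit, and the value group is generated
  either by the value of \<open>t\<close> or by half of it.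
\<close>

lemma ex_discrete_val_E:
  assumes M: "M \<in> max_spec E"
  shows "\<exists>v. discrete_val E M v"
proof -
  define Q where "Q = M \<inter> D"
  have Q: "Q \<in> max_spec D" unfolding Q_def by (rule max_restrict[OF M])
  interpret v: valued_ring D Q "val D Q" by (rule dval_val[OF Q])
  obtain t where t: "t \<in> Q" "t \<in> D" "t \<noteq> 0" "val D Q t = 1" by (rule v.uniformizer)
  have tL: "t \<in> L" "t \<in> K" "t \<in> M" using t K_L Q_def by auto
  let ?V = "localization E M"
  interpret V: field_subring ?V by unfold_locales (rule E.integral_domain_localization[OF E.max_spec_prime[OF M]])
  note DM = E.idealD[OF E.max_spec_ideal[OF M]]
  have M1: "1 \<notin> M" using M by (simp add: E.max_spec_iff)
  have tV: "t \<in> ?V" using E.subset_localization[OF M1 D_E[OF t(2)]] .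
  have tn: "1 / t \<notin> ?V"
  proof
    assume "1 / t \<in> ?V"
    then obtain c s where s: "1 / t = c / s" "c \<in> E" "s \<in> E" "s \<notin> M" "s \<noteq> 0" using DM(2) by (rule E.localizationE)
    hence "s = c * t" using t by (simp add: field_simps)
    thus False using s DM(4) tL by blast
  qed
  define U where "U x \<longleftrightarrow> x \<noteq> 0 \<and> x \<in> ?V \<and> 1 / x \<in> ?V" for x
  have Um: "U (x * y)" if "U x" "U y" for x y
    using that V.mult_mem[of x y] V.mult_mem[of "1/x" "1/y"] by (auto simp: U_def)
  have Ui: "U (1 / x)" if "U x" for x using that by (auto simp: U_def)
  have Upow: "U (x ^ n)" if "U x" for x n using Um that by (induction n) (auto simp: U_def)
  have Up: "U (x powi k)" if "U x" for x k
    using Upow[OF that] Upow[OF Ui[OF that]] by (auto simp: power_int_def inverse_eq_divide)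
  \<comment> \<open>Either \<open>x\<close> or \<open>1 / x\<close> is in the valuation ring, and
    multiplying by the unit \<open>x * x\<close> or its inverse gives the other one.\<close>
  have Usq: "U x" if "x \<in> L" "U (x * x)" for x
  proof -
    have nz: "x \<noteq> 0" using that by (auto simp: U_def)
    have "1 / (x * x) * x = 1 / x" "(x * x) * (1 / x) = x" using nz by auto
    moreover have "1 / (x * x) \<in> ?V" "x * x \<in> ?V" using that by (auto simp: U_def)
    moreover have "x \<in> ?V \<or> 1 / x \<in> ?V" by (rule valuation_ring[OF M that(1) nz])
    ultimately have "x \<in> ?V" "1 / x \<in> ?V" using V.mult_mem by metis+
    thus ?thesis using nz by (simp add: U_def)
  qed
  have nonunit: "U (1 + n)" if n: "n \<in> ?V" "\<not> U n" for n
  proof -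
    obtain c s where s: "n = c / s" "c \<in> E" "s \<in> E" "s \<notin> M" "s \<noteq> 0" using n(1) DM(2) by (rule E.localizationE)
    have "c \<in> M"
    proof (rule ccontr)
      assume c: "c \<notin> M"
      hence "c \<noteq> 0" using DM(2) by auto
      moreover have "1 / n \<in> ?V" by (rule E.localizationI[OF s(3,2) c]) (simp add: s(1))
      ultimately show False using n s by (auto simp: U_def)
    qed
    have sc: "s + c \<notin> M"
    proof
      assume "s + c \<in> M"
      hence "s + c - c \<in> M" using DM(7) \<open>c \<in> M\<close> by blast
      thus False using s by simp
    qed
    hence "s + c \<noteq> 0" using DM(2) by auto
    have e: "1 + n = (s + c) / s" using s by (simp add: field_simps)
    have "1 + n \<in> ?V" by (rule E.localizationI[OF _ s(3,4) e]) (use s in simp)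
    moreover have "1 / (1 + n) \<in> ?V" by (rule E.localizationI[OF s(3) _ sc]) (use s e in simp_all)
    moreover have "1 + n \<noteq> 0" using e s \<open>s + c \<noteq> 0\<close> by simp
    ultimately show ?thesis by (simp add: U_def)
  qed
  have tri: "U (x / y) \<or> U (w / x) \<or> U (w / y)"
    if h: "x \<in> L" "y \<in> L" "x \<noteq> 0" "y \<noteq> 0" "x + y = w" for x y w
  proof -
    have "x / y \<in> ?V \<or> 1 / (x / y) \<in> ?V"
      by (rule valuation_ring[OF M L_inverse[OF h(1,2)]]) (use h in simp)
    moreover have "w / y = 1 + x / y" "w / x = 1 + y / x" using h by (auto simp: field_simps)
    moreover have "U (y / x) \<Longrightarrow> U (x / y)" using Ui[of "y / x"] by simp
    ultimately show ?thesis using nonunit[of "x / y"] nonunit[of "y / x"] by auto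
  qed
  have UK: "U (c * t powi (- val D Q c))" if c: "c \<in> K" "c \<noteq> 0" for c
  proof -
    let ?u = "c * t powi (- val D Q c)"
    have u: "?u \<in> K" "?u \<noteq> 0" "val D Q ?u = 0" using c tL t v.v_powi[OF tL(2) t(3)] by auto
    have "?u \<in> localization D Q" using v.v_ge_0[OF u(1,2)] u(3) by simp
    moreover have "1 / ?u \<in> localization D Q" using v.mem_M_iff'[OF u(1,2) calculation] u(3) by simp
    moreover have "localization D Q \<subseteq> ?V" using D_E by (auto simp: localization_def Q_def)
    ultimately show ?thesis using u(2) unfolding U_def by blast
  qed
  have sqK: "\<exists>k. U (z * z * t powi k)" if c: "c \<in> K" "c \<noteq> 0" "U (z * z / c)" for z c
    using Um[OF c(3) UK[OF c(1,2)]] c(2) by (auto simp: field_simps)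
  have sq: "\<exists>k. U (z * z * t powi k)" if z: "z \<in> L" "z \<noteq> 0" for z
  proof -
    obtain \<alpha> where al: "\<alpha> \<in> D" "\<alpha> \<noteq> 0" "\<alpha> * (z + cj z) \<in> D" "\<alpha> * (z * cj z) \<in> D" using M z by (rule primitive_relation)
    define \<beta> where "\<beta> = \<alpha> * (z + cj z)"
    define \<gamma> where "\<gamma> = \<alpha> * (z * cj z)"
    have gn: "\<gamma> \<noteq> 0" using al z cj_nz by (simp add: \<gamma>_def)
    have abK: "\<alpha> \<in> K" "\<beta> \<in> K" "\<gamma> \<in> K" using al by (simp_all add: \<beta>_def \<gamma>_def)
    have rel: "\<alpha> * (z * z) + \<gamma> = \<beta> * z" by (simp add: \<beta>_def \<gamma>_def algebra_simps)
    have "U (\<alpha> * (z * z) / \<gamma>) \<or> U (\<beta> * z / (\<alpha> * (z * z))) \<or> U (\<beta> * z / \<gamma>)"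
      by (rule tri[OF L_mult(1)[OF K_L[OF abK(1)] L_mult(1)[OF z(1,1)]] K_L[OF abK(3)] _ gn rel]) (use al z in simp)
    thus ?thesis
    proof (elim disjE)
      assume u: "U (\<alpha> * (z * z) / \<gamma>)"
      show ?thesis by (rule sqK[of "\<gamma> / \<alpha>"]) (use abK al gn u in \<open>simp_all add: mult.commute\<close>)
    next
      assume u: "U (\<beta> * z / (\<alpha> * (z * z)))"
      hence b: "\<beta> \<noteq> 0" unfolding U_def by (metis div_0 mult_zero_left)
      have e: "1 / (\<beta> * z / (\<alpha> * (z * z))) = z / (\<beta> / \<alpha>)" using z by simp
      have u': "U (z / (\<beta> / \<alpha>))" using Ui[OF u] unfolding e .
      have e': "z / (\<beta> / \<alpha>) * (z / (\<beta> / \<alpha>)) = z * z / ((\<beta> / \<alpha>) * (\<beta> / \<alpha>))" by simp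
      have u'': "U (z * z / ((\<beta> / \<alpha>) * (\<beta> / \<alpha>)))" using Um[OF u' u'] unfolding e' .
      show ?thesis by (rule sqK[OF _ _ u'']) (use abK al b in simp_all)
    next
      assume u: "U (\<beta> * z / \<gamma>)"
      hence b: "\<beta> \<noteq> 0" unfolding U_def by (metis div_0 mult_zero_left)
      have e: "\<beta> * z / \<gamma> = z / (\<gamma> / \<beta>)" by simp
      have u': "U (z / (\<gamma> / \<beta>))" using u unfolding e .
      have e': "z / (\<gamma> / \<beta>) * (z / (\<gamma> / \<beta>)) = z * z / ((\<gamma> / \<beta>) * (\<gamma> / \<beta>))" by simp
      have u'': "U (z * z / ((\<gamma> / \<beta>) * (\<gamma> / \<beta>)))" using Um[OF u' u'] unfolding e' .
      show ?thesis by (rule sqK[OF _ _ u'']) (use abK gn b in simp_all)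
    qed
  qed
  have tp: "t powi k \<in> L" for k using v.v_powi[OF tL(2) t(3)] K_L by blast
  have t2: "t powi (2 * j) = t powi j * t powi j" for j
    unfolding mult_2 using t(3) by (intro power_int_add) simp
  have "\<exists>w. w \<in> ?V \<and> w \<noteq> 0 \<and> 1 / w \<notin> ?V \<and>
    (\<forall>x\<in>quotient_field E. x \<noteq> 0 \<longrightarrow> (\<exists>k::int. x * w powi k \<in> ?V \<and> 1 / (x * w powi k) \<in> ?V))"
  proof (cases "\<exists>z\<in>L. \<exists>k. z \<noteq> 0 \<and> odd k \<and> U (z * z * t powi k)")
    case True
    then obtain z j where z: "z \<in> L" "z \<noteq> 0" "U (z * z * t powi (2 * j + 1))" by (auto elim: oddE)
    \<comment> \<open>Since \<open>z * z * t powi (2 * j + 1)\<close> is a unit,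
      \<open>w * w\<close> equals \<open>t\<close> up to a unit: this is the uniformizer of half the
      value of \<open>t\<close>. In the other case \<open>t\<close> itself is a uniformizer.\<close>
    define w where "w = 1 / (z * t powi j)"
    have wL: "w \<in> L" "w \<noteq> 0" unfolding w_def using z t K_L tp by (auto intro!: L_inverse L_mult(1))
    have "t powi (2 * j + 1) = t powi j * t powi j * t"
      using t2[of j] t(3) power_int_add[of t "2 * j" 1] by simp
    hence "1 / (z * z * t powi (2 * j + 1)) = w * w / t" by (simp add: w_def)
    hence uw: "U (w * w / t)" using Ui[OF z(3)] by simp
    have wn: "1 / w \<notin> ?V"
    proof
      assume "1 / w \<in> ?V"
      hence "w * w / t * (1 / w * (1 / w)) \<in> ?V" using uw unfolding U_def by (metis V.mult_mem)
      thus False using tn wL by simp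
    qed
    have wV: "w \<in> ?V" using valuation_ring[OF M wL] wn by blast
    have "\<exists>k::int. x * w powi k \<in> ?V \<and> 1 / (x * w powi k) \<in> ?V" if x: "x \<in> L" "x \<noteq> 0" for x
    proof -
      obtain k where k: "U (x * x * t powi k)" using sq[OF x] by blast
      have "U (x * x * t powi k * (w * w / t) powi k)" by (rule Um[OF k Up[OF uw]])
      also have "x * x * t powi k * (w * w / t) powi k = (x * w powi k) * (x * w powi k)"
        using t(3) by (simp add: power_int_mult_distrib power_int_divide_distrib)
      finally have u: "U ((x * w powi k) * (x * w powi k))" .
      have "w powi k \<in> L"
      proof -
        have pw: "y ^ n \<in> L" if "y \<in> L" for y n using L_mult(1) that K_L[of 1] by (induction n) auto
        show ?thesis using pw[OF wL(1)] pw[OF L_inverse[OF K_L[of 1] wL(1)]] by (auto simp: power_int_def inverse_eq_divide)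
      qed
      from Usq[OF L_mult(1)[OF x(1) this] u] show ?thesis unfolding U_def by blast
    qed
    thus ?thesis using wV wL wn unfolding quotient_field_E by blast
  next
    case False
    have "\<exists>k::int. x * t powi k \<in> ?V \<and> 1 / (x * t powi k) \<in> ?V" if x: "x \<in> L" "x \<noteq> 0" for x
    proof -
      obtain k where k: "U (x * x * t powi k)" using sq[OF x] by blast
      hence "even k" using False x by blast
      then obtain j where j: "k = 2 * j" by (rule evenE)
      have e: "x * x * t powi k = (x * t powi j) * (x * t powi j)"
        using t2[of j] by (simp add: j)
      have "U ((x * t powi j) * (x * t powi j))" using k unfolding e .
      from Usq[OF L_mult(1)[OF x(1) tp] this] show ?thesis unfolding U_def by blast
    qed
    thus ?thesis using tV t(3) tn unfolding quotient_field_E by blast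
  qed
  then obtain w where w: "w \<in> ?V" "w \<noteq> 0" "1 / w \<notin> ?V"
    "\<And>x. x \<in> quotient_field E \<Longrightarrow> x \<noteq> 0 \<Longrightarrow> \<exists>k::int. x * w powi k \<in> ?V \<and> 1 / (x * w powi k) \<in> ?V" by blast
  show ?thesis using E.discrete_valI[OF M w] by blast
qed

text \<open>Otherwise some \<open>u\<close> in \<open>N\<close> is congruent to 1 modulo
  \<open>M\<close> and its conjugate. Its norm lies in \<open>N\<close> and in \<open>D\<close>,
  hence in \<open>M\<close>, so \<open>u\<close> or \<open>cj u\<close> lies in \<open>M\<close>,
  although both are congruent to 1 there.\<close>

lemma over_same:
  assumes M: "M \<in> max_spec E" "N \<in> max_spec E" "M \<inter> D = N \<inter> D"
  shows "N = M \<or> N = cj ` M"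
proof (rule ccontr)
  assume n: "\<not> ?thesis"
  note cM = cj_max[OF M(1)]
  obtain u where u: "u \<in> E" "u \<in> N" "1 - u \<in> M" "1 - u \<in> cj ` M"
    using E.max_spec_approx[of "{N}" "{M, cj ` M}"] n M cM by auto
  have "cj (1 - u) \<in> M"
  proof -
    obtain m where "1 - u = cj m" "m \<in> M" using u(4) by blast
    thus ?thesis using cj_cj[OF E_L[OF E.idealD(1)[OF E.max_spec_ideal[OF M(1)]]]] by simp
  qed
  moreover have "1 \<in> L" using K_L by simp
  ultimately have cu: "1 - cj u \<in> M" using L_diff(2) E_L[OF u(1)] cj_1 by simp
  have "u * cj u \<in> N \<inter> D" by (rule norm_in_ideal[OF E.max_spec_ideal[OF M(2)] u(2)])
  hence "u * cj u \<in> M" using M(3) by blast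
  hence uM: "u \<in> M \<or> cj u \<in> M" using E.max_spec_prime[OF M(1)] u cj_E unfolding is_prime_def by blast
  note DM = E.idealD[OF E.max_spec_ideal[OF M(1)]]
  have "1 \<in> M" using uM DM(3)[OF u(3), of u] DM(3)[OF cu, of "cj u"] by auto
  thus False using M(1) by (simp add: E.max_spec_iff)
qed

lemma finite_over: "Q \<in> max_spec D \<Longrightarrow> finite {M \<in> max_spec E. M \<inter> D = Q}"
proof -
  assume "Q \<in> max_spec D"
  then obtain M where "M \<in> max_spec E" "M \<inter> D = Q" using ex_max_over by blast
  hence "{M \<in> max_spec E. M \<inter> D = Q} \<subseteq> {M, cj ` M}" using over_same by blast
  thus ?thesis by (rule finite_subset) simp
qed

sublocale E: dedekind_like E
proof
  show "locally_discrete E" using E.integral_domain ex_discrete_val_E by (simp add: locally_discrete_def)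
  show "finite_character E" unfolding finite_character_def
  proof (intro ballI impI)
    fix x assume x: "x \<in> E" "x \<noteq> 0"
    have nx: "x * cj x \<in> D" "x * cj x \<noteq> 0" using x cj_nz[OF E_L] by (simp add: E_def, simp)
    \<comment> \<open>The zeros of \<open>x\<close> lie over zeros of its norm, and only finitely
      many ideals lie over each of these.\<close>
    have "{M \<in> max_spec E. x \<in> M} \<subseteq> (\<Union>Q\<in>{Q \<in> max_spec D. x * cj x \<in> Q}. {M \<in> max_spec E. M \<inter> D = Q})"
    proof
      fix M assume "M \<in> {M \<in> max_spec E. x \<in> M}"
      moreover from this have "x * cj x \<in> M \<inter> D" using norm_in_ideal[OF E.max_spec_ideal] by auto
      ultimately show "M \<in> (\<Union>Q\<in>{Q \<in> max_spec D. x * cj x \<in> Q}. {M \<in> max_spec E. M \<inter> D = Q})"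
        using max_restrict by auto
    qed
    moreover have "finite (\<Union>Q\<in>{Q \<in> max_spec D. x * cj x \<in> Q}. {M \<in> max_spec E. M \<inter> D = Q})"
      using finite_containing[OF nx] finite_over by blast
    ultimately show "finite {M \<in> max_spec E. x \<in> M}" by (rule finite_subset)
  qed
qed

text \<open>
  A polynomial over \<open>E\<close> times its conjugate is a polynomial over \<open>D\<close>.
\<close>

lemma integral_descend:
  assumes "integral_over E x"
  shows "integral_over D x"
proof -
  obtain p where p: "Polynomial.lead_coeff p = 1" "\<And>i. Polynomial.coeff p i \<in> E" "poly p x = 0"
    using assms by (auto simp: integral_over_def)
  define r where "r = p * map_poly cj p"
  have cf: "Polynomial.coeff (map_poly cj p) i = cj (Polynomial.coeff p i)" for i by (simp add: coeff_map_poly cj_0)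
  have "Polynomial.lead_coeff (map_poly cj p) = 1"
    using p(1) by (subst lead_coeff_map_poly_nz) (auto simp: cj_0 cj_1)
  hence "Polynomial.lead_coeff r = 1" using p(1) by (simp add: r_def Polynomial.lead_coeff_mult)
  moreover have "poly r x = 0" by (simp add: r_def p(3))
  moreover have "Polynomial.coeff r n \<in> D" for n
  proof -
    let ?c = "Polynomial.coeff p"
    have cr: "Polynomial.coeff r n = (\<Sum>i\<le>n. ?c i * cj (?c (n - i)))" by (simp add: r_def Polynomial.coeff_mult cf)
    have E: "Polynomial.coeff r n \<in> E" unfolding cr using p(2) cj_E by (auto intro!: E.sum_mem E.mult_mem)
    have cL: "?c i \<in> L" "cj (?c i) \<in> L" for i using E_L[OF p(2)] cj_L by auto
    have "cj (Polynomial.coeff r n) = (\<Sum>i\<le>n. cj (?c i * cj (?c (n - i))))"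
      unfolding cr by (rule conjunct1[OF cj_sum]) (use cL in \<open>simp add: L_mult\<close>)
    also have "\<dots> = (\<Sum>i\<le>n. ?c (n - i) * cj (?c i))"
      by (rule sum.cong) (use cL in \<open>simp_all add: L_mult cj_cj mult.commute\<close>)
    also have "\<dots> = (\<Sum>i\<le>n. ?c i * cj (?c (n - i)))"
      by (rule sum.reindex_bij_witness[of _ "\<lambda>i. n - i" "\<lambda>i. n - i"]) auto
    finally have "cj (Polynomial.coeff r n) = Polynomial.coeff r n" by (simp add: cr)
    hence "Polynomial.coeff r n \<in> K" using cj_fixed E E_L by blast
    thus ?thesis using E_K E by blast
  qed
  ultimately show ?thesis unfolding integral_over_def by blast
qed

lemma extends_domain: "extends_domain D E"
  unfolding extends_domain_def using dedekind_like_axioms E.dedekind_like_axioms D_E E_K max_restrict ex_max_over integral_descend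
  by (intro conjI subsetI ballI allI impI) blast+

lemma val_E:
  assumes M: "M \<in> max_spec E"
  shows "\<exists>e\<ge>1. \<forall>x\<in>K. x \<noteq> 0 \<longrightarrow> val E M x = e * val D (M \<inter> D) x"
proof -
  interpret v: valued_ring D "M \<inter> D" "val D (M \<inter> D)" by (rule dval_val[OF max_restrict[OF M]])
  show ?thesis by (rule v.val_restrict[OF E.dval_val[OF M]]) (use D_E in auto)
qed

text \<open>Modulo \<open>M\<close> the roots \<open>\<theta>\<close> and
  \<open>a - \<theta>\<close> have product 0 and sum 1.\<close>

lemma theta_mem:
  assumes M: "M \<in> max_spec E" and Q: "1 - a \<in> M" "b \<in> M"
  shows "\<theta> \<in> M \<longleftrightarrow> a - \<theta> \<notin> M"
proof -
  note DM = E.idealD[OF E.max_spec_ideal[OF M]]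
  have "\<theta> * (a - \<theta>) \<in> M" using theta Q(2) by (simp add: right_diff_distrib mult.commute)
  hence "\<theta> \<in> M \<or> a - \<theta> \<in> M" using E.max_spec_primeD[OF M theta_E E.diff_mem[OF D_E[OF aD] theta_E]] by blast
  moreover have "\<not> (\<theta> \<in> M \<and> a - \<theta> \<in> M)"
  proof
    assume "\<theta> \<in> M \<and> a - \<theta> \<in> M"
    hence "(1 - a) + (\<theta> + (a - \<theta>)) \<in> M" using DM(3) Q(1) by blast
    thus False using M by (simp add: E.max_spec_iff)
  qed
  ultimately show ?thesis by blast
qed

text \<open>Conjugation exchanges the two roots, so \<open>\<theta>\<close> separates an ideal over
  \<open>Q\<close> from its conjugate.\<close>

lemma split_both:
  assumes Q: "Q \<in> max_spec D" "1 - a \<in> Q" "b \<in> Q"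
  shows "\<exists>M\<in>max_spec E. M \<inter> D = Q \<and> \<theta> \<in> M" "\<exists>M\<in>max_spec E. M \<inter> D = Q \<and> \<theta> \<notin> M"
proof -
  obtain M where M: "M \<in> max_spec E" "M \<inter> D = Q" using ex_max_over[OF Q(1)] by blast
  note cM = cj_max[OF M(1)]
  have "\<theta> \<in> cj ` M \<longleftrightarrow> a - \<theta> \<in> M"
  proof
    assume "\<theta> \<in> cj ` M"
    then obtain m where m: "\<theta> = cj m" "m \<in> M" by blast
    have "cj \<theta> = m" using cj_cj[OF E_L[OF E.idealD(1)[OF E.max_spec_ideal[OF M(1)] m(2)]]] m(1) by simp
    thus "a - \<theta> \<in> M" using m cj_theta by simp
  next
    assume "a - \<theta> \<in> M"
    moreover have "\<theta> = cj (a - \<theta>)" using cj_cj[OF theta_L] cj_theta by simp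
    ultimately show "\<theta> \<in> cj ` M" by blast
  qed
  hence "\<theta> \<in> M \<longleftrightarrow> \<theta> \<notin> cj ` M" using theta_mem[OF M(1)] M(2) Q by blast
  thus "\<exists>M\<in>max_spec E. M \<inter> D = Q \<and> \<theta> \<in> M" "\<exists>M\<in>max_spec E. M \<inter> D = Q \<and> \<theta> \<notin> M"
    using M cM by metis+
qed

text \<open>
  Modulo \<open>M\<close>, the polynomial of \<open>\<theta>\<close> is \<open>X * (X - 1)\<close>. If \<open>M\<close> were ramified, an element \<open>z = x + y * \<theta>\<close> of
  value 1 at \<open>M\<close> and positive value at the conjugate of \<open>M\<close> would force \<open>y\<close>, and then \<open>x\<close>, to have
  value at least 2.
\<close>

lemma split_unramified:
  assumes M: "M \<in> max_spec E" and Q: "1 - a \<in> M" "b \<in> M"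
  shows "unramified D E M"
proof -
  interpret w: valued_ring E M "val E M" by (rule E.dval_val[OF M])
  note cM = cj_max[OF M]
  obtain e where e: "1 \<le> e" "\<And>x. x \<in> K \<Longrightarrow> x \<noteq> 0 \<Longrightarrow> val E M x = e * val D (M \<inter> D) x"
    using val_E[OF M] by blast
  note DM = E.idealD[OF w.M_ideal]
  have KF: "x \<in> quotient_field E" if "x \<in> K" for x using K_L[OF that] by (simp add: quotient_field_E)
  have thF: "\<theta> \<in> quotient_field E" "a - \<theta> \<in> quotient_field E" using theta_L L_diff(1)[OF K_L[of a] theta_L] aD by (simp_all add: quotient_field_E)
  have neq: "cj ` M \<noteq> M"
  proof
    assume "cj ` M = M"
    hence "\<theta> \<in> M \<Longrightarrow> cj \<theta> \<in> M" "a - \<theta> \<in> M \<Longrightarrow> cj (a - \<theta>) \<in> M" by blast+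
    moreover have "cj (a - \<theta>) = \<theta>" using cj_cj[OF theta_L] cj_theta by simp
    ultimately show False using theta_mem[OF M Q] cj_theta by metis
  qed
  obtain z where z: "z \<in> M" "z \<noteq> 0" "val E M z = 1" "z \<in> cj ` M"
    using E.uniformizer_in[OF M, of "{cj ` M}"] cM(1) neq by auto
  have zL: "z \<in> L" using E_L DM(1) z by blast
  obtain m where m: "z = cj m" "m \<in> M" using z(4) by blast
  have cz: "cj z \<in> M" using cj_cj[OF E_L[OF DM(1)]] m by simp
  obtain x y where xy: "z = x + y * \<theta>" "x \<in> K" "y \<in> K" using zL by (rule LE)
  \<comment> \<open>The left side lies in \<open>M\<close>. As
    \<open>\<theta> - (a - \<theta>)\<close> is a unit at \<open>M\<close>, this makes the value of
    \<open>y\<close> positive if \<open>y\<close> is nonzero.\<close>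
  have diff: "z - cj z = y * (\<theta> - (a - \<theta>))" unfolding xy(1) cj_eq[OF xy(2,3)] by (simp add: algebra_simps)
  have "e = 1"
  proof (rule ccontr)
    assume "e \<noteq> 1"
    hence e2: "2 \<le> e" using e by simp
    \<comment> \<open>All values on \<open>K\<close> are multiples of \<open>e\<close>, so a
      positive one is at least 2.\<close>
    have mult: "2 \<le> val E M c" if "c \<in> K" "c \<noteq> 0" "1 \<le> val E M c" for c
    proof -
      have "0 < e * val D (M \<inter> D) c" using that e by simp
      hence "1 \<le> val D (M \<inter> D) c" using e2 by (simp add: zero_less_mult_iff)
      hence "2 * 1 \<le> e * val D (M \<inter> D) c" using e2 by (intro mult_mono) auto
      thus ?thesis using e that by simp
    qed
    have th: "\<theta> - (a - \<theta>) \<notin> M"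
    proof
      assume n: "\<theta> - (a - \<theta>) \<in> M"
      have a: "\<theta> = (a - \<theta>) + (\<theta> - (a - \<theta>))" "a - \<theta> = \<theta> - (\<theta> - (a - \<theta>))" by (simp_all add: algebra_simps)
      have "a - \<theta> \<in> M \<Longrightarrow> \<theta> \<in> M" "\<theta> \<in> M \<Longrightarrow> a - \<theta> \<in> M"
        using DM(3)[of "a - \<theta>", OF _ n] DM(7)[of \<theta>, OF _ n] a by metis+
      thus False using theta_mem[OF M Q] by blast
    qed
    have thE: "\<theta> - (a - \<theta>) \<in> E" using theta_E D_E[OF aD] by simp
    have v0: "val E M (\<theta> - (a - \<theta>)) = 0" by (rule w.v_eq_0[OF thE th])
    have nz: "\<theta> - (a - \<theta>) \<noteq> 0" using separable by simp
    have y2: "y = 0 \<or> 2 \<le> val E M (y * \<theta>)"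
    proof (cases "y = 0")
      case False
      have "y * (\<theta> - (a - \<theta>)) \<in> M" using diff DM(7)[OF z(1) cz] by simp
      moreover have "y * (\<theta> - (a - \<theta>)) \<noteq> 0" using False nz by simp
      ultimately have "0 < val E M (y * (\<theta> - (a - \<theta>)))" by (rule w.v_pos)
      also have "val E M (y * (\<theta> - (a - \<theta>))) = val E M y"
        using False nz v0 KF[OF xy(3)] E.subset_quotient_field[OF thE] by (subst w.v_mult) auto
      finally have "2 \<le> val E M y" using mult[OF xy(3) False] by simp
      moreover have "\<theta> \<noteq> 0" using theta_notin by auto
      moreover have "val E M (y * \<theta>) = val E M y + val E M \<theta>"
        using False KF[OF xy(3)] thF \<open>\<theta> \<noteq> 0\<close> by (intro w.v_mult) auto
      moreover have "0 \<le> val E M \<theta>" by (rule w.v_nonneg[OF theta_E \<open>\<theta> \<noteq> 0\<close>])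
      ultimately show ?thesis by linarith
    qed auto
    have yF: "- (y * \<theta>) \<in> quotient_field E" using KF[OF xy(3)] thF by simp
    have y2': "- (y * \<theta>) = 0 \<or> val E M z < val E M (- (y * \<theta>))"
    proof (cases "y = 0")
      case False
      have tn: "\<theta> \<noteq> 0" using theta_notin by auto
      have "val E M (- (y * \<theta>)) = val E M (y * \<theta>)"
        using w.v_uminus[of "y * \<theta>"] False tn KF[OF xy(3)] thF by simp
      thus ?thesis using y2 z False by simp
    qed auto
    have zF: "z \<in> quotient_field E" using zL by (simp add: quotient_field_E)
    have x: "x = z + (- (y * \<theta>))" using xy by simp
    have "x \<noteq> 0" "val E M x = 1" unfolding x using w.v_dominant[OF zF yF z(2) y2'] z(3) by auto
    thus False using mult[OF xy(2)] by simp
  qed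
  thus ?thesis using e unfolding unramified_def by simp
qed

text \<open>Both roots lie in \<open>M\<close>, so their product \<open>b\<close> has value at least
  2 there, while it has value 1 below.\<close>

lemma eisenstein_ramified:
  assumes M: "M \<in> max_spec E" and Q: "a \<in> M" "b \<in> M" "val D (M \<inter> D) b = 1"
  shows "\<not> unramified D E M"
proof
  assume u: "unramified D E M"
  interpret w: valued_ring E M "val E M" by (rule E.dval_val[OF M])
  note DM = E.idealD[OF w.M_ideal]
  have "\<theta> * (a - \<theta>) = b" using theta by (simp add: right_diff_distrib mult.commute)
  hence "\<theta> * (a - \<theta>) \<in> M" using Q(2) by simp
  hence "\<theta> \<in> M \<or> a - \<theta> \<in> M" using E.max_spec_primeD[OF M theta_E E.diff_mem[OF D_E[OF aD] theta_E]] by blast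
  hence th: "\<theta> \<in> M" "a - \<theta> \<in> M" using DM(7)[OF Q(1)] by fastforce+
  have nz: "\<theta> \<noteq> 0" "a - \<theta> \<noteq> 0" using theta_notin aD by auto
  have "0 < val E M \<theta>" "0 < val E M (a - \<theta>)" using w.v_pos th nz by auto
  moreover have "val E M (\<theta> * (a - \<theta>)) = val E M \<theta> + val E M (a - \<theta>)"
    using nz th DM(1) E.subset_quotient_field by (intro w.v_mult) auto
  moreover have "\<theta> * (a - \<theta>) = b" by fact
  ultimately have "2 \<le> val E M b" by simp
  moreover have "b \<noteq> 0" using \<open>\<theta> * (a - \<theta>) = b\<close> nz by auto
  ultimately show False using u Q(3) bD by (simp add: unramified_def)
qed

end

section \<open>Prescribed ramification\<close>

text \<open>For each \<open>Q\<close> in \<open>R\<close> take an element of value 1 at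
  \<open>Q\<close>, of value at least 2 at the rest of \<open>R\<close>, and contained in all ideals
  of \<open>S\<close>. In the sum of these, one term dominates at each \<open>Q\<close>.\<close>

lemma (in dedekind_like) ex_simultaneous_uniformizer:
  assumes R: "finite R" "R \<subseteq> max_spec A" and S: "finite S" "S \<subseteq> max_spec A" "S \<inter> R = {}"
  shows "\<exists>b\<in>A. (\<forall>Q\<in>S. b \<in> Q) \<and> (\<forall>Q\<in>R. b \<in> Q \<and> b \<noteq> 0 \<and> val A Q b = 1)"
proof -
  have "\<exists>b. b \<in> A \<and> b \<noteq> 0 \<and> val A Q b = 1 \<and> (\<forall>P\<in>R - {Q}. 2 \<le> val A P b) \<and> (\<forall>P\<in>S. b \<in> P)" if Q: "Q \<in> R" for Q
  proof -
    have Qm: "Q \<in> max_spec A" using Q R by auto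
    interpret v: valued_ring A Q "val A Q" by (rule dval_val[OF Qm])
    have "\<exists>y\<in>Q. y \<noteq> 0 \<and> val A Q y = 1 \<and> (\<forall>P\<in>S \<union> (R - {Q}). y \<in> P)"
      by (rule uniformizer_in[OF Qm]) (use R S Q in auto)
    then obtain y where y: "y \<in> Q" "y \<noteq> 0" "val A Q y = 1" "\<And>P. P \<in> S \<union> (R - {Q}) \<Longrightarrow> y \<in> P" by blast
    have "\<exists>u\<in>A - Q. \<forall>P\<in>R - {Q}. u \<in> P"
      by (rule max_spec_separate[OF Qm]) (use R in auto)
    then obtain u where u: "u \<in> A" "u \<notin> Q" "\<And>P. P \<in> R - {Q} \<Longrightarrow> u \<in> P" by blast
    have nz: "u \<noteq> 0" using u v.M_0 by auto
    have yA: "y \<in> A" using idealD(1)[OF v.M_ideal y(1)] .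
    have "2 \<le> val A P (y * u)" if P: "P \<in> R - {Q}" for P
    proof -
      interpret w: valued_ring A P "val A P" by (rule dval_val) (use P R in auto)
      have "0 < val A P y" "0 < val A P u" using w.v_pos y(2) nz y(4)[of P] u(3)[of P] P by auto
      thus ?thesis using yA u(1) y(2) nz by simp
    qed
    moreover have "y * u \<in> P" if P: "P \<in> S" for P
      using idealD(5)[OF max_spec_ideal u(1) y(4)] P S by blast
    moreover have "val A Q (y * u) = 1" using y(2,3) nz v.v_eq_0[OF u(1,2)] yA u(1) by simp
    ultimately show ?thesis using yA u(1) y(2) nz by (intro exI[of _ "y * u"]) auto
  qed
  then obtain f where f: "\<And>Q. Q \<in> R \<Longrightarrow> f Q \<in> A \<and> f Q \<noteq> 0 \<and> val A Q (f Q) = 1 \<and> (\<forall>P\<in>R - {Q}. 2 \<le> val A P (f Q)) \<and> (\<forall>P\<in>S. f Q \<in> P)"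
    by metis
  define b where "b = (\<Sum>Q\<in>R. f Q)"
  have bA: "b \<in> A" unfolding b_def using f by (intro sum_mem) auto
  have "b \<in> P" if P: "P \<in> S" for P
  proof -
    have i: "is_ideal A P" using P S max_spec_ideal by auto
    have "(\<And>Q. Q \<in> T \<Longrightarrow> f Q \<in> P) \<Longrightarrow> (\<Sum>Q\<in>T. f Q) \<in> P" for T
      by (induction T rule: infinite_finite_induct) (auto intro: idealD(2,3)[OF i])
    thus ?thesis using f P unfolding b_def by blast
  qed
  moreover have "b \<in> Q \<and> b \<noteq> 0 \<and> val A Q b = 1" if Q: "Q \<in> R" for Q
  proof -
    interpret v: valued_ring A Q "val A Q" by (rule dval_val) (use Q R in auto)
    have "(\<And>P. P \<in> T \<Longrightarrow> f P \<in> A \<and> 2 \<le> val A Q (f P)) \<Longrightarrow> (\<Sum>P\<in>T. f P) \<in> A \<and> ((\<Sum>P\<in>T. f P) = 0 \<or> 2 \<le> val A Q (\<Sum>P\<in>T. f P))" for T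
    proof (induction T rule: infinite_finite_induct)
      case (insert P T)
      have h: "f P \<in> A" "2 \<le> val A Q (f P)" "(\<Sum>P\<in>T. f P) \<in> A" "(\<Sum>P\<in>T. f P) = 0 \<or> 2 \<le> val A Q (\<Sum>P\<in>T. f P)"
        using insert by auto
      have "f P + (\<Sum>P\<in>T. f P) \<noteq> 0 \<Longrightarrow> 2 \<le> val A Q (f P + (\<Sum>P\<in>T. f P))"
        by (rule v.v_min) (use h in auto)
      thus ?case using insert.hyps h by auto
    qed auto
    from this[of "R - {Q}"] have rest: "(\<Sum>P\<in>R - {Q}. f P) \<in> A" "(\<Sum>P\<in>R - {Q}. f P) = 0 \<or> 2 \<le> val A Q (\<Sum>P\<in>R - {Q}. f P)"
      using f Q by auto
    have b: "b = f Q + (\<Sum>P\<in>R - {Q}. f P)" unfolding b_def using R(1) Q by (rule sum.remove)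
    have "b \<noteq> 0" "val A Q b = 1" unfolding b using v.v_dominant[of "f Q" "\<Sum>P\<in>R - {Q}. f P"] rest f[OF Q] by auto
    thus ?thesis using v.mem_M_iff[OF bA] by simp
  qed
  ultimately show ?thesis using bA by blast
qed

text \<open>The polynomial is \<open>X ^ 2 - a X + b\<close> with \<open>a\<close> in
  \<open>R\<close> and congruent to 1 on \<open>S\<close>, and \<open>b\<close> in \<open>S\<close>
  and of value 1 on \<open>R\<close>. A member of \<open>R\<close> makes it irreducible by
  Eisenstein's argument; a member of \<open>S\<close> forces \<open>a\<close> to be nonzero, which
  is separability in characteristic 2.\<close>

lemma quadratic_extension:
  fixes D :: "'k::alg_closed_field set"
  assumes dedekind_like: "dedekind_like D" and S: "finite S" "S \<subseteq> max_spec D" "S \<noteq> {}" and R: "finite R" "R \<subseteq> max_spec D" "R \<noteq> {}"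
    and disj: "S \<inter> R = {}"
  obtains E \<theta> where "extends_domain D E"
    "\<And>M. M \<in> max_spec E \<Longrightarrow> M \<inter> D \<in> S \<Longrightarrow> unramified D E M"
    "\<And>M. M \<in> max_spec E \<Longrightarrow> M \<inter> D \<in> R \<Longrightarrow> \<not> unramified D E M"
    "\<And>Q. Q \<in> S \<Longrightarrow> \<exists>M\<in>max_spec E. M \<inter> D = Q \<and> \<theta> \<in> M"
    "\<And>Q. Q \<in> S \<Longrightarrow> \<exists>M\<in>max_spec E. M \<inter> D = Q \<and> \<theta> \<notin> M"
proof -
  interpret dedekind_like D by fact
  obtain a where a: "a \<in> D" "\<forall>Q\<in>R. a \<in> Q" "\<forall>Q\<in>S. 1 - a \<in> Q"
    using max_spec_approx[OF R(1) S(1) R(2) S(2)] disj by blast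
  obtain b where b: "b \<in> D" "\<forall>Q\<in>S. b \<in> Q" "\<forall>Q\<in>R. b \<in> Q \<and> b \<noteq> 0 \<and> val D Q b = 1"
    using ex_simultaneous_uniformizer[OF R(1,2) S(1,2) disj] by blast
  obtain \<theta> where "poly [:b, - a, 1:] \<theta> = 0" using alg_closed_imp_poly_has_root[of "[:b, - a, 1:]"] by auto
  hence "b + \<theta> * (\<theta> - a) = 0" by (simp add: algebra_simps)
  hence th: "\<theta> * \<theta> = a * \<theta> - b" by (simp add: algebra_simps eq_diff_eq)
  have notin: "\<theta> \<notin> quotient_field D"
  proof
    assume thK: "\<theta> \<in> quotient_field D"
    have thD: "\<theta> \<in> D" by (rule integrally_closed_2[OF thK a(1), of "- b"]) (use b th in \<open>auto simp: power2_eq_square\<close>)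
    obtain Q where Q: "Q \<in> R" using R by auto
    interpret v: valued_ring D Q "val D Q" by (rule dval_val) (use Q R in auto)
    have e: "\<theta> * (a - \<theta>) = b" using th by (simp add: algebra_simps)
    hence "\<theta> * (a - \<theta>) \<in> Q" using b Q by simp
    hence "\<theta> \<in> Q \<or> a - \<theta> \<in> Q" using max_spec_primeD[OF v.M thD] thD a by auto
    hence m: "\<theta> \<in> Q" "a - \<theta> \<in> Q" using idealD(7)[OF v.M_ideal, of a] a Q by fastforce+
    have nz: "\<theta> \<noteq> 0" "a - \<theta> \<noteq> 0" using e b Q by auto
    have "0 < val D Q \<theta>" "0 < val D Q (a - \<theta>)" using v.v_pos m nz by auto
    moreover have "val D Q b = val D Q \<theta> + val D Q (a - \<theta>)" unfolding e[symmetric] using nz thD a by (intro v.v_mult) auto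
    ultimately show False using b Q by simp
  qed
  have sep: "a - \<theta> \<noteq> \<theta>"
  proof
    assume "a - \<theta> = \<theta>"
    hence a2: "a = 2 * \<theta>" by (simp add: algebra_simps)
    show False
    proof (cases "(2::'k) = 0")
      case True
      obtain Q where Q: "Q \<in> S" using S by auto
      have "a = 0" using a2 True by simp
      thus False using a(3) Q S max_spec_iff by auto
    next
      case False
      hence "\<theta> = a / 2" using a2 by simp
      moreover have "a / 2 \<in> quotient_field D" by (rule quotient_fieldI[OF a(1) _ False]) simp
      ultimately show False using notin by blast
    qed
  qed
  interpret quadratic D a b \<theta> by unfold_locales (use a b th notin sep in auto)
  have mem: "\<And>M x. x \<in> M \<inter> D \<Longrightarrow> x \<in> M" by blast
  show thesis
  proof (rule that[OF extends_domain])
    fix M assume M: "M \<in> max_spec E"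
    show "unramified D E M" if "M \<inter> D \<in> S"
      by (rule split_unramified[OF M]) (use bspec[OF a(3) that] bspec[OF b(2) that] in auto)
    show "\<not> unramified D E M" if "M \<inter> D \<in> R"
      by (rule eisenstein_ramified[OF M]) (use bspec[OF a(2) that] bspec[OF b(3) that] in auto)
  next
    fix Q assume "Q \<in> S"
    hence Q: "Q \<in> max_spec D" "1 - a \<in> Q" "b \<in> Q" using S a b by auto
    show "\<exists>M\<in>max_spec E. M \<inter> D = Q \<and> \<theta> \<in> M" "\<exists>M\<in>max_spec E. M \<inter> D = Q \<and> \<theta> \<notin> M"
      by (rule split_both[OF Q])+
  qed
qed

section \<open>Composition of extensions and of ramification indices\<close>

lemma extends_domainD:
  assumes "extends_domain D E"
  shows "dedekind_like D" "dedekind_like E" "x \<in> D \<Longrightarrow> x \<in> E" "x \<in> E \<Longrightarrow> x \<in> quotient_field D \<Longrightarrow> x \<in> D"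
    "M \<in> max_spec E \<Longrightarrow> M \<inter> D \<in> max_spec D" "Q \<in> max_spec D \<Longrightarrow> \<exists>M\<in>max_spec E. M \<inter> D = Q"
    "integral_over E x \<Longrightarrow> integral_over D x"
  using assms unfolding extends_domain_def by auto

lemma quotient_field_mono: "D \<subseteq> E \<Longrightarrow> quotient_field D \<subseteq> quotient_field E"
  by (auto simp: quotient_field_def)

lemma extends_domain_subset: "extends_domain D E \<Longrightarrow> D \<subseteq> E"
  by (simp add: extends_domain_def)

lemma extends_domain_refl: "dedekind_like D \<Longrightarrow> extends_domain D D"
proof -
  assume "dedekind_like D"
  then interpret dedekind_like D .
  have "M \<inter> D = M" if "M \<in> max_spec D" for M using idealD(1)[OF max_spec_ideal[OF that]] by auto
  thus ?thesis using dedekind_like_axioms unfolding extends_domain_def by auto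
qed

lemma extends_domain_trans:
  assumes "extends_domain D E" "extends_domain E F"
  shows "extends_domain D F"
proof -
  note 1 = extends_domainD[OF assms(1)] and 2 = extends_domainD[OF assms(2)]
  have s: "D \<subseteq> E" "E \<subseteq> F" using assms by (auto simp: extends_domain_def)
  have "M \<inter> D = (M \<inter> E) \<inter> D" for M using s by auto
  note eq = this
  show ?thesis unfolding extends_domain_def
  proof (intro conjI ballI allI impI subsetI)
    fix x assume "x \<in> F \<inter> quotient_field D"
    thus "x \<in> D" using 1(4) 2(4) quotient_field_mono[OF s(1)] by blast
  next
    fix M assume "M \<in> max_spec F" thus "M \<inter> D \<in> max_spec D" unfolding eq[of M] using 1(5) 2(5) by blast
  next
    fix Q assume "Q \<in> max_spec D"
    then obtain N where N: "N \<in> max_spec E" "N \<inter> D = Q" using 1(6) by blast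
    then obtain M where "M \<in> max_spec F" "M \<inter> E = N" using 2(6) by blast
    thus "\<exists>M\<in>max_spec F. M \<inter> D = Q" using eq[of M] N by auto
  next
    show "dedekind_like D" "dedekind_like F" by (fact 1(1), fact 2(2))
    show "x \<in> F" if "x \<in> D" for x using that s by blast
    show "integral_over D x" if "integral_over F x" for x using 1(7)[OF 2(7)[OF that]] .
  qed
qed

lemma extends_domain_val:
  assumes DE: "extends_domain D E" and M: "M \<in> max_spec E"
  shows "\<exists>e\<ge>1. \<forall>x\<in>quotient_field D. x \<noteq> 0 \<longrightarrow> val E M x = e * val D (M \<inter> D) x"
proof -
  interpret D: dedekind_like D by (rule extends_domainD(1)[OF DE])
  interpret E: dedekind_like E by (rule extends_domainD(2)[OF DE])
  interpret v: valued_ring D "M \<inter> D" "val D (M \<inter> D)" by (rule D.dval_val[OF extends_domainD(5)[OF DE M]])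
  show ?thesis by (rule v.val_restrict[OF E.dval_val[OF M] extends_domain_subset[OF DE]]) simp
qed

lemma ramified_val:
  assumes DE: "extends_domain D E" and M: "M \<in> max_spec E" and r: "\<not> unramified D E M"
  shows "\<exists>e\<ge>2. \<forall>x\<in>quotient_field D. x \<noteq> 0 \<longrightarrow> val E M x = e * val D (M \<inter> D) x"
proof -
  obtain e where e: "1 \<le> e" "\<forall>x\<in>quotient_field D. x \<noteq> 0 \<longrightarrow> val E M x = e * val D (M \<inter> D) x"
    using extends_domain_val[OF DE M] by blast
  have "e \<noteq> 1" using r e by (auto simp: unramified_def)
  thus ?thesis using e by (intro exI[of _ e]) auto
qed

text \<open>The lower step keeps normalized values, so a uniformizer of \<open>D\<close> detects the
  index of the upper step.\<close>

lemma unramified_trans: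
  assumes DE: "extends_domain D E" and EF: "extends_domain E F" and M: "M \<in> max_spec F"
    and u: "unramified D E (M \<inter> E)"
  shows "unramified D F M \<longleftrightarrow> unramified E F M"
proof -
  interpret D: dedekind_like D by (rule extends_domainD(1)[OF DE])
  have s: "D \<subseteq> E" "quotient_field D \<subseteq> quotient_field E" using extends_domain_subset[OF DE] quotient_field_mono by auto
  have eq: "M \<inter> E \<inter> D = M \<inter> D" using s by auto
  have ME: "M \<inter> E \<in> max_spec E" "M \<inter> D \<in> max_spec D"
    using extends_domainD(5)[OF EF M] extends_domainD(5)[OF extends_domain_trans[OF DE EF] M] by auto
  have ue: "val E (M \<inter> E) x = val D (M \<inter> D) x" if "x \<in> quotient_field D" "x \<noteq> 0" for x
    using u that unfolding unramified_def eq by simp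
  obtain e where e: "1 \<le> e" "\<And>x. x \<in> quotient_field E \<Longrightarrow> x \<noteq> 0 \<Longrightarrow> val F M x = e * val E (M \<inter> E) x"
    using extends_domain_val[OF EF M] by blast
  interpret v: valued_ring D "M \<inter> D" "val D (M \<inter> D)" by (rule D.dval_val[OF ME(2)])
  obtain t where t: "t \<in> D" "t \<noteq> 0" "val D (M \<inter> D) t = 1" by (rule v.uniformizer)
  have tE: "t \<in> quotient_field E" using t s D.subset_quotient_field by blast
  show ?thesis
  proof
    assume "unramified D F M"
    hence "val F M t = 1" using t D.subset_quotient_field by (simp add: unramified_def)
    hence "e = 1" using e(2)[OF tE t(2)] ue[of t] t D.subset_quotient_field by simp
    thus "unramified E F M" using e by (simp add: unramified_def)
  next
    assume "unramified E F M"
    thus "unramified D F M" using ue s unfolding unramified_def by auto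
  qed
qed

text \<open>The ideals over \<open>Q\<close> are zeros in \<open>E\<close> of a uniformizer of
  \<open>Q\<close>, so finite character of \<open>E\<close> bounds them.\<close>

lemma finite_over_max:
  assumes DE: "extends_domain D E" and T: "finite T" "T \<subseteq> max_spec D"
  shows "finite {M \<in> max_spec E. M \<inter> D \<in> T}"
proof -
  interpret D: dedekind_like D by (rule extends_domainD(1)[OF DE])
  interpret E: dedekind_like E by (rule extends_domainD(2)[OF DE])
  have "finite {M \<in> max_spec E. M \<inter> D = Q}" if Q: "Q \<in> T" for Q
  proof -
    interpret v: valued_ring D Q "val D Q" by (rule D.dval_val) (use Q T in auto)
    obtain t where t: "t \<in> Q" "t \<in> D" "t \<noteq> 0" by (rule v.uniformizer)
    have "finite {M \<in> max_spec E. t \<in> M}" by (rule E.finite_containing) (use t extends_domainD(3)[OF DE] in auto)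
    moreover have "{M \<in> max_spec E. M \<inter> D = Q} \<subseteq> {M \<in> max_spec E. t \<in> M}" using t by blast
    ultimately show ?thesis by (metis finite_subset)
  qed
  moreover have "{M \<in> max_spec E. M \<inter> D \<in> T} = (\<Union>Q\<in>T. {M \<in> max_spec E. M \<inter> D = Q})" by blast
  ultimately show ?thesis using T(1) by simp
qed

text \<open>
  Two quadratic steps: the first one splits every ideal of \<open>T\<close> in two, the second one ramifies exactly
  one half if the ideal is not in \<open>T0\<close>. The auxiliary ideals \<open>p\<close> and \<open>q\<close> ensure that both steps are
  proper separable extensions.
\<close>

lemma prescribed_extension:
  fixes D :: "'k::alg_closed_field set"
  assumes dedekind_like: "dedekind_like D" and inf: "infinite (max_spec D)" and T: "finite T" "T \<subseteq> max_spec D" "T0 \<subseteq> T"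
  shows "\<exists>E. extends_domain D E \<and> (\<forall>M\<in>max_spec E. M \<inter> D \<in> T0 \<longrightarrow> unramified D E M) \<and>
    (\<forall>Q\<in>T. \<exists>M\<in>max_spec E. M \<inter> D = Q \<and> unramified D E M) \<and>
    (\<forall>Q\<in>T - T0. \<exists>M\<in>max_spec E. M \<inter> D = Q \<and> \<not> unramified D E M)"
proof -
  have "\<not> max_spec D \<subseteq> T" using inf T(1) by (metis finite_subset)
  then obtain p where p: "p \<in> max_spec D" "p \<notin> T" by blast
  have "infinite (max_spec D - insert p T)" using inf T(1) by simp
  hence "max_spec D - insert p T \<noteq> {}" by (metis finite.emptyI)
  then obtain q where q: "q \<in> max_spec D" "q \<notin> T" "q \<noteq> p" by blast
  have pT: "finite (insert p T)" "insert p T \<subseteq> max_spec D" "insert p T \<noteq> {}" "finite {q}" "{q} \<subseteq> max_spec D"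
    "{q} \<noteq> {}" "insert p T \<inter> {q} = {}" using T p q by auto
  obtain E \<theta> where E: "extends_domain D E" and
    Eu: "\<And>M. M \<in> max_spec E \<Longrightarrow> M \<inter> D \<in> insert p T \<Longrightarrow> unramified D E M" and
    "\<And>M. M \<in> max_spec E \<Longrightarrow> M \<inter> D \<in> {q} \<Longrightarrow> \<not> unramified D E M" and
    Es: "\<And>Q. Q \<in> insert p T \<Longrightarrow> \<exists>M\<in>max_spec E. M \<inter> D = Q \<and> \<theta> \<in> M"
      "\<And>Q. Q \<in> insert p T \<Longrightarrow> \<exists>M\<in>max_spec E. M \<inter> D = Q \<and> \<theta> \<notin> M"
    by (rule quadratic_extension[OF dedekind_like pT], rule that; assumption)
  \<comment> \<open>Over an ideal of \<open>T\<close>, membership of \<open>\<theta>\<close> tells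
    the two halves apart. The half without \<open>\<theta>\<close> goes to \<open>R\<close>, unless
    it lies over \<open>T0\<close>.\<close>
  define S where "S = {M \<in> max_spec E. M \<inter> D \<in> insert p T0 \<or> (M \<inter> D \<in> T \<and> \<theta> \<in> M)}"
  define R where "R = {M \<in> max_spec E. M \<inter> D \<in> insert q (T - T0) \<and> M \<notin> S}"
  have fW: "finite {M \<in> max_spec E. M \<inter> D \<in> insert p (insert q T)}"
    by (rule finite_over_max[OF E]) (use T p q in auto)
  have W: "S \<subseteq> {M \<in> max_spec E. M \<inter> D \<in> insert p (insert q T)}"
    "R \<subseteq> {M \<in> max_spec E. M \<inter> D \<in> insert p (insert q T)}" using T(3) by (auto simp: S_def R_def)
  note fin = finite_subset[OF W(1) fW] finite_subset[OF W(2) fW]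
  have "S \<noteq> {}" using Es(1)[of p] by (auto simp: S_def)
  have "R \<noteq> {}"
  proof -
    obtain M where "M \<in> max_spec E" "M \<inter> D = q" using extends_domainD(6)[OF E q(1)] by blast
    hence "M \<in> R" using q T(3) by (auto simp: R_def S_def)
    thus ?thesis by blast
  qed
  have "S \<subseteq> max_spec E" "R \<subseteq> max_spec E" "S \<inter> R = {}" by (auto simp: S_def R_def)
  obtain F \<theta>' where F: "extends_domain E F" and
    Fu: "\<And>M. M \<in> max_spec F \<Longrightarrow> M \<inter> E \<in> S \<Longrightarrow> unramified E F M" and
    Fr: "\<And>M. M \<in> max_spec F \<Longrightarrow> M \<inter> E \<in> R \<Longrightarrow> \<not> unramified E F M" and
    "\<And>Q. Q \<in> S \<Longrightarrow> \<exists>M\<in>max_spec F. M \<inter> E = Q \<and> \<theta>' \<in> M" "\<And>Q. Q \<in> S \<Longrightarrow> \<exists>M\<in>max_spec F. M \<inter> E = Q \<and> \<theta>' \<notin> M"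
    by (rule quadratic_extension[OF extends_domainD(2)[OF E] fin(1) \<open>S \<subseteq> max_spec E\<close> \<open>S \<noteq> {}\<close> fin(2) \<open>R \<subseteq> max_spec E\<close> \<open>R \<noteq> {}\<close> \<open>S \<inter> R = {}\<close>], rule that; assumption)
  have DF: "extends_domain D F" by (rule extends_domain_trans[OF E F])
  have eq: "M \<inter> D = (M \<inter> E) \<inter> D" for M using extends_domain_subset[OF E] by auto
  have tr: "unramified D F M \<longleftrightarrow> unramified E F M" if "M \<in> max_spec F" "M \<inter> D \<in> T" for M
    using unramified_trans[OF E F that(1)] Eu[OF extends_domainD(5)[OF F that(1)]] that(2) unfolding eq[of M] by blast
  show ?thesis
  proof (intro exI[of _ F] conjI DF ballI impI)
    fix M assume M: "M \<in> max_spec F" "M \<inter> D \<in> T0"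
    have "M \<inter> E \<in> S" using M extends_domainD(5)[OF F M(1)] by (simp add: S_def eq[symmetric])
    thus "unramified D F M" using tr[OF M(1)] Fu[OF M(1)] M T(3) by blast
  next
    fix Q assume Q: "Q \<in> T"
    then obtain N where N: "N \<in> max_spec E" "N \<inter> D = Q" "\<theta> \<in> N" using Es by blast
    obtain M where M: "M \<in> max_spec F" "M \<inter> E = N" using extends_domainD(6)[OF F N(1)] by blast
    have "N \<in> S" using N Q by (simp add: S_def)
    thus "\<exists>M\<in>max_spec F. M \<inter> D = Q \<and> unramified D F M"
      using tr[OF M(1)] Fu[OF M(1)] M N Q eq[of M] by metis
  next
    fix Q assume Q: "Q \<in> T - T0"
    then obtain N where N: "N \<in> max_spec E" "N \<inter> D = Q" "\<theta> \<notin> N" using Es by blast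
    obtain M where M: "M \<in> max_spec F" "M \<inter> E = N" using extends_domainD(6)[OF F N(1)] by blast
    have "N \<in> R" using N Q p by (auto simp: S_def R_def)
    thus "\<exists>M\<in>max_spec F. M \<inter> D = Q \<and> \<not> unramified D F M"
      using tr[OF M(1)] Fr[OF M(1)] M N Q eq[of M] by (metis DiffD1)
  qed
qed

section \<open>Towers of extensions\<close>

text \<open>
  The label of an ideal bounds the rank of the ideals of the limit lying over it. Ideals over the
  \<open>n\<close>-th maximal ideal of \<open>D 0\<close> are under control only from stage \<open>n\<close> on; from then on, a label drops
  exactly when the ideal ramifies.
\<close>

locale tower =
  fixes D :: "nat \<Rightarrow> 'k::field set" and idx :: "'k set \<Rightarrow> nat"
    and lab :: "nat \<Rightarrow> 'k set \<Rightarrow> 'o::wellorder" and g :: "nat \<Rightarrow> 'o \<Rightarrow> 'o" and \<alpha> :: 'o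
  assumes ext: "extends_domain (D n) (D (Suc n))"
    and lab_Suc: "M \<in> max_spec (D (Suc n)) \<Longrightarrow> lab (Suc n) M =
      (if idx (M \<inter> D 0) \<le> n \<and> \<not> unramified (D n) (D (Suc n)) M then g n (lab n (M \<inter> D n)) else lab n (M \<inter> D n))"
    and zero_unram: "M \<in> max_spec (D (Suc n)) \<Longrightarrow> idx (M \<inter> D 0) \<le> n \<Longrightarrow> zero_ordinal (lab n (M \<inter> D n)) \<Longrightarrow>
      unramified (D n) (D (Suc n)) M"
    and ex_unram: "Q \<in> max_spec (D n) \<Longrightarrow> idx (Q \<inter> D 0) \<le> n \<Longrightarrow>
      \<exists>M\<in>max_spec (D (Suc n)). M \<inter> D n = Q \<and> unramified (D n) (D (Suc n)) M"
    and ex_ram: "Q \<in> max_spec (D n) \<Longrightarrow> idx (Q \<inter> D 0) \<le> n \<Longrightarrow> \<not> zero_ordinal (lab n Q) \<Longrightarrow>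
      \<exists>M\<in>max_spec (D (Suc n)). M \<inter> D n = Q \<and> \<not> unramified (D n) (D (Suc n)) M"
    and g_less: "\<not> zero_ordinal \<gamma> \<Longrightarrow> g n \<gamma> < \<gamma>"
    and g_cofinal: "\<gamma> < \<alpha> \<Longrightarrow> \<delta> < \<gamma> \<Longrightarrow> \<exists>n\<ge>N. g n \<gamma> = \<delta>"
    and lab_less: "Q \<in> max_spec (D 0) \<Longrightarrow> lab 0 Q < \<alpha>"
    and lab_onto: "\<delta> < \<alpha> \<Longrightarrow> \<exists>Q\<in>max_spec (D 0). lab 0 Q = \<delta>"
begin

abbreviation "qf n \<equiv> quotient_field (D n)"
abbreviation "vD n M \<equiv> val (D n) (M \<inter> D n)"

lemma dedekind_like: "dedekind_like (D n)" using ext[of n] by (rule extends_domainD(1))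

lemma ext_le: "n \<le> m \<Longrightarrow> extends_domain (D n) (D m)"
proof (induction rule: dec_induct)
  case base show ?case by (rule extends_domain_refl[OF dedekind_like])
next
  case (step m) thus ?case using extends_domain_trans ext by blast
qed

lemma D_mono: "n \<le> m \<Longrightarrow> D n \<subseteq> D m" using ext_le extends_domain_subset by blast

lemma int_D: "n \<le> m \<Longrightarrow> M \<inter> D m \<inter> D n = M \<inter> D n" using D_mono by blast

definition "A = (\<Union>n. D n)"

lemma D_A: "x \<in> D n \<Longrightarrow> x \<in> A" by (auto simp: A_def)

lemma A_E2: assumes "x \<in> A" "y \<in> A" obtains n where "N \<le> n" "x \<in> D n" "y \<in> D n"
proof -
  obtain k l where "x \<in> D k" "y \<in> D l" using assms by (auto simp: A_def)
  hence "x \<in> D (max N (max k l))" "y \<in> D (max N (max k l))"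
    using D_mono[of k "max N (max k l)"] D_mono[of l "max N (max k l)"] by (auto simp: le_max_iff_disj)
  thus ?thesis using that[of "max N (max k l)"] by auto
qed

sublocale A: field_subring A
proof (unfold_locales, unfold integral_domain_iff, intro conjI ballI)
  interpret dedekind_like "D 0" by (rule dedekind_like)
  show "1 \<in> A" by (rule D_A[of _ 0]) simp
  fix x y assume "x \<in> A" "y \<in> A"
  then obtain n where n: "x \<in> D n" "y \<in> D n" by (rule A_E2[of _ _ 0])
  interpret n: dedekind_like "D n" by (rule dedekind_like)
  show "x - y \<in> A" "x * y \<in> A" using n by (auto intro!: D_A[of _ n])
qed

lemma A_E1: assumes "x \<in> A" obtains n where "N \<le> n" "x \<in> D n"
  using A_E2[OF assms assms] by blast

lemma quotient_D_A: "x \<in> qf n \<Longrightarrow> x \<in> quotient_field A"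
  using quotient_field_mono[of "D n" A] D_A by blast

lemma quotient_D_mono: "n \<le> m \<Longrightarrow> x \<in> qf n \<Longrightarrow> x \<in> qf m"
  using quotient_field_mono[OF D_mono] by blast

lemma quotient_AE:
  assumes "x \<in> quotient_field A" obtains n where "N \<le> n" "x \<in> qf n"
proof -
  obtain a b where ab: "x = a / b" "a \<in> A" "b \<in> A" "b \<noteq> 0" using assms by (rule A.quotient_fieldE)
  obtain n where n: "N \<le> n" "a \<in> D n" "b \<in> D n" using ab(2,3) by (rule A_E2)
  interpret n: dedekind_like "D n" by (rule dedekind_like)
  show ?thesis by (rule that[OF n(1)]) (use ab n in \<open>auto intro: n.quotient_fieldI\<close>)
qed

lemma A_quotient_D: "x \<in> A \<Longrightarrow> x \<in> qf n \<Longrightarrow> x \<in> D n"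
proof -
  assume x: "x \<in> A" "x \<in> qf n"
  obtain m where m: "n \<le> m" "x \<in> D m" using x(1) by (rule A_E1)
  thus "x \<in> D n" using extends_domainD(4)[OF ext_le[OF m(1)] m(2) x(2)] by blast
qed

text \<open>Each condition on a maximal ideal involves finitely many elements, so it can be checked
  inside one late \<open>D n\<close>.\<close>

lemma max_specI:
  assumes "M \<subseteq> A" "\<And>n. N \<le> n \<Longrightarrow> M \<inter> D n \<in> max_spec (D n)"
  shows "M \<in> max_spec A"
  unfolding A.max_spec_iff is_ideal_def
proof (intro conjI ballI impI)
  have id: "is_ideal (D n) (M \<inter> D n)" if "N \<le> n" for n
  proof -
    interpret dedekind_like "D n" by (rule dedekind_like)
    show ?thesis by (rule max_spec_ideal[OF assms(2)[OF that]])
  qed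
  show "0 \<in> M" using id[of N] by (auto simp: is_ideal_def)
  show "1 \<notin> M"
  proof -
    interpret dedekind_like "D N" by (rule dedekind_like)
    have "1 \<notin> M \<inter> D N" using assms(2)[of N] by (simp add: max_spec_iff)
    thus ?thesis by simp
  qed
  fix x
  { fix y assume xy: "x \<in> M" "y \<in> M"
    hence "x \<in> A" "y \<in> A" using assms(1) by auto
    then obtain n where "N \<le> n" "x \<in> D n" "y \<in> D n" by (rule A_E2)
    hence "x + y \<in> M \<inter> D n" using xy id[of n] unfolding is_ideal_def by blast
    thus "x + y \<in> M" by blast }
  { fix y assume xy: "x \<in> A" "y \<in> M"
    hence "x \<in> A" "y \<in> A" using assms(1) by auto
    then obtain n where "N \<le> n" "x \<in> D n" "y \<in> D n" by (rule A_E2)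
    hence "x * y \<in> M \<inter> D n" using xy id[of n] unfolding is_ideal_def by blast
    thus "x * y \<in> M" by blast }
  assume x: "x \<in> A" "x \<notin> M"
  obtain n where n: "N \<le> n" "x \<in> D n" using x(1) by (rule A_E1)
  interpret n: dedekind_like "D n" by (rule dedekind_like)
  have "x \<notin> M \<inter> D n" using x by blast
  then obtain y where "y \<in> D n" "1 - x * y \<in> M \<inter> D n" using assms(2)[OF n(1)] n(2) unfolding n.max_spec_iff by blast
  thus "\<exists>y\<in>A. 1 - x * y \<in> M" using D_A by blast
qed (rule assms(1))

text \<open>A nonzero element of \<open>P\<close> lives at some stage \<open>m\<close> beyond
  \<open>n\<close>, where the trace is therefore a nonzero prime and thus maximal; maximality then
  restricts to stage \<open>n\<close>.\<close>

lemma prime_trace: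
  assumes P: "is_prime A P" "P \<noteq> {0}"
  shows "P \<inter> D n \<in> max_spec (D n)"
proof -
  note DP = A.idealD[OF conjunct1[OF P(1)[unfolded is_prime_def]]]
  obtain x where x: "x \<in> P" "x \<noteq> 0" using P(2) DP(2) by blast
  obtain m where m: "n \<le> m" "x \<in> D m" using DP(1)[OF x(1)] by (rule A_E1)
  interpret m: dedekind_like "D m" by (rule dedekind_like)
  have "is_prime (D m) (P \<inter> D m)" unfolding is_prime_def is_ideal_def
  proof (intro conjI ballI impI)
    show "1 \<notin> P \<inter> D m" using P(1) by (simp add: is_prime_def)
    show "x \<in> P \<inter> D m \<or> y \<in> P \<inter> D m" if "x \<in> D m" "y \<in> D m" "x * y \<in> P \<inter> D m" for x y
      using P(1) that D_A unfolding is_prime_def by blast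
  qed (use DP D_A in auto)
  hence "P \<inter> D m \<in> max_spec (D m)" using m.prime_is_max[of _ x] x m by blast
  thus "P \<inter> D n \<in> max_spec (D n)" using extends_domainD(5)[OF ext_le[OF m(1)]] int_D[OF m(1), of P] by metis
qed

lemma nonzero_prime_max: "is_prime A P \<Longrightarrow> P \<noteq> {0} \<Longrightarrow> P \<in> max_spec A"
  by (rule max_specI[of _ 0]) (auto simp: prime_trace is_prime_def is_ideal_def)

text \<open>Otherwise \<open>A\<close> would contain the inverse of a uniformizer of
  \<open>D 0\<close>, and that inverse would already lie in \<open>D 0\<close>.\<close>

lemma max_spec_nonzero: assumes "M \<in> max_spec A" shows "M \<noteq> {0}"
proof
  assume M: "M = {0}"
  interpret dedekind_like "D 0" by (rule dedekind_like)
  have "is_ideal (D 0) {0}" by (auto simp: is_ideal_def)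
  then obtain Q where Q: "Q \<in> max_spec (D 0)" using ex_max_spec[of "{0}"] by auto
  interpret v: valued_ring "D 0" Q "val (D 0) Q" by (rule dval_val[OF Q])
  obtain q where q: "q \<in> Q" "q \<in> D 0" "q \<noteq> 0" by (rule v.uniformizer)
  then obtain y where y: "y \<in> A" "1 - q * y = 0" using assms M D_A[of q 0] by (auto simp: A.max_spec_iff)
  hence "y = 1 / q" using q by (simp add: field_simps)
  hence "y \<in> quotient_field (D 0)" using quotient_fieldI[of 1 q] q by simp
  hence "y \<in> D 0" using A_quotient_D y by blast
  hence "q * y \<in> Q" using idealD(5)[OF v.M_ideal _ q(1)] by blast
  thus False using y(2) v.M_1 by simp
qed

lemma max_trace: "M \<in> max_spec A \<Longrightarrow> M \<inter> D n \<in> max_spec (D n)"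
  using prime_trace[OF A.max_spec_prime max_spec_nonzero] by blast

lemma lab_antimono_step:
  assumes M: "M \<in> max_spec (D (Suc n))"
  shows "lab (Suc n) M \<le> lab n (M \<inter> D n)"
proof (cases "idx (M \<inter> D 0) \<le> n \<and> \<not> unramified (D n) (D (Suc n)) M")
  case True
  hence "\<not> zero_ordinal (lab n (M \<inter> D n))" using zero_unram[OF M] by blast
  thus ?thesis using lab_Suc[OF M] True g_less by (simp add: less_imp_le)
qed (use lab_Suc[OF M] in auto)

lemma lab_eq_unram:
  assumes M: "M \<in> max_spec (D (Suc n))" and "idx (M \<inter> D 0) \<le> n" "lab (Suc n) M = lab n (M \<inter> D n)"
  shows "unramified (D n) (D (Suc n)) M"
proof (rule ccontr)
  assume r: "\<not> unramified (D n) (D (Suc n)) M"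
  hence "\<not> zero_ordinal (lab n (M \<inter> D n))" using zero_unram[OF M] assms by blast
  from g_less[OF this, of n] show False using lab_Suc[OF M] assms r by simp
qed

lemma lab_antimono: assumes M: "M \<in> max_spec A" shows "n \<le> m \<Longrightarrow> lab m (M \<inter> D m) \<le> lab n (M \<inter> D n)"
proof (induction rule: dec_induct)
  case (step m)
  have "lab (Suc m) (M \<inter> D (Suc m)) \<le> lab m (M \<inter> D (Suc m) \<inter> D m)" by (rule lab_antimono_step[OF max_trace[OF M]])
  thus ?case using step.IH int_D[of m "Suc m" M] by simp
qed simp

text \<open>Labels never increase along the traces of a maximal ideal of \<open>A\<close>, so their
  least value is the eventual one.\<close>

definition "rnk M = (LEAST \<gamma>. \<exists>n. lab n (M \<inter> D n) = \<gamma>)"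

lemma rnk_le: "rnk M \<le> lab n (M \<inter> D n)"
  unfolding rnk_def by (rule Least_le) blast

lemma rnk_stable:
  assumes M: "M \<in> max_spec A"
  obtains N where "K \<le> N" "idx (M \<inter> D 0) \<le> N" "\<And>n. N \<le> n \<Longrightarrow> lab n (M \<inter> D n) = rnk M"
proof -
  have "\<exists>n. lab n (M \<inter> D n) = rnk M" unfolding rnk_def by (rule LeastI_ex) blast
  then obtain n where n: "lab n (M \<inter> D n) = rnk M" by blast
  show ?thesis
    by (rule that[of "max K (max n (idx (M \<inter> D 0)))"]) (use n rnk_le[of M] lab_antimono[OF M, of n] in \<open>auto intro: antisym\<close>)
qed

lemma rnk_less: assumes "M \<in> max_spec A" shows "rnk M < \<alpha>"
  using rnk_le[of M 0] lab_less[OF max_trace[OF assms]] by (rule le_less_trans)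

lemma val_stable_D:
  assumes M: "M \<in> max_spec A" and idx: "idx (M \<inter> D 0) \<le> n" and st: "\<And>m. n \<le> m \<Longrightarrow> lab m (M \<inter> D m) = lab n (M \<inter> D n)"
    and nm: "n \<le> m" and x: "x \<in> qf n" "x \<noteq> 0"
  shows "vD m M x = vD n M x"
  using nm
proof (induction rule: dec_induct)
  case (step m)
  have i: "M \<inter> D (Suc m) \<inter> D m = M \<inter> D m" "M \<inter> D (Suc m) \<inter> D 0 = M \<inter> D 0" by (rule int_D, simp)+
  have "unramified (D m) (D (Suc m)) (M \<inter> D (Suc m))"
    by (rule lab_eq_unram[OF max_trace[OF M]]) (use idx st[of m] st[of "Suc m"] step i in auto)
  hence "vD (Suc m) M x = vD m M x"
    using quotient_D_mono[OF step(1) x(1)] x(2) by (simp add: unramified_def i)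
  thus ?case using step.IH by simp
qed simp

text \<open>Once the label is stable and the ideal is under control, no further ramification occurs,
  so the valuations of the later \<open>D n\<close> extend one another and glue to a discrete
  valuation of \<open>A\<close>.\<close>

lemma ex_discrete_val_A:
  assumes M: "M \<in> max_spec A"
  shows "\<exists>v. discrete_val A M v"
proof -
  obtain N where N: "idx (M \<inter> D 0) \<le> N" "\<And>n. N \<le> n \<Longrightarrow> lab n (M \<inter> D n) = rnk M" using rnk_stable[OF M, of 0] by metis
  \<comment> \<open>Evaluated at the first stage from \<open>N\<close> on whose quotient field
    contains \<open>x\<close>; every later stage gives the same value.\<close>
  define v where "v x = (let n = (LEAST n. N \<le> n \<and> x \<in> qf n) in vD n M x)" for x
  have v: "v x = vD n M x" if x: "N \<le> n" "x \<in> qf n" "x \<noteq> 0" for x n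
  proof -
    define k where "k = (LEAST n. N \<le> n \<and> x \<in> qf n)"
    have k: "N \<le> k \<and> x \<in> qf k" unfolding k_def by (rule LeastI[of _ n]) (use x in simp)
    have kn: "k \<le> n" unfolding k_def by (rule Least_le) (use x in simp)
    have "vD n M x = vD k M x"
      by (rule val_stable_D[OF M _ _ kn]) (use N k x in auto)
    thus ?thesis by (simp add: v_def k_def Let_def)
  qed
  have "discrete_val A M v" unfolding discrete_val_def
  proof (intro conjI ballI impI)
    fix x y assume xy: "x \<in> quotient_field A" "y \<in> quotient_field A" "x \<noteq> 0" "y \<noteq> 0"
    obtain k where k: "N \<le> k" "x \<in> qf k" using xy(1) by (rule quotient_AE)
    obtain n where n: "k \<le> n" "y \<in> qf n" using xy(2) by (rule quotient_AE)
    have x: "x \<in> qf n" using quotient_D_mono[OF n(1) k(2)] .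
    have Nn: "N \<le> n" using k n by simp
    interpret dedekind_like "D n" by (rule dedekind_like)
    interpret w: valued_ring "D n" "M \<inter> D n" "vD n M" by (rule dval_val[OF max_trace[OF M]])
    show "v (x * y) = v x + v y" using v[OF Nn x xy(3)] v[OF Nn n(2) xy(4)] v[OF Nn, of "x * y"] x n xy by simp
  next
    interpret dedekind_like "D N" by (rule dedekind_like)
    interpret w: valued_ring "D N" "M \<inter> D N" "vD N M" by (rule dval_val[OF max_trace[OF M]])
    obtain t where "t \<in> D N" "t \<noteq> 0" "vD N M t = 1" by (rule w.uniformizer)
    thus "\<exists>t\<in>quotient_field A. t \<noteq> 0 \<and> v t = 1" using v[of N t] quotient_D_A[of t N]
      by (intro bexI[of _ t]) auto
  next
    fix x assume x: "x \<in> quotient_field A" "x \<noteq> 0"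
    obtain k where k: "N \<le> k" "x \<in> qf k" using x(1) by (rule quotient_AE)
    show "0 \<le> v x \<longleftrightarrow> x \<in> localization A M"
    proof
      assume nn: "0 \<le> v x"
      interpret dedekind_like "D k" by (rule dedekind_like)
      interpret w: valued_ring "D k" "M \<inter> D k" "vD k M" by (rule dval_val[OF max_trace[OF M]])
      have "x \<in> localization (D k) (M \<inter> D k)" using w.v_ge_0[OF k(2) x(2)] v[OF k x(2)] nn by simp
      thus "x \<in> localization A M" using D_A by (auto simp: localization_def)
    next
      assume "x \<in> localization A M"
      then obtain a s where as: "x = a / s" "a \<in> A" "s \<in> A" "s \<notin> M" by (auto simp: localization_def)
      obtain n where n: "N \<le> n" "a \<in> D n" "s \<in> D n" using as(2,3) by (rule A_E2)
      interpret dedekind_like "D n" by (rule dedekind_like)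
      interpret w: valued_ring "D n" "M \<inter> D n" "vD n M" by (rule dval_val[OF max_trace[OF M]])
      have xl: "x \<in> localization (D n) (M \<inter> D n)" by (rule localizationI[OF n(2,3) _ as(1)]) (use as in simp)
      have "x \<in> qf n" by (rule localization_subset[OF w.M_0 xl])
      thus "0 \<le> v x" using w.v_ge_0[of x] v[OF n(1), of x] xl x by simp
    qed
  qed
  thus ?thesis by blast
qed

sublocale A: locally_discrete_ring A
  by unfold_locales (use A.integral_domain ex_discrete_val_A in \<open>simp add: locally_discrete_def\<close>)

lemma val_A:
  assumes M: "M \<in> max_spec A"
  obtains e where "1 \<le> e" "\<And>x. x \<in> qf n \<Longrightarrow> x \<noteq> 0 \<Longrightarrow> val A M x = e * vD n M x"
proof -
  interpret dedekind_like "D n" by (rule dedekind_like)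
  interpret w: valued_ring "D n" "M \<inter> D n" "vD n M" by (rule dval_val[OF max_trace[OF M]])
  show ?thesis using w.val_restrict[OF A.dval_val[OF M]] D_A that by blast
qed

text \<open>A uniformizer of \<open>A\<close> at \<open>M\<close> already lies in some
  \<open>D m\<close>, which forces the index between \<open>D m\<close> and \<open>A\<close> to be
  1; between \<open>n\<close> and \<open>m\<close> the stable label excludes ramification.\<close>

lemma val_A_stable:
  assumes M: "M \<in> max_spec A" and idx: "idx (M \<inter> D 0) \<le> n" and st: "\<And>m. n \<le> m \<Longrightarrow> lab m (M \<inter> D m) = lab n (M \<inter> D n)"
    and x: "x \<in> qf n" "x \<noteq> 0"
  shows "val A M x = vD n M x"
proof -
  interpret w: valued_ring A M "val A M" by (rule A.dval_val[OF M])
  obtain t where t: "t \<in> A" "t \<noteq> 0" "val A M t = 1" by (rule w.uniformizer)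
  obtain m where m: "n \<le> m" "t \<in> D m" using t(1) by (rule A_E1)
  interpret m: dedekind_like "D m" by (rule dedekind_like)
  interpret wm: valued_ring "D m" "M \<inter> D m" "vD m M" by (rule m.dval_val[OF max_trace[OF M]])
  obtain e where e: "1 \<le> e" "\<And>x. x \<in> qf m \<Longrightarrow> x \<noteq> 0 \<Longrightarrow> val A M x = e * vD m M x"
    using val_A[OF M] by blast
  have "e * vD m M t = 1" using e(2)[of t] t m by simp
  hence "e = 1" using e(1) unfolding zmult_eq_1_iff by auto
  hence "val A M x = vD m M x" using e(2)[OF quotient_D_mono[OF m(1) x(1)] x(2)] by simp
  also have "\<dots> = vD n M x" by (rule val_stable_D[OF M idx st m(1) x])
  finally show ?thesis .
qed

lemma val_A_ramified:
  assumes M: "M \<in> max_spec A" and nm: "n \<le> m" and r: "\<not> unramified (D m) (D (Suc m)) (M \<inter> D (Suc m))"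
  obtains e where "2 \<le> e" "\<And>x. x \<in> qf n \<Longrightarrow> x \<noteq> 0 \<Longrightarrow> val A M x = e * vD n M x"
proof -
  obtain e1 where e1: "1 \<le> e1" "\<And>x. x \<in> quotient_field (D (Suc m)) \<Longrightarrow> x \<noteq> 0 \<Longrightarrow> val A M x = e1 * vD (Suc m) M x"
    using val_A[OF M] by blast
  obtain e2 where e2: "2 \<le> e2" "\<And>x. x \<in> qf m \<Longrightarrow> x \<noteq> 0 \<Longrightarrow> vD (Suc m) M x = e2 * vD m M x"
    using ramified_val[OF ext max_trace[OF M] r] int_D[of m "Suc m" M] by auto
  obtain e3 where e3: "1 \<le> e3" "\<And>x. x \<in> qf n \<Longrightarrow> x \<noteq> 0 \<Longrightarrow> vD m M x = e3 * vD n M x"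
    using extends_domain_val[OF ext_le[OF nm] max_trace[OF M]] int_D[OF nm, of M] by auto
  have "1 * 2 \<le> e1 * e2" using e1(1) e2(1) by (intro mult_mono) auto
  hence "2 * 1 \<le> (e1 * e2) * e3" using e3(1) by (intro mult_mono) auto
  thus ?thesis using that[of "e1 * e2 * e3"] e1(2) e2(2) e3(2) quotient_D_mono[OF nm] quotient_D_mono[of m "Suc m"] by simp
qed

text \<open>Continue \<open>Q\<close> forever by ideals of the same label: by unramified ones when
  it is under control, and by arbitrary ones before that, when labels are merely copied.\<close>

lemma ex_branch:
  assumes Q: "Q \<in> max_spec (D n)"
  obtains M where "M \<in> max_spec A" "M \<inter> D n = Q" "rnk M = lab n Q"
proof -
  have "\<exists>f. f 0 = Q \<and> (\<forall>k. f k \<in> max_spec (D (n + k)) \<and> f (Suc k) \<inter> D (n + k) = f k \<and> lab (Suc (n + k)) (f (Suc k)) = lab (n + k) (f k))"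
  proof -
    have step: "\<exists>M\<in>max_spec (D (Suc m)). M \<inter> D m = R \<and> lab (Suc m) M = lab m R" if R: "R \<in> max_spec (D m)" for m R
    proof (cases "idx (R \<inter> D 0) \<le> m")
      case True
      then obtain M where M: "M \<in> max_spec (D (Suc m))" "M \<inter> D m = R" "unramified (D m) (D (Suc m)) M" using ex_unram[OF R] by blast
      thus ?thesis using lab_Suc[OF M(1)] by auto
    next
      case False
      obtain M where M: "M \<in> max_spec (D (Suc m))" "M \<inter> D m = R" using extends_domainD(6)[OF ext R] by blast
      have "M \<inter> D 0 = R \<inter> D 0" using M(2) D_mono[of 0 m] by auto
      thus ?thesis using lab_Suc[OF M(1)] False M by auto
    qed
    \<comment> \<open>Dependent choice leaves the starting point open, so the condition at
      \<open>k = 0\<close> pins it to \<open>Q\<close>.\<close>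
    have "\<exists>f. \<forall>k. (f k \<in> max_spec (D (n + k)) \<and> (k = 0 \<longrightarrow> f k = Q)) \<and> f (Suc k) \<inter> D (n + k) = f k \<and> lab (Suc (n + k)) (f (Suc k)) = lab (n + k) (f k)"
      by (rule dependent_nat_choice) (use step Q in auto)
    thus ?thesis by blast
  qed
  then obtain f where f: "f 0 = Q" "\<And>k. f k \<in> max_spec (D (n + k))" "\<And>k. f (Suc k) \<inter> D (n + k) = f k" "\<And>k. lab (Suc (n + k)) (f (Suc k)) = lab (n + k) (f k)" by blast
  have labf: "lab (n + k) (f k) = lab n Q" for k by (induction k) (use f in auto)
  have fD: "f k \<subseteq> D (n + k)" for k
  proof -
    interpret dedekind_like "D (n + k)" by (rule dedekind_like)
    show ?thesis using idealD(1)[OF max_spec_ideal[OF f(2)]] by blast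
  qed
  have tr: "f l \<inter> D (n + k) = f k" if "k \<le> l" for k l
    using that
  proof (induction rule: dec_induct)
    case base show ?case using fD by blast
  next
    case (step l)
    have "D (n + k) \<subseteq> D (n + l)" using step by (intro D_mono) simp
    thus ?case using f(3)[of l] step.IH by blast
  qed
  define M where "M = (\<Union>k. f k)"
  have Mk: "M \<inter> D (n + k) = f k" for k
  proof
    show "f k \<subseteq> M \<inter> D (n + k)" using fD by (auto simp: M_def)
    show "M \<inter> D (n + k) \<subseteq> f k"
    proof
      fix x assume "x \<in> M \<inter> D (n + k)"
      then obtain l where l: "x \<in> f l" "x \<in> D (n + k)" by (auto simp: M_def)
      show "x \<in> f k"
      proof (cases "k \<le> l")
        case True thus ?thesis using tr[OF True] l by blast
      next
        case False
        hence "f k \<inter> D (n + l) = f l" by (intro tr) simp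
        thus ?thesis using l by blast
      qed
    qed
  qed
  have "M \<in> max_spec A"
  proof (rule max_specI[of _ n])
    show "M \<subseteq> A" using fD D_A by (auto simp: M_def)
    fix m assume "n \<le> m"
    then obtain k where "m = n + k" using le_Suc_ex by blast
    thus "M \<inter> D m \<in> max_spec (D m)" using Mk f(2) by simp
  qed
  moreover have "rnk M = lab n Q"
  proof -
    obtain N where N: "n \<le> N" "lab N (M \<inter> D N) = rnk M" using rnk_stable[OF calculation, of n] by blast
    then obtain k where "N = n + k" using le_Suc_ex by blast
    thus ?thesis using N(2) Mk labf by simp
  qed
  ultimately show ?thesis using that Mk[of 0] f(1) by simp
qed

lemma almost_dedekind: "almost_dedekind_domain A"
  unfolding almost_dedekind_domain_def
  using A.integral_domain valued_ring.discrete_valuation_ring_localization[OF A.dval_val] by blast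

lemma integral: "integral_extension (D 0) A"
  unfolding integral_extension_def
proof (intro conjI ballI)
  show "D 0 \<subseteq> A" using D_A by blast
  fix x assume "x \<in> A"
  then obtain n where n: "x \<in> D n" by (auto simp: A_def)
  interpret dedekind_like "D n" by (rule dedekind_like)
  have "integral_over (D n) x" unfolding integral_over_def
    by (rule exI[of _ "[:- x, 1:]"]) (use n in \<open>auto simp: coeff_pCons split: nat.split\<close>)
  thus "integral_over (D 0) x" using extends_domainD(7)[OF ext_le[of 0 n]] by simp
qed

end

section \<open>Critical ideals of the limit\<close>

text \<open>
  The sets \<open>Y\<close> are the iterated sets of critical ideals. The last assumption says that \<open>Y\<close> is closed in
  the inverse limit of the maximal spectra of the \<open>D n\<close>.
\<close>

locale tower_closed = tower +
  fixes Y
  assumes Y_max: "Y \<subseteq> max_spec A" and Y_nonempty: "Y \<noteq> {}"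
    and Y_closed: "M \<in> max_spec A \<Longrightarrow> (\<And>n. \<exists>M'\<in>Y. M' \<inter> D n = M \<inter> D n) \<Longrightarrow> M \<in> Y"
begin

definition "T = (\<Inter>M\<in>Y. localization A M)"

lemma dv: "M \<in> Y \<Longrightarrow> valued_ring A M (val A M)" using A.dval_val Y_max by blast

lemma T_F: "x \<in> T \<Longrightarrow> x \<in> quotient_field A"
proof -
  assume x: "x \<in> T"
  obtain M where M: "M \<in> Y" using Y_nonempty by blast
  interpret v: valued_ring A M "val A M" by (rule dv[OF M])
  show ?thesis using A.localization_subset[OF v.M_0] x M by (auto simp: T_def)
qed

lemma A_T: "x \<in> A \<Longrightarrow> x \<in> T"
  unfolding T_def using A.subset_localization valued_ring.M_1[OF dv] by blast

lemma T_iff: "x \<in> quotient_field A \<Longrightarrow> x \<noteq> 0 \<Longrightarrow> x \<in> T \<longleftrightarrow> (\<forall>M\<in>Y. 0 \<le> val A M x)"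
  using valued_ring.v_ge_0[OF dv] by (auto simp: T_def)

lemma T_nonneg: "x \<in> T \<Longrightarrow> x \<noteq> 0 \<Longrightarrow> M \<in> Y \<Longrightarrow> 0 \<le> val A M x"
  using T_iff[of x] T_F by blast

sublocale T: field_subring T
proof (unfold_locales, unfold integral_domain_iff, intro conjI ballI)
  show "1 \<in> T" by (rule A_T) simp
  fix x y assume xy: "x \<in> T" "y \<in> T"
  have "x - y \<in> localization A M \<and> x * y \<in> localization A M" if M: "M \<in> Y" for M
  proof -
    interpret L: field_subring "localization A M"
      by unfold_locales (rule A.integral_domain_localization[OF valued_ring.M_prime[OF dv[OF M]]])
    show ?thesis using xy M by (auto simp: T_def)
  qed
  thus "x - y \<in> T" "x * y \<in> T" by (auto simp: T_def)
qed

text \<open>Used in three ways: \<open>C = {M}\<close> with \<open>k = 1\<close> is the extension of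
  \<open>M\<close>; a neighbourhood \<open>C\<close> of \<open>M\<close> in \<open>Y\<close> with
  \<open>k = 1\<close> is the radical ideal that refutes criticality; \<open>C = {M'}\<close> with
  \<open>k = 2\<close> records the effect of ramification.\<close>

definition "val_ge C k = {x \<in> T. x = 0 \<or> (\<forall>M\<in>C. k \<le> val A M x)}"

lemma val_ge_ideal: assumes "C \<subseteq> Y" shows "is_ideal T (val_ge C k)"
  unfolding is_ideal_def
proof (intro conjI ballI)
  show "val_ge C k \<subseteq> T" "0 \<in> val_ge C k" by (auto simp: val_ge_def)
  fix x y assume xy: "x \<in> val_ge C k" "y \<in> val_ge C k"
  have "k \<le> val A M (x + y)" if M: "M \<in> C" "x + y \<noteq> 0" for M
  proof -
    interpret v: valued_ring A M "val A M" using dv M assms by blast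
    show ?thesis by (rule v.v_min) (use xy M T_F in \<open>auto simp: val_ge_def\<close>)
  qed
  moreover have "x + y \<in> T" using xy by (auto simp: val_ge_def)
  ultimately show "x + y \<in> val_ge C k" by (auto simp: val_ge_def)
next
  fix a x assume ax: "a \<in> T" "x \<in> val_ge C k"
  have "k \<le> val A M (a * x)" if M: "M \<in> C" "a \<noteq> 0" "x \<noteq> 0" for M
  proof -
    interpret v: valued_ring A M "val A M" using dv M assms by blast
    have "0 \<le> val A M a" "k \<le> val A M x" using T_nonneg[OF ax(1) M(2)] M ax assms by (auto simp: val_ge_def)
    thus ?thesis using v.v_mult[of a x] ax M T_F by (auto simp: val_ge_def)
  qed
  moreover have "a * x \<in> T" using ax by (auto simp: val_ge_def)
  ultimately show "a * x \<in> val_ge C k" by (auto simp: val_ge_def)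
qed

abbreviation "center M \<equiv> val_ge {M} 1"

lemma M_center: "M \<in> Y \<Longrightarrow> M \<subseteq> center M"
proof
  fix x assume M: "M \<in> Y" "x \<in> M"
  interpret v: valued_ring A M "val A M" by (rule dv[OF M(1)])
  have "x \<in> T" by (rule A_T[OF A.idealD(1)[OF v.M_ideal M(2)]])
  moreover have "x \<noteq> 0 \<Longrightarrow> 1 \<le> val A M x" using v.v_pos[OF M(2)] by simp
  ultimately show "x \<in> center M" by (auto simp: val_ge_def)
qed

lemma center_A: "M \<in> Y \<Longrightarrow> center M \<inter> A \<subseteq> M"
proof
  fix x assume M: "M \<in> Y" "x \<in> center M \<inter> A"
  interpret v: valued_ring A M "val A M" by (rule dv[OF M(1)])
  show "x \<in> M" using v.mem_M_iff[of x] v.M_0 M by (cases "x = 0") (auto simp: val_ge_def)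
qed

lemma center_max: assumes M: "M \<in> Y" shows "center M \<in> max_spec T"
  unfolding T.max_spec_iff
proof (intro conjI ballI impI)
  interpret v: valued_ring A M "val A M" by (rule dv[OF M])
  show "is_ideal T (center M)" by (rule val_ge_ideal) (use M in simp)
  show "1 \<notin> center M" by (simp add: val_ge_def)
  fix x assume x: "x \<in> T" "x \<notin> center M"
  hence "x \<in> localization A M" using M by (auto simp: T_def)
  then obtain a s where a: "x = a / s" "a \<in> A" "s \<in> A" "s \<notin> M" "s \<noteq> 0" using v.M_0 by (rule A.localizationE)
  have "a \<notin> M"
  proof
    assume "a \<in> M"
    hence am: "a \<in> center M" using M_center[OF M] by blast
    have "x \<noteq> 0" using x by (auto simp: val_ge_def)
    hence "a \<noteq> 0" using a by auto
    hence "val A M x = val A M a" using a v.v_eq_0[of s] by simp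
    thus False using x am \<open>a \<noteq> 0\<close> by (auto simp: val_ge_def)
  qed
  then obtain y where y: "y \<in> A" "1 - a * y \<in> M" using max_trace a(2) A.max_spec_iff[of M] Y_max M by blast
  have "1 - x * (s * y) = 1 - a * y" using a by simp
  thus "\<exists>y\<in>T. 1 - x * y \<in> center M" using y a M_center[OF M] A_T by (intro bexI[of _ "s * y"]) auto
qed

text \<open>Carries \<open>inverse_uniformizer\<close> from \<open>D n\<close> to \<open>A\<close>:
  passing to \<open>A\<close> multiplies values by a positive index and so preserves their
  sign.\<close>

lemma inverse_element:
  assumes M: "M \<in> max_spec A"
  obtains z q q' where "z \<in> qf n" "z \<noteq> 0" "vD n M z = - 1"
    "\<And>M'. M' \<in> Y \<Longrightarrow> M' \<inter> D n \<noteq> M \<inter> D n \<Longrightarrow> 0 \<le> val A M' z"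
    "q \<in> M \<inter> D n" "q' \<in> M \<inter> D n" "1 = q + z * q'"
proof -
  interpret dedekind_like "D n" by (rule dedekind_like)
  obtain z q q' where z: "z \<in> qf n" "z \<noteq> 0" "vD n M z = - 1"
    "\<And>P. P \<in> max_spec (D n) \<Longrightarrow> P \<noteq> M \<inter> D n \<Longrightarrow> 0 \<le> val (D n) P z" "q \<in> M \<inter> D n" "q' \<in> M \<inter> D n" "1 = q + z * q'"
    using inverse_uniformizer[OF max_trace[OF M]] by metis
  have "0 \<le> val A M' z" if M': "M' \<in> Y" "M' \<inter> D n \<noteq> M \<inter> D n" for M'
  proof -
    have m: "M' \<in> max_spec A" using M' Y_max by blast
    obtain e where "1 \<le> e" "val A M' z = e * vD n M' z" using val_A[OF m, of n] z(1,2) by metis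
    thus ?thesis using z(4)[OF max_trace[OF m] M'(2)] by simp
  qed
  thus ?thesis using that z by blast
qed

lemma mult_mem_T:
  assumes x: "x \<in> T" "x \<noteq> 0" and z: "z \<in> qf n" "z \<noteq> 0"
    and away: "\<And>M'. M' \<in> Y \<Longrightarrow> M' \<inter> D n \<noteq> Q \<Longrightarrow> 0 \<le> val A M' z"
    and over: "\<And>M'. M' \<in> Y \<Longrightarrow> M' \<inter> D n = Q \<Longrightarrow> 0 \<le> val A M' x + val A M' z"
  shows "x * z \<in> T"
proof -
  have F: "x \<in> quotient_field A" "z \<in> quotient_field A" using T_F[OF x(1)] quotient_D_A[OF z(1)] .
  have "0 \<le> val A M' (x * z)" if M': "M' \<in> Y" for M'
  proof -
    interpret w: valued_ring A M' "val A M'" by (rule dv[OF M'])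
    show ?thesis using w.v_mult[OF F x(2) z(2)] T_nonneg[OF x M'] away[OF M'] over[OF M']
      by (cases "M' \<inter> D n = Q") auto
  qed
  thus ?thesis using T_iff[OF A.quotient_field_closed(3)[OF F]] x(2) z(2) by simp
qed

text \<open>Multiply the relation for 1 by \<open>x\<close>. The element \<open>z\<close> is a pole
  that \<open>x\<close> has to absorb.\<close>

lemma decompose:
  assumes q: "q \<in> I" "q' \<in> I" "1 = q + z * q'" and I: "is_ideal T I" and x: "x \<in> T" "x * z \<in> T"
  shows "x \<in> I"
proof -
  have "x = x * q + (x * z) * q'" using q(3) by (metis distrib_left mult.assoc mult.right_neutral)
  moreover have "x * q + (x * z) * q' \<in> I" by (rule T.idealD(3)[OF I T.idealD(4)[OF I x(1) q(1)] T.idealD(4)[OF I x(2) q(2)]])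
  ultimately show ?thesis by simp
qed

text \<open>An element \<open>x\<close> of positive value at \<open>M\<close> has positive value at
  the trace of \<open>M\<close> in a suitable \<open>D n\<close>, hence at every \<open>M'\<close>
  with the same trace. So \<open>x\<close> absorbs the simple pole of \<open>z\<close> there, and
  \<open>decompose\<close> writes it through elements of \<open>M\<close>.\<close>

lemma generated_center: assumes M: "M \<in> Y" shows "generated_ideal T M = center M"
proof
  interpret v: valued_ring A M "val A M" by (rule dv[OF M])
  have MT: "M \<subseteq> T" using A.idealD(1)[OF v.M_ideal] A_T by blast
  show "generated_ideal T M \<subseteq> center M"
    by (rule T.generated_ideal(3)[OF MT val_ge_ideal M_center[OF M]]) (use M in simp)
  have Mm: "M \<in> max_spec A" using M Y_max by blast
  note gi = T.generated_ideal(1,2)[OF MT]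
  show "center M \<subseteq> generated_ideal T M"
  proof
    fix x assume x: "x \<in> center M"
    show "x \<in> generated_ideal T M"
    proof (cases "x = 0")
      case True thus ?thesis using T.idealD(2)[OF gi(1)] by simp
    next
      case False
      have xT: "x \<in> T" "1 \<le> val A M x" using x False by (auto simp: val_ge_def)
      obtain n where n: "x \<in> qf n" using T_F[OF xT(1)] by (rule quotient_AE)
      obtain z q q' where z: "z \<in> qf n" "z \<noteq> 0" "vD n M z = - 1"
        "\<And>M'. M' \<in> Y \<Longrightarrow> M' \<inter> D n \<noteq> M \<inter> D n \<Longrightarrow> 0 \<le> val A M' z"
        "q \<in> M \<inter> D n" "q' \<in> M \<inter> D n" "1 = q + z * q'" by (rule inverse_element[where n = n, OF Mm], rule that; assumption)
      have vx: "1 \<le> vD n M x"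
      proof -
        obtain e where e: "1 \<le> e" "val A M x = e * vD n M x" using val_A[OF Mm, of n] n False by metis
        hence "0 < e * vD n M x" using xT by simp
        thus ?thesis using e(1) by (simp add: zero_less_mult_iff)
      qed
      have "x * z \<in> T"
      proof (rule mult_mem_T[OF xT(1) False z(1,2,4)])
        fix M' assume M': "M' \<in> Y" "M' \<inter> D n = M \<inter> D n"
        have M'm: "M' \<in> max_spec A" using M' Y_max by blast
        obtain e' where e': "1 \<le> e'" "\<And>x. x \<in> qf n \<Longrightarrow> x \<noteq> 0 \<Longrightarrow> val A M' x = e' * vD n M' x"
          using val_A[OF M'm] by blast
        have "val A M' x + val A M' z = e' * (vD n M x - 1)"
          using e'(2)[OF n False] e'(2)[OF z(1,2)] z(3) M'(2) by (simp add: algebra_simps)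
        thus "0 \<le> val A M' x + val A M' z" using e'(1) vx by simp
      qed
      thus ?thesis using decompose[OF _ _ z(7) gi(1) xT(1)] z(5,6) gi(2) by blast
    qed
  qed
qed

text \<open>The trace \<open>P\<close> of \<open>N\<close> in \<open>A\<close> is maximal. If it
  were outside \<open>Y\<close>, closedness would give a stage \<open>n\<close> at which no member
  of \<open>Y\<close> has the trace of \<open>P\<close>; then \<open>z\<close> from
  \<open>inverse_element\<close> has no poles on \<open>Y\<close>, lies in \<open>T\<close>, and
  puts 1 into \<open>N\<close>.\<close>

lemma max_spec_T: assumes N: "N \<in> max_spec T" shows "\<exists>M\<in>Y. N = center M"
proof -
  note DN = T.idealD[OF T.max_spec_ideal[OF N]]
  define P where "P = N \<inter> A"
  have "is_prime A P" unfolding is_prime_def is_ideal_def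
  proof (intro conjI ballI impI)
    show "1 \<notin> P" using N by (simp add: P_def T.max_spec_iff)
    show "x \<in> P \<or> y \<in> P" if "x \<in> A" "y \<in> A" "x * y \<in> P" for x y
      using T.max_spec_primeD[OF N A_T A_T] that by (auto simp: P_def)
  qed (use DN A_T in \<open>auto simp: P_def\<close>)
  moreover have "P \<noteq> {0}"
  proof
    assume P0: "P = {0}"
    have "N = {0}"
    proof -
      have "x = 0" if x: "x \<in> N" for x
      proof -
        obtain a b where ab: "x = a / b" "a \<in> A" "b \<in> A" "b \<noteq> 0" using T_F[OF DN(1)[OF x]] by (rule A.quotient_fieldE)
        have "b * x \<in> N" using DN(4)[OF A_T[OF ab(3)] x] .
        hence "a \<in> P" using ab by (simp add: P_def)
        thus "x = 0" using P0 ab by simp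
      qed
      thus ?thesis using DN(2) by blast
    qed
    obtain M where M: "M \<in> Y" using Y_nonempty by blast
    interpret v: valued_ring A M "val A M" by (rule dv[OF M])
    obtain t where t: "t \<in> A" "t \<noteq> 0" "val A M t = 1" by (rule v.uniformizer)
    then obtain y where y: "y \<in> T" "1 - t * y \<in> N" using N A_T[OF t(1)] \<open>N = {0}\<close> by (auto simp: T.max_spec_iff)
    hence "y = 1 / t" using \<open>N = {0}\<close> t by (simp add: field_simps)
    hence "val A M y = - 1" "y \<noteq> 0" using t by auto
    thus False using T_nonneg[OF y(1) _ M] by simp
  qed
  ultimately have Pm: "P \<in> max_spec A" using nonzero_prime_max by blast
  interpret p: valued_ring A P "val A P" by (rule A.dval_val[OF Pm])
  have inv: "False" if h: "x \<in> N" "x \<noteq> 0" "1 / x \<in> localization A P" for x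
  proof -
    obtain a s where a: "1 / x = a / s" "a \<in> A" "s \<in> A" "s \<notin> P" "s \<noteq> 0" using h(3) p.M_0 by (rule A.localizationE)
    have "s = a * x" using a(1,5) h(2) by (simp add: field_simps)
    thus False using DN(4)[OF A_T[OF a(2)] h(1)] a by (simp add: P_def)
  qed
  have PY: "P \<in> Y"
  proof (rule Y_closed[OF Pm], rule ccontr)
    fix n assume n: "\<not> (\<exists>M'\<in>Y. M' \<inter> D n = P \<inter> D n)"
    obtain z q q' where z: "z \<in> qf n" "z \<noteq> 0" "val (D n) (P \<inter> D n) z = - 1"
        "\<And>M'. M' \<in> Y \<Longrightarrow> M' \<inter> D n \<noteq> P \<inter> D n \<Longrightarrow> 0 \<le> val A M' z"
        "q \<in> P \<inter> D n" "q' \<in> P \<inter> D n" "1 = q + z * q'" by (rule inverse_element[where n = n, OF Pm], rule that; assumption)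
    have "z \<in> T" using T_iff[OF quotient_D_A[OF z(1)] z(2)] z(4) n by blast
    hence "q + z * q' \<in> N" using z(5,6) DN(3)[OF _ DN(4)] by (auto simp: P_def)
    thus False using z(7) N by (simp add: T.max_spec_iff)
  qed
  have "N \<subseteq> center P"
  proof
    fix x assume x: "x \<in> N"
    show "x \<in> center P"
    proof (cases "x = 0")
      case False
      have "x \<in> localization A P" using DN(1)[OF x] PY by (auto simp: T_def)
      hence "val A P x \<noteq> 0" using p.mem_M_iff'[OF T_F[OF DN(1)[OF x]] False] inv[OF x False] by blast
      thus ?thesis using T_nonneg[OF DN(1)[OF x] False PY] DN(1)[OF x] by (auto simp: val_ge_def)
    qed (simp add: val_ge_def)
  qed
  hence "N = center P" by (rule T.max_spec_eqI[OF N center_max[OF PY]])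
  thus ?thesis using PY by blast
qed

lemma generated_max_imp_Y:
  assumes "P \<in> max_spec A" "generated_ideal T P \<in> max_spec T"
  shows "P \<in> Y"
proof -
  obtain M where M: "M \<in> Y" "generated_ideal T P = center M" using max_spec_T[OF assms(2)] by blast
  have PA: "P \<subseteq> A" using A.idealD(1)[OF A.max_spec_ideal[OF assms(1)]] by blast
  hence "P \<subseteq> T" using A_T by blast
  hence "P \<subseteq> center M \<inter> A" using T.generated_ideal(2)[of P] M PA by blast
  hence "P \<subseteq> M" using center_A[OF M(1)] by blast
  hence "P = M" using A.max_spec_eqI[OF assms(1)] M Y_max by blast
  thus ?thesis using M by simp
qed

text \<open>\<open>C\<close> is a neighbourhood of \<open>M\<close> on which values from stage
  \<open>n\<close> no longer change. The pole of \<open>z\<close> has order exactly 1 on all of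
  \<open>C\<close>, so \<open>q\<close> and \<open>q'\<close> generate everything positive on
  \<open>C\<close>; this ideal is radical since positivity is insensitive to powers.\<close>

lemma not_crit:
  assumes M: "M \<in> Y" and un: "\<And>M' x. M' \<in> Y \<Longrightarrow> M' \<inter> D n = M \<inter> D n \<Longrightarrow> x \<in> qf n \<Longrightarrow> x \<noteq> 0 \<Longrightarrow>
    val A M' x = vD n M' x"
  shows "center M \<notin> crit T"
proof -
  have Mm: "M \<in> max_spec A" using M Y_max by blast
  obtain z q q' where z: "z \<in> qf n" "z \<noteq> 0" "vD n M z = - 1"
    "\<And>M'. M' \<in> Y \<Longrightarrow> M' \<inter> D n \<noteq> M \<inter> D n \<Longrightarrow> 0 \<le> val A M' z"
    "q \<in> M \<inter> D n" "q' \<in> M \<inter> D n" "1 = q + z * q'" by (rule inverse_element[where n = n, OF Mm], rule that; assumption)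
  define C where "C = {M' \<in> Y. M' \<inter> D n = M \<inter> D n}"
  have C: "C \<subseteq> Y" "M \<in> C" using M by (auto simp: C_def)
  let ?J = "val_ge C 1"
  have "x \<in> ?J" if "x \<in> M \<inter> D n" for x
  proof -
    have "x \<in> center M'" if "M' \<in> C" for M' using M_center[of M'] that \<open>x \<in> M \<inter> D n\<close> by (auto simp: C_def)
    thus ?thesis using C by (auto simp: val_ge_def)
  qed
  hence qJ: "{q, q'} \<subseteq> ?J" using z by blast
  hence qT: "{q, q'} \<subseteq> T" by (auto simp: val_ge_def)
  note gi = T.generated_ideal[OF qT]
  have "?J = generated_ideal T {q, q'}"
  proof
    show "generated_ideal T {q, q'} \<subseteq> ?J" by (rule gi(3)[OF val_ge_ideal[OF C(1)] qJ])
    show "?J \<subseteq> generated_ideal T {q, q'}"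
    proof
      fix x assume x: "x \<in> ?J"
      show "x \<in> generated_ideal T {q, q'}"
      proof (cases "x = 0")
        case True thus ?thesis using T.idealD(2)[OF gi(1)] by simp
      next
        case False
        have xT: "x \<in> T" "\<And>M'. M' \<in> C \<Longrightarrow> 1 \<le> val A M' x" using x False by (auto simp: val_ge_def)
        have "x * z \<in> T"
        proof (rule mult_mem_T[OF xT(1) False z(1,2,4)])
          fix M' assume M': "M' \<in> Y" "M' \<inter> D n = M \<inter> D n"
          thus "0 \<le> val A M' x + val A M' z" using un[OF M' z(1,2)] z(3) xT(2)[of M'] by (simp add: C_def)
        qed
        thus ?thesis using decompose[OF _ _ z(7) gi(1) xT(1)] gi(2) by blast
      qed
    qed
  qed
  hence "finitely_generated_ideal T ?J" unfolding finitely_generated_ideal_def using qT by (intro exI[of _ "{q, q'}"]) auto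
  moreover have "radical_ideal T ?J" unfolding radical_ideal_def T.ideal_iff
  proof (intro conjI ballI allI impI val_ge_ideal[OF C(1)])
    fix x and k :: nat assume x: "x \<in> T" "x ^ k \<in> ?J"
    show "x \<in> ?J"
    proof (cases "x = 0")
      case False
      have "1 \<le> val A M' x" if M': "M' \<in> C" for M'
      proof -
        interpret w: valued_ring A M' "val A M'" using dv M' C by blast
        have "1 \<le> val A M' (x ^ k)" using x(2) False M' by (auto simp: val_ge_def)
        hence "0 < int k * val A M' x" using T_F[OF x(1)] False by simp
        thus ?thesis by (simp add: zero_less_mult_iff)
      qed
      thus ?thesis using x by (auto simp: val_ge_def)
    qed (simp add: val_ge_def)
  qed
  moreover have "?J \<noteq> {0}"
  proof
    assume "?J = {0}"
    hence "q = 0" "q' = 0" using qJ by auto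
    thus False using z(7) by simp
  qed
  moreover have "?J \<subseteq> center M" using C by (auto simp: val_ge_def)
  ultimately show ?thesis unfolding crit_def by blast
qed

text \<open>
  Some generator \<open>s0\<close> divides a power of an element \<open>y\<close> with value 1 at \<open>M'\<close>, while ramification forces
  all elements of \<open>I\<close> to have value at least 2 at \<open>M'\<close>.
\<close>

lemma in_crit:
  assumes M: "M \<in> Y" and ram: "\<And>n. \<exists>M'\<in>Y. M' \<inter> D n = M \<inter> D n \<and>
    (\<exists>e\<ge>2. \<forall>x\<in>qf n. x \<noteq> 0 \<longrightarrow> val A M' x = e * vD n M' x)"
  shows "center M \<in> crit T"
proof (rule ccontr)
  assume "center M \<notin> crit T"
  then obtain I where I: "finitely_generated_ideal T I" "radical_ideal T I" "I \<noteq> {0}" "I \<subseteq> center M"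
    using center_max[OF M] by (auto simp: crit_def)
  obtain S where S: "finite S" "S \<subseteq> T" "I = generated_ideal T S" using I(1) by (auto simp: finitely_generated_ideal_def)
  note gi = T.generated_ideal[OF S(2), folded S(3)]
  have Mm: "M \<in> max_spec A" using M Y_max by blast
  have "\<exists>s\<in>S. s \<noteq> 0"
  proof (rule ccontr)
    assume "\<not> ?thesis"
    hence "S \<subseteq> {0}" by blast
    moreover have "is_ideal T {0}" by (auto simp: is_ideal_def)
    ultimately have "I \<subseteq> {0}" using gi(3) by blast
    thus False using I(3) T.idealD(2)[OF gi(1)] by blast
  qed
  then obtain s0 where s0: "s0 \<in> S" "s0 \<noteq> 0" by blast
  \<comment> \<open>Finite generation enters here: all generators belong to one stage, and
    ramification after that stage doubles at least their values.\<close>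
  have "\<exists>n. S \<subseteq> qf n"
    using S(1,2)
  proof (induction S rule: finite_induct)
    case (insert s S)
    then obtain n where n: "S \<subseteq> qf n" by auto
    have "s \<in> quotient_field A" using insert.prems T_F by auto
    then obtain m where "n \<le> m" "s \<in> qf m" by (rule quotient_AE)
    thus ?case using n quotient_D_mono by (intro exI[of _ m]) blast
  qed auto
  then obtain n where n: "S \<subseteq> qf n" by blast
  obtain M' e where M': "M' \<in> Y" "M' \<inter> D n = M \<inter> D n" and e: "2 \<le> e"
    "\<And>x. x \<in> qf n \<Longrightarrow> x \<noteq> 0 \<Longrightarrow> val A M' x = e * vD n M' x" using ram[of n] by blast
  have "S \<subseteq> val_ge {M'} 2"
  proof
    fix s assume s: "s \<in> S"
    show "s \<in> val_ge {M'} 2"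
    proof (cases "s = 0")
      case False
      obtain e' where e': "1 \<le> e'" "val A M s = e' * vD n M s" using val_A[OF Mm, of n] subsetD[OF n s] False by metis
      have "s \<in> center M" using gi(2) I(4) s by blast
      hence "0 < e' * vD n M s" using e' False by (auto simp: val_ge_def)
      hence "1 \<le> vD n M s" using e'(1) by (simp add: zero_less_mult_iff)
      hence "2 * 1 \<le> e * vD n M s" using e(1) by (intro mult_mono) auto
      hence "2 \<le> val A M' s" using e(2)[of s] n s False M'(2) by auto
      thus ?thesis using S(2) s by (auto simp: val_ge_def)
    qed (simp add: val_ge_def)
  qed
  hence I2: "I \<subseteq> val_ge {M'} 2" using gi(3)[OF val_ge_ideal] M'(1) by blast
  interpret w: valued_ring A M' "val A M'" by (rule dv[OF M'(1)])
  obtain t where t: "t \<in> M'" "t \<in> A" "t \<noteq> 0" "val A M' t = 1" by (rule w.uniformizer)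
  obtain m where m: "n \<le> m" "t \<in> D m" using t(2) by (rule A_E1)
  interpret m: dedekind_like "D m" by (rule dedekind_like)
  have s0m: "s0 \<in> qf m" using quotient_D_mono[OF m(1)] n s0 by blast
  obtain c d where cd: "s0 = c / d" "c \<in> D m" "d \<in> D m" "d \<noteq> 0" using s0m by (rule m.quotient_fieldE)
  have cnz: "c \<noteq> 0" using cd s0 by auto
  define C where "C = {R \<in> max_spec (D m). c \<in> R}"
  have C: "finite C" using m.finite_containing[OF cd(2) cnz] by (simp add: C_def)
  \<comment> \<open>Makes \<open>y = t * u\<close> vanish at all zeros of the numerator
    \<open>c\<close> of \<open>s0\<close> while keeping value 1 at \<open>M'\<close>. The
    denominator \<open>d\<close> can only increase the value of \<open>y ^ j / s0\<close>.\<close>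
  obtain u where u: "u \<in> D m" "u \<notin> M' \<inter> D m" "\<forall>R\<in>C - {M' \<inter> D m}. u \<in> R"
    using m.max_spec_separate[OF max_trace[OF w.M], of "C - {M' \<inter> D m}"] C by (auto simp: C_def)
  define y where "y = t * u"
  have uA: "u \<in> A" "u \<notin> M'" using u D_A by auto
  have unz: "u \<noteq> 0" using uA w.M_0 by auto
  have y: "y \<in> D m" "y \<noteq> 0" using m u unz t by (auto simp: y_def)
  have vy: "val A M' y = 1" using w.v_eq_0[OF uA] t uA unz by (simp add: y_def)
  have yZ: "y \<in> R" if R: "R \<in> C" for R
  proof -
    have i: "is_ideal (D m) R" using R m.max_spec_ideal by (simp add: C_def)
    show ?thesis using m.idealD(4)[OF i, of t u] m.idealD(5)[OF i, of u t] u(3) R t m u(1) unfolding y_def by blast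
  qed
  \<comment> \<open>At least every value of \<open>c\<close> at its zeros, so that
    \<open>y ^ j / s0\<close> has no pole on \<open>Y\<close>.\<close>
  define j where "j = Suc (nat (\<Sum>R\<in>C. \<bar>val (D m) R c\<bar>))"
  have jZ: "val (D m) R c \<le> int j" if "R \<in> C" for R
  proof -
    have "\<bar>val (D m) R c\<bar> \<le> (\<Sum>R\<in>C. \<bar>val (D m) R c\<bar>)" using C that by (intro member_le_sum) auto
    thus ?thesis by (simp add: j_def)
  qed
  have xF: "y ^ j / s0 \<in> qf m" "y ^ j / s0 \<noteq> 0"
    using y s0 s0m m.quotient_field_closed m.subset_quotient_field by auto
  have "0 \<le> val A M'' (y ^ j / s0)" if M'': "M'' \<in> Y" for M''
  proof -
    have M''m: "M'' \<in> max_spec A" using M'' Y_max by blast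
    let ?R = "M'' \<inter> D m"
    interpret r: valued_ring "D m" ?R "val (D m) ?R" by (rule m.dval_val[OF max_trace[OF M''m]])
    have "val (D m) ?R (y ^ j / s0) = int j * val (D m) ?R y - (val (D m) ?R c - val (D m) ?R d)"
      unfolding cd(1) using y cd cnz by simp
    moreover have "0 \<le> val (D m) ?R d" by (rule r.v_nonneg[OF cd(3,4)])
    moreover have "val (D m) ?R c \<le> int j * val (D m) ?R y"
    proof (cases "?R \<in> C")
      case True
      have "0 < val (D m) ?R y" using r.v_pos[OF yZ[OF True] y(2)] .
      hence "int j * 1 \<le> int j * val (D m) ?R y" by (intro mult_left_mono) auto
      thus ?thesis using jZ[OF True] by simp
    next
      case False
      hence "val (D m) ?R c = 0" using r.v_eq_0[OF cd(2)] r.M by (auto simp: C_def)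
      thus ?thesis using r.v_nonneg[OF y] by simp
    qed
    ultimately have "0 \<le> val (D m) ?R (y ^ j / s0)" by simp
    moreover obtain e'' where "1 \<le> e''" "val A M'' (y ^ j / s0) = e'' * val (D m) ?R (y ^ j / s0)"
      using val_A[OF M''m, of m] xF by metis
    ultimately show ?thesis by simp
  qed
  hence "y ^ j / s0 \<in> T" using T_iff[OF quotient_D_A[OF xF(1)] xF(2)] by blast
  hence "y ^ j / s0 * s0 \<in> I" using T.idealD(4)[OF gi(1)] gi(2) s0 by blast
  hence "y ^ j \<in> I" using s0 by simp
  moreover have "y \<in> T" using A_T D_A y by blast
  ultimately have "y \<in> I" using I(2) by (auto simp: radical_ideal_def)
  hence "2 \<le> val A M' y" using I2 y by (auto simp: val_ge_def)
  thus False using vy by simp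
qed

end

section \<open>The iterated critical sets in terms of the rank\<close>

context tower begin

definition "Y \<delta> = {M \<in> max_spec A. \<delta> \<le> rnk M}"

lemma Y_nonempty: "\<delta> < \<alpha> \<Longrightarrow> Y \<delta> \<noteq> {}"
proof -
  assume "\<delta> < \<alpha>"
  then obtain Q where Q: "Q \<in> max_spec (D 0)" "lab 0 Q = \<delta>" using lab_onto by blast
  obtain M where "M \<in> max_spec A" "rnk M = lab 0 Q" using ex_branch[OF Q(1)] by blast
  thus ?thesis using Q by (auto simp: Y_def)
qed

text \<open>At a stage \<open>N\<close> where the label of \<open>M\<close> has reached its rank,
  that label bounds the rank of every \<open>M'\<close> with the same trace; so
  \<open>\<delta>\<close> is at most the rank of \<open>M\<close>.\<close>

lemma tower_closed: assumes "\<delta> < \<alpha>" shows "tower_closed D idx lab g \<alpha> (Y \<delta>)"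
proof
  show "Y \<delta> \<subseteq> max_spec A" "Y \<delta> \<noteq> {}" using Y_nonempty[OF assms] by (auto simp: Y_def)
  fix M assume M: "M \<in> max_spec A" and cl: "\<And>n. \<exists>M'\<in>Y \<delta>. M' \<inter> D n = M \<inter> D n"
  obtain N where N: "lab N (M \<inter> D N) = rnk M" using rnk_stable[OF M, of 0] by blast
  obtain M' where "M' \<in> Y \<delta>" "M' \<inter> D N = M \<inter> D N" using cl by blast
  hence "\<delta> \<le> rnk M" using rnk_le[of M' N] N by (auto simp: Y_def)
  thus "M \<in> Y \<delta>" using M by (simp add: Y_def)
qed

text \<open>If the rank of \<open>P\<close> exceeds \<open>\<delta>\<close>, then arbitrarily late a
  ramified branch of rank \<open>\<delta>\<close> leaves the branch of \<open>P\<close>. If it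
  equals \<open>\<delta>\<close>, then branches in \<open>Y \<delta>\<close> sharing the trace of
  \<open>P\<close> at a late stage have their labels squeezed to \<open>\<delta>\<close> and cannot
  ramify.\<close>

lemma crit_step:
  assumes d: "\<delta> < \<alpha>"
  defines "T \<equiv> (\<Inter>M\<in>Y \<delta>. localization A M)"
  shows "{P \<in> max_spec A. generated_ideal T P \<in> crit T} = {P \<in> max_spec A. \<delta> < rnk P}"
proof -
  interpret c: tower_closed D idx lab g \<alpha> "Y \<delta>" by (rule tower_closed[OF d])
  have T: "T = c.T" unfolding T_def c.T_def ..
  have "generated_ideal T P \<in> crit T \<longleftrightarrow> \<delta> < rnk P" if P: "P \<in> max_spec A" for P
  proof (cases "P \<in> Y \<delta>")
    case False
    hence "generated_ideal T P \<notin> crit T" using c.generated_max_imp_Y[OF P] by (auto simp: crit_def T)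
    thus ?thesis using False P by (auto simp: Y_def)
  next
    case PY: True
    show ?thesis
    proof (cases "\<delta> < rnk P")
      case True
      have "c.center P \<in> crit c.T"
      proof (rule c.in_crit[OF PY])
        fix n
        obtain N where N: "n \<le> N" "idx (P \<inter> D 0) \<le> N" "\<And>k. N \<le> k \<Longrightarrow> lab k (P \<inter> D k) = rnk P"
          using rnk_stable[OF P, of n] by metis
        \<comment> \<open>The label must drop to exactly \<open>\<delta>\<close>: a lower one could
          lead out of \<open>Y \<delta>\<close>, where the ramification would not be seen.\<close>
        obtain m where m: "N \<le> m" "g m (rnk P) = \<delta>" using g_cofinal[OF rnk_less[OF P] True] by blast
        have i: "P \<inter> D m \<inter> D 0 = P \<inter> D 0" by (rule int_D) simp
        have l: "lab m (P \<inter> D m) = rnk P" using N(3) m by blast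
        have nz: "\<not> zero_ordinal (rnk P)" using True by (auto simp: zero_ordinal_def)
        obtain R where R: "R \<in> max_spec (D (Suc m))" "R \<inter> D m = P \<inter> D m" "\<not> unramified (D m) (D (Suc m)) R"
          using ex_ram[OF max_trace[OF P]] i l nz N(2) m(1) by (metis order_trans)
        have R0: "R \<inter> D 0 = P \<inter> D 0" using R(2) i D_mono[of 0 m] by auto
        have lR: "lab (Suc m) R = \<delta>" using lab_Suc[OF R(1)] R R0 l m N(2) by simp
        obtain M' where M': "M' \<in> max_spec A" "M' \<inter> D (Suc m) = R" "rnk M' = lab (Suc m) R" by (rule ex_branch[OF R(1)])
        have nm: "n \<le> m" using N(1) m(1) by simp
        obtain e where e: "2 \<le> e" "\<And>x. x \<in> qf n \<Longrightarrow> x \<noteq> 0 \<Longrightarrow> val A M' x = e * vD n M' x"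
          using val_A_ramified[OF M'(1) nm] R(3) M'(2) by blast
        have "M' \<inter> D n = P \<inter> D n"
        proof -
          have "M' \<inter> D m = P \<inter> D m" using M'(2) R(2) int_D[of m "Suc m" M'] by simp
          thus ?thesis using int_D[OF nm] by metis
        qed
        moreover have "M' \<in> Y \<delta>" using M' lR by (simp add: Y_def)
        ultimately show "\<exists>M'\<in>Y \<delta>. M' \<inter> D n = P \<inter> D n \<and>
          (\<exists>e\<ge>2. \<forall>x\<in>qf n. x \<noteq> 0 \<longrightarrow> val A M' x = e * vD n M' x)"
          using e by blast
      qed
      thus ?thesis using True c.generated_center[OF PY] by (simp add: T)
    next
      case False
      hence rP: "rnk P = \<delta>" using PY by (auto simp: Y_def)
      obtain N where N: "idx (P \<inter> D 0) \<le> N" "lab N (P \<inter> D N) = \<delta>" using rnk_stable[OF P, of 0] rP by (metis order_refl)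
      have "c.center P \<notin> crit c.T"
      proof (rule c.not_crit[OF PY, of N])
        fix M' x assume M': "M' \<in> Y \<delta>" "M' \<inter> D N = P \<inter> D N" and x: "x \<in> qf N" "x \<noteq> 0"
        have Mm: "M' \<in> max_spec A" "\<delta> \<le> rnk M'" using M' by (auto simp: Y_def)
        have "M' \<inter> D 0 = P \<inter> D 0" using M'(2) int_D[of 0 N] by (metis le0)
        hence idx: "idx (M' \<inter> D 0) \<le> N" using N by simp
        have "lab k (M' \<inter> D k) = lab N (M' \<inter> D N)" if "N \<le> k" for k
          using lab_antimono[OF Mm(1) that] rnk_le[of M' k] Mm(2) N(2) M'(2) by auto
        thus "val A M' x = vD N M' x" by (rule val_A_stable[OF Mm(1) idx _ x])
      qed
      thus ?thesis using False c.generated_center[OF PY] by (simp add: T)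
    qed
  qed
  thus ?thesis by blast
qed

text \<open>At zero the recursion returns \<open>A\<close>, which is the intersection of its
  localizations; elsewhere nonemptiness of \<open>Y \<delta>\<close> excludes the quotient field
  case.\<close>

lemma overring_iter_eq:
  assumes d: "\<delta> < \<alpha>" and c: "crit_iter A \<delta> = Y \<delta>"
  shows "overring_iter A \<delta> = (\<Inter>M\<in>Y \<delta>. localization A M)"
proof (cases "zero_ordinal \<delta>")
  case True
  hence Y: "Y \<delta> = max_spec A" using c crit_iter_zero by metis
  have ov: "overring_iter A \<delta> = A" using True by (simp add: overring_iter.simps)
  have ne: "max_spec A \<noteq> {}" using Y_nonempty[OF d] Y by simp
  have "(\<Inter>M\<in>max_spec A. localization A M) = A"
  proof
    show "A \<subseteq> (\<Inter>M\<in>max_spec A. localization A M)"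
      using A.subset_localization by (auto simp: A.max_spec_iff)
    show "(\<Inter>M\<in>max_spec A. localization A M) \<subseteq> A"
    proof
      fix x assume x: "x \<in> (\<Inter>M\<in>max_spec A. localization A M)"
      obtain M where M: "M \<in> max_spec A" using ne by blast
      have "x \<in> quotient_field A"
        using A.localization_subset[OF valued_ring.M_0[OF A.dval_val[OF M]]] x M by blast
      thus "x \<in> A" by (rule A.in_all_localizations) (use x in blast)
    qed
  qed
  thus ?thesis using ov Y by simp
next
  case False
  thus ?thesis using c Y_nonempty[OF d] by (subst overring_iter.simps) simp
qed

lemma crit_iter_eq: "\<delta> \<le> \<alpha> \<Longrightarrow> crit_iter A \<delta> = Y \<delta>"
proof (induction \<delta> rule: less_induct)
  case (less \<delta>)
  consider "zero_ordinal \<delta>" | \<beta> where "successor_of \<beta> \<delta>" | "\<not> zero_ordinal \<delta>" "\<nexists>\<beta>. successor_of \<beta> \<delta>" by blast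
  thus ?case
  proof cases
    case 1
    hence "\<delta> \<le> \<gamma>" for \<gamma> unfolding zero_ordinal_def by (metis empty_iff lessThan_iff not_le)
    thus ?thesis using crit_iter_zero[OF 1] by (simp add: Y_def)
  next
    case (2 \<beta>)
    hence b: "\<beta> < \<delta>" "\<And>\<gamma>. \<beta> < \<gamma> \<Longrightarrow> \<delta> \<le> \<gamma>"
      unfolding successor_of_def by (auto, metis empty_iff greaterThanLessThan_iff not_le)
    hence ba: "\<beta> < \<alpha>" using less.prems by simp
    have c: "crit_iter A \<beta> = Y \<beta>" using less.IH[OF b(1)] ba by simp
    show ?thesis unfolding crit_iter_successor[OF 2] overring_iter_eq[OF ba c] crit_step[OF ba]
      unfolding Y_def using b by (auto intro: less_le_trans)
  next
    case 3
    have "crit_iter A \<delta> = (\<Inter>\<beta>\<in>{..<\<delta>}. Y \<beta>)"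
      unfolding crit_iter_limit[OF 3] using less by (intro INF_cong) auto
    also have "\<dots> = Y \<delta>"
    proof
      show "Y \<delta> \<subseteq> (\<Inter>\<beta>\<in>{..<\<delta>}. Y \<beta>)" by (auto simp: Y_def)
      show "(\<Inter>\<beta>\<in>{..<\<delta>}. Y \<beta>) \<subseteq> Y \<delta>"
      proof
        fix M assume M: "M \<in> (\<Inter>\<beta>\<in>{..<\<delta>}. Y \<beta>)"
        have ge: "\<beta> \<le> rnk M" if "\<beta> < \<delta>" for \<beta> using M that by (auto simp: Y_def)
        have "M \<in> max_spec A" using M 3(1) by (auto simp: Y_def zero_ordinal_def)
        moreover have "\<delta> \<le> rnk M"
        proof (rule ccontr)
          assume "\<not> \<delta> \<le> rnk M"
          hence r: "rnk M < \<delta>" by simp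
          then obtain \<gamma> where "rnk M < \<gamma>" "\<gamma> < \<delta>" using 3(2) by (auto simp: successor_of_def set_eq_iff)
          thus False using ge[of \<gamma>] by simp
        qed
        ultimately show "M \<in> Y \<delta>" by (simp add: Y_def)
      qed
    qed
    finally show ?thesis .
  qed
qed

lemma SP_rank: "has_SP_rank A \<alpha>"
  unfolding has_SP_rank_def
proof (intro conjI allI impI)
  show "crit_iter A \<alpha> = {}" using crit_iter_eq[of \<alpha>] rnk_less by (auto simp: Y_def not_le)
  fix \<beta> :: 'o assume "crit_iter A \<beta> = {}"
  thus "\<alpha> \<le> \<beta>" using crit_iter_eq[of \<beta>] Y_nonempty[of \<beta>] by (cases "\<beta> < \<alpha>") auto
qed

end

section \<open>Construction of the tower and the final choice of labels\<close>

lemma tower_exists: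
  fixes D0 :: "'k::alg_closed_field set" and \<alpha> :: "'o::wellorder"
  assumes dedekind_like: "dedekind_like D0" and inf: "infinite (max_spec D0)" and inj: "inj_on idx (max_spec D0)"
    and g_less: "\<And>n \<gamma>. \<not> zero_ordinal \<gamma> \<Longrightarrow> g n \<gamma> < \<gamma>"
    and g_cofinal: "\<And>\<gamma> \<delta> N. \<gamma> < \<alpha> \<Longrightarrow> \<delta> < \<gamma> \<Longrightarrow> \<exists>n\<ge>N. g n \<gamma> = \<delta>"
    and lab_image: "l0 ` max_spec D0 = {..<\<alpha>}"
  shows "\<exists>D lab. D 0 = D0 \<and> tower D idx lab g \<alpha>"
proof -
  \<comment> \<open>Dependent choice runs over pairs of a ring and a labelling of its maximal
    ideals.\<close>
  define P where "P n s \<longleftrightarrow> extends_domain D0 (fst s) \<and> (n = 0 \<longrightarrow> s = (D0, l0))"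
    for n :: nat and s :: "'k set \<times> ('k set \<Rightarrow> 'o)"
  define R where "R n s s' \<longleftrightarrow> extends_domain (fst s) (fst s') \<and>
      (\<forall>M\<in>max_spec (fst s'). snd s' M = (if idx (M \<inter> D0) \<le> n \<and> \<not> unramified (fst s) (fst s') M
        then g n (snd s (M \<inter> fst s)) else snd s (M \<inter> fst s))) \<and>
      (\<forall>M\<in>max_spec (fst s'). idx (M \<inter> D0) \<le> n \<longrightarrow> zero_ordinal (snd s (M \<inter> fst s)) \<longrightarrow> unramified (fst s) (fst s') M) \<and>
      (\<forall>Q\<in>max_spec (fst s). idx (Q \<inter> D0) \<le> n \<longrightarrow> (\<exists>M\<in>max_spec (fst s'). M \<inter> fst s = Q \<and> unramified (fst s) (fst s') M)) \<and>
      (\<forall>Q\<in>max_spec (fst s). idx (Q \<inter> D0) \<le> n \<longrightarrow> \<not> zero_ordinal (snd s Q) \<longrightarrow>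
        (\<exists>M\<in>max_spec (fst s'). M \<inter> fst s = Q \<and> \<not> unramified (fst s) (fst s') M))"
    for n :: nat and s s' :: "'k set \<times> ('k set \<Rightarrow> 'o)"
  have "\<exists>f. \<forall>n. P n (f n) \<and> R n (f n) (f (Suc n))"
  proof (rule dependent_nat_choice)
    show "\<exists>s. P 0 s" using extends_domain_refl[OF dedekind_like] by (auto simp: P_def)
    fix s n assume "P n s"
    then obtain E l where s: "s = (E, l)" and DE: "extends_domain D0 E" by (cases s) (auto simp: P_def)
    \<comment> \<open>The ideals under control at stage \<open>n\<close>; this set is finite because
      \<open>idx\<close> is injective and finitely many ideals lie over each one. Those of label
      zero will be the set without ramification.\<close>
    define T where "T = {Q \<in> max_spec E. Q \<inter> D0 \<in> {P \<in> max_spec D0. idx P \<le> n}}"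
    have T_iff: "Q \<in> T \<longleftrightarrow> idx (Q \<inter> D0) \<le> n" if "Q \<in> max_spec E" for Q
      using extends_domainD(5)[OF DE that] that by (simp add: T_def)
    have "finite {P \<in> max_spec D0. idx P \<le> n}"
    proof (rule inj_on_finite[of idx _ "{..n}"])
      show "inj_on idx {P \<in> max_spec D0. idx P \<le> n}" using inj by (rule inj_on_subset) auto
    qed auto
    hence fT: "finite T" unfolding T_def by (intro finite_over_max[OF DE]) auto
    have "infinite (max_spec E)"
    proof
      assume "finite (max_spec E)"
      moreover have "max_spec D0 \<subseteq> (\<lambda>M. M \<inter> D0) ` max_spec E" using extends_domainD(6)[OF DE] by blast
      ultimately show False using inf finite_surj by blast
    qed
    moreover have "T \<subseteq> max_spec E" "{Q \<in> T. zero_ordinal (l Q)} \<subseteq> T" by (auto simp: T_def)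
    ultimately have "\<exists>E'. extends_domain E E' \<and>
      (\<forall>M\<in>max_spec E'. M \<inter> E \<in> {Q \<in> T. zero_ordinal (l Q)} \<longrightarrow> unramified E E' M) \<and>
      (\<forall>Q\<in>T. \<exists>M\<in>max_spec E'. M \<inter> E = Q \<and> unramified E E' M) \<and>
      (\<forall>Q\<in>T - {Q \<in> T. zero_ordinal (l Q)}. \<exists>M\<in>max_spec E'. M \<inter> E = Q \<and> \<not> unramified E E' M)"
      by (intro prescribed_extension[OF extends_domainD(2)[OF DE] _ fT])
    then obtain E' where E': "extends_domain E E'"
      "\<forall>M\<in>max_spec E'. M \<inter> E \<in> {Q \<in> T. zero_ordinal (l Q)} \<longrightarrow> unramified E E' M"
      "\<forall>Q\<in>T. \<exists>M\<in>max_spec E'. M \<inter> E = Q \<and> unramified E E' M"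
      "\<forall>Q\<in>T - {Q \<in> T. zero_ordinal (l Q)}. \<exists>M\<in>max_spec E'. M \<inter> E = Q \<and> \<not> unramified E E' M"
      by (elim exE conjE)
    define l' where "l' M = (if idx (M \<inter> D0) \<le> n \<and> \<not> unramified E E' M then g n (l (M \<inter> E)) else l (M \<inter> E))" for M
    have eq: "(M \<inter> E) \<inter> D0 = M \<inter> D0" for M using extends_domain_subset[OF DE] by blast
    have "R n s (E', l')" unfolding R_def s fst_conv snd_conv
    proof (intro conjI ballI impI)
      fix M assume M: "M \<in> max_spec E'" "idx (M \<inter> D0) \<le> n" "zero_ordinal (l (M \<inter> E))"
      show "unramified E E' M" by (rule E'(2)[rule_format, OF M(1)]) (use M eq T_iff[OF extends_domainD(5)[OF E'(1) M(1)]] in simp)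
    qed (use E' T_iff in \<open>simp_all add: l'_def\<close>)
    moreover have "P (Suc n) (E', l')" using extends_domain_trans[OF DE E'(1)] by (simp add: P_def)
    ultimately show "\<exists>s'. P (Suc n) s' \<and> R n s s'" by blast
  qed
  then obtain f where f: "\<And>n. P n (f n)" "\<And>n. R n (f n) (f (Suc n))" by blast
  have f0: "f 0 = (D0, l0)" using f(1)[of 0] by (simp add: P_def)
  have "tower (\<lambda>n. fst (f n)) idx (\<lambda>n. snd (f n)) g \<alpha>"
  proof
    fix n
    note r = f(2)[of n, unfolded R_def]
    show "extends_domain (fst (f n)) (fst (f (Suc n)))" using r by blast
    fix M assume "M \<in> max_spec (fst (f (Suc n)))"
    thus "snd (f (Suc n)) M = (if idx (M \<inter> fst (f 0)) \<le> n \<and> \<not> unramified (fst (f n)) (fst (f (Suc n))) M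
        then g n (snd (f n) (M \<inter> fst (f n))) else snd (f n) (M \<inter> fst (f n)))" using r by (simp add: f0)
  next
    fix n M
    note r = f(2)[of n, unfolded R_def]
    assume "M \<in> max_spec (fst (f (Suc n)))" "idx (M \<inter> fst (f 0)) \<le> n" "zero_ordinal (snd (f n) (M \<inter> fst (f n)))"
    thus "unramified (fst (f n)) (fst (f (Suc n))) M" using r by (simp add: f0)
  next
    fix n Q
    note r = f(2)[of n, unfolded R_def]
    assume "Q \<in> max_spec (fst (f n))" "idx (Q \<inter> fst (f 0)) \<le> n"
    thus "\<exists>M\<in>max_spec (fst (f (Suc n))). M \<inter> fst (f n) = Q \<and> unramified (fst (f n)) (fst (f (Suc n))) M" using r by (simp add: f0)
  next
    fix n Q
    note r = f(2)[of n, unfolded R_def]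
    assume "Q \<in> max_spec (fst (f n))" "idx (Q \<inter> fst (f 0)) \<le> n" "\<not> zero_ordinal (snd (f n) Q)"
    thus "\<exists>M\<in>max_spec (fst (f (Suc n))). M \<inter> fst (f n) = Q \<and> \<not> unramified (fst (f n)) (fst (f (Suc n))) M" using r by (simp add: f0)
  next
    fix Q assume "Q \<in> max_spec (fst (f 0))"
    thus "snd (f 0) Q < \<alpha>" using lab_image by (auto simp: f0)
  next
    fix \<delta> assume "\<delta> < \<alpha>"
    hence "\<delta> \<in> l0 ` max_spec D0" using lab_image by simp
    thus "\<exists>Q\<in>max_spec (fst (f 0)). snd (f 0) Q = \<delta>" by (auto simp: f0)
  qed (use g_less g_cofinal in auto)
  thus ?thesis using f0 by (intro exI[of _ "\<lambda>n. fst (f n)"] exI[of _ "\<lambda>n. snd (f n)"]) simp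
qed

theorem theorem6p3:
  fixes D :: "'a::field set" and \<alpha> :: "'o::wellorder"
  assumes "dedekind_domain D"
    and "countable (max_spec D)" and "infinite (max_spec D)"
    and "\<not> zero_ordinal \<alpha>" and "countable {..<\<alpha>}"
  shows "\<exists>A :: 'a alg_closure set.
    almost_dedekind_domain A \<and> integral_extension (to_ac ` D) A \<and> has_SP_rank A \<alpha>"
proof -
  interpret dedekind D by unfold_locales fact
  define D0 where "D0 = (to_ac ` D :: 'a alg_closure set)"
  have dl0: "dedekind_like D0" unfolding D0_def by (rule to_ac.dedekind_like_image) (rule dedekind_like_axioms)
  have ms: "max_spec D0 = (`) to_ac ` max_spec D" unfolding D0_def by (rule to_ac.max_spec_image) (rule field_subring_axioms)
  have "inj_on ((`) to_ac :: 'a set \<Rightarrow> 'a alg_closure set) (max_spec D)"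
    using to_ac.inj_h by (simp add: inj_on_def inj_image_eq_iff)
  hence inf: "infinite (max_spec D0)" unfolding ms using assms(3) by (simp add: finite_image_iff)
  have cnt: "countable (max_spec D0)" unfolding ms using assms(2) by simp
  define idx where "idx = to_nat_on (max_spec D0)"
  have bij: "bij_betw idx (max_spec D0) UNIV" unfolding idx_def by (rule to_nat_on_infinite[OF cnt inf])
  \<comment> \<open>Only the first component of the pair coded by \<open>n\<close> is used, so each
    member of the enumeration of \<open>{..<\<gamma>}\<close> recurs for infinitely many
    \<open>n\<close>.\<close>
  define g where "g n \<gamma> = from_nat_into {..<\<gamma>} (fst (prod_decode n))" for n and \<gamma> :: 'o
  have "\<exists>D lab. D 0 = D0 \<and> tower D idx lab g \<alpha>"
  proof (rule tower_exists[OF dl0 inf, where ?l0.0 = "\<lambda>Q. from_nat_into {..<\<alpha>} (idx Q)"])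
    show "inj_on idx (max_spec D0)" using bij by (rule bij_betw_imp_inj_on)
    show "g n \<gamma> < \<gamma>" if "\<not> zero_ordinal \<gamma>" for n \<gamma>
      using from_nat_into[of "{..<\<gamma>}"] that by (simp add: g_def zero_ordinal_def)
    show "\<exists>n\<ge>N. g n \<gamma> = \<delta>" if h: "\<gamma> < \<alpha>" "\<delta> < \<gamma>" for \<gamma> \<delta> N
    proof -
      have "countable {..<\<gamma>}" by (rule countable_subset[OF _ assms(5)]) (use h in auto)
      then obtain k where "from_nat_into {..<\<gamma>} k = \<delta>" using from_nat_into_surj[of "{..<\<gamma>}" \<delta>] h by auto
      thus ?thesis by (intro exI[of _ "prod_encode (k, N)"]) (simp add: g_def le_prod_encode_2)
    qed
    \<comment> \<open>As \<open>idx\<close> is onto the natural numbers, composing it with an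
      enumeration of \<open>{..<\<alpha>}\<close> reaches every label.\<close>
    have "(\<lambda>Q. from_nat_into {..<\<alpha>} (idx Q)) ` max_spec D0 = range (from_nat_into {..<\<alpha>})"
      using bij_betw_imp_surj_on[OF bij] by (metis image_image)
    also have "\<dots> = {..<\<alpha>}" by (rule range_from_nat_into) (use assms(4,5) in \<open>auto simp: zero_ordinal_def\<close>)
    finally show "(\<lambda>Q. from_nat_into {..<\<alpha>} (idx Q)) ` max_spec D0 = {..<\<alpha>}" .
  qed
  then obtain E lab where E: "E 0 = D0" "tower E idx lab g \<alpha>" by blast
  interpret t: tower E idx lab g \<alpha> by (rule E(2))
  show ?thesis using t.almost_dedekind t.integral t.SP_rank by (intro exI[of _ t.A]) (simp add: E(1) D0_def)
qed

end
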